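(* Suppose that for each $\hat\rho_e\ge1$ the state $\mu_e^{(\hat\rho_e)}$ is the unique stationary state (translation invariant or not) of the SSM on $\widehat X_e^*$ with density $\hat\rho_e$. Then the regular ETIS states of the F-SSEP with density $\rho>1/2$ are the states $\Phi_\phi(\mu^{(\hat\rho,\lambda)})$, where $\hat\rho>1$, $\lambda$ is an ergodic translation invariant probability measure on $S=\{0,1\}^{\mathbb Z}$ of density $\kappa\le\hat\rho-1$, and $\mu^{(\hat\rho,\lambda)}:=\gamma_*(\mu_e^{(\hat\rho-\kappa)}\times\lambda)$; the state $\Phi_\phi(\mu^{(\hat\rho,\lambda)})$ has density $\hat\rho/(1+\hat\rho)$.
   Context: F-SSEP: the discrete-time Markov process on $X=\{0,1\}^{\mathbb Z}$ in which, in passing from $\eta_t$ to $\eta_{t+1}$, every particle (site $i$ with $\eta_t(i)=1$) with exactly one occupied neighboring site attempts to jump to its empty neighboring site; the jump takes place unless two particles attempt to jump to the same site, in which case one of the two, chosen with probability $1/2$ each (independently for different sites), succeeds. SSM (symmetric stack model): the discrete-time Markov process on $\widehat X=\mathbb Z_+^{\mathbb Z}$, $\mathbb Z_+=\{0,1,2,\dots\}$. A stack $\mathbf n(i)$ is short if $\mathbf n(i)\le1$ and tall otherwise. In passing from $\mathbf n_t$ to $\mathbf n_{t+1}$, simultaneously for each bond $\langle k,k+1\rangle$: if both stacks are short no particle crosses the bond; if one is short and one tall, one particle moves from the tall to the short stack; if both are tall, one particle moves across the bond in a direction chosen with probability $1/2$ each (independently for different bonds). $\widehat X^*\subset\widehat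 X$ is the set of configurations with no two adjacent short stacks, and $\widehat X^*_e\subset\widehat X^*$ is the subset of configurations with every $\mathbf n(i)$ even; both are invariant under the SSM dynamics. $\gamma:\widehat X^*_e\times S\to\widehat X^*$ is $\gamma(\mathbf m,\sigma)=\mathbf m+\sigma$ (site by site), and $f_*$ denotes push-forward of measures. States are Borel probability measures; TI = translation invariant; TIS = TI and stationary; ETIS = extremal among TIS states. A TI state on $X$ is regular if it gives probability zero to the configuration with $\eta(i)=1$ for all $i$. A state has density $\hat\rho$ if almost every configuration $\mathbf n$ satisfies $\lim_{N}\frac1N\sum_{i=1}^N\mathbf n(i)=\lim_{N}\frac1N\sum_{i=-N}^{-1}\mathbf n(i)=\hat\rho$ (same definition on $X$ and $S$). For $\hat\rho_e\ge1$, $\mu_e^{(\hat\rho_e)}$ is the state on $\widehat X_e^*$ defined, with $\zeta=(\hat\rho_e-1)/\hat\rho_e\in[0,1)$, as the weak limit (convergence of probabilities of events depending on finitely many sites) as $L\to\infty$ of the measures $\mu^{(\zeta,L)}$ on a ring of $2L+1$ sites indexed by $\{-L,\dots,L\}$, where $\mu^{(\zeta,L)}$ is supported on those $\mathbf n\in\mathbb Z_+^{\{-L,\dots,L\}}$ with all $\mathbf n(i)$ even and no two (cyclically) adjacent zeros, with $\mu^{(\zeta,L)}(\mathbf n)$ proportional to $\zeta^{\sum_i\mathbf n(i)-2L-2}\,4^{-|\{i:\mathbf n(i)=0\}|}$ (convention $0^0=1$). This limit exists and is a TIS state of the SSM on $\widehat X^*_e$ of density $\hat\rho_e$. Substitution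 map $\phi:\widehat X\to X$: $\phi(\mathbf n)$ is obtained by replacing each $\mathbf n(i)$ by the word $0\,1^{\mathbf n(i)}$ and concatenating, with the word for $\mathbf n(1)$ beginning at site 1. With $(\tau\eta)(i)=\eta(i-1)$, for a TI state $\hat\nu$ on $\widehat X$ with finite mean stack height, $\Phi_\phi(\hat\nu)=Z_{\hat\nu}^{-1}\sum_{n\ge0}\sum_{j=0}^{n}(\tau^{-j}\circ\phi)_*\bigl(\hat\nu|_{\{\mathbf n(1)=n\}}\bigr)$, where $Z_{\hat\nu}=\sum_{n\ge0}(n+1)\hat\nu(\mathbf n(1)=n)$. *)

theory Defs
  imports "HOL-Probability.Probability"
begin

section \<open>Configurations and states\<close>

text \<open>
  Configurations are functions on the integers: \<^typ>\<open>int \<Rightarrow> nat\<close> for the space of stack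
  configurations, and \<^typ>\<open>int \<Rightarrow> bool\<close> for both copies of \<open>{0,1}\<close>-valued configurations, where
  \<^term>\<open>True\<close> stands for 1.  The lemmas \<open>sets_config_space_nat\<close> and \<open>sets_config_space_bool\<close>
  below show that the product sigma algebra is the Borel one.
\<close>

definition config_space :: "(int \<Rightarrow> 'a) measure" where
  "config_space = PiM UNIV (\<lambda>_. count_space UNIV)"

definition state :: "(int \<Rightarrow> 'a) measure \<Rightarrow> bool" where
  "state \<mu> \<longleftrightarrow> prob_space \<mu> \<and> sets \<mu> = sets config_space"

text \<open>\<^term>\<open>translate k\<close> is the \<open>k\<close>-th power of the shift, for every integer \<open>k\<close>.\<close>

definition translate :: "int \<Rightarrow> (int \<Rightarrow> 'a) \<Rightarrow> (int \<Rightarrow> 'a)" where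
  "translate k \<eta> = (\<lambda>i. \<eta> (i - k))"

definition translation_invariant :: "(int \<Rightarrow> 'a) measure \<Rightarrow> bool" where
  "translation_invariant \<mu> \<longleftrightarrow> distr \<mu> config_space (translate 1) = \<mu>"

definition ergodic_TI :: "(int \<Rightarrow> 'a) measure \<Rightarrow> bool" where
  "ergodic_TI \<mu> \<longleftrightarrow> state \<mu> \<and> translation_invariant \<mu> \<and>
     (\<forall>A \<in> sets \<mu>. translate 1 -` A = A \<longrightarrow> measure \<mu> A = 0 \<or> measure \<mu> A = 1)"

text \<open>
  The argument \<open>v\<close> turns a single-site value into a number; it is \<^term>\<open>real\<close> for stack
  configurations and \<^term>\<open>of_bool\<close> for \<open>{0,1}\<close>-valued ones.
\<close>

definition has_density :: "('a \<Rightarrow> real) \<Rightarrow> (int \<Rightarrow> 'a) measure \<Rightarrow> real \<Rightarrow> bool" where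
  "has_density v \<mu> \<rho> \<longleftrightarrow>
     (AE \<eta> in \<mu>.
        (\<lambda>N. (\<Sum>i \<in> {1..int N}. v (\<eta> i)) / real N) \<longlonglongrightarrow> \<rho> \<and>
        (\<lambda>N. (\<Sum>i \<in> {- int N..-1}. v (\<eta> i)) / real N) \<longlonglongrightarrow> \<rho>)"

text \<open>In the following \<open>K\<close> is the one-step transition kernel of a discrete-time Markov process.\<close>

definition stationary ::
  "((int \<Rightarrow> 'a) \<Rightarrow> (int \<Rightarrow> 'a) measure) \<Rightarrow> (int \<Rightarrow> 'a) measure \<Rightarrow> bool" where
  "stationary K \<mu> \<longleftrightarrow> \<mu> \<bind> K = \<mu>"

definition TIS ::
  "((int \<Rightarrow> 'a) \<Rightarrow> (int \<Rightarrow> 'a) measure) \<Rightarrow> (int \<Rightarrow> 'a) measure \<Rightarrow> bool" where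
  "TIS K \<mu> \<longleftrightarrow> state \<mu> \<and> translation_invariant \<mu> \<and> stationary K \<mu>"

definition ETIS ::
  "((int \<Rightarrow> 'a) \<Rightarrow> (int \<Rightarrow> 'a) measure) \<Rightarrow> (int \<Rightarrow> 'a) measure \<Rightarrow> bool" where
  "ETIS K \<mu> \<longleftrightarrow> TIS K \<mu> \<and>
     (\<forall>\<mu>1 \<mu>2 c. TIS K \<mu>1 \<and> TIS K \<mu>2 \<and> 0 < c \<and> c < 1 \<and>
        (\<forall>A \<in> sets config_space. measure \<mu> A = c * measure \<mu>1 A + (1 - c) * measure \<mu>2 A)
        \<longrightarrow> \<mu>1 = \<mu>2)"

definition regular :: "(int \<Rightarrow> bool) measure \<Rightarrow> bool" where
  "regular \<mu> \<longleftrightarrow> state \<mu> \<and> translation_invariant \<mu> \<and> measure \<mu> {\<lambda>_. True} = 0"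


section \<open>The two Markov processes\<close>

text \<open>Independent fair coins, one for each site (F-SSEP) or for each bond (SSM).\<close>

definition coins :: "(int \<Rightarrow> bool) measure" where
  "coins = PiM UNIV (\<lambda>_. measure_pmf (bernoulli_pmf (1/2)))"

text \<open>
  The particle at \<open>i\<close> attempts to jump to \<open>i + d\<close>, where \<open>d\<close> is \<open>1\<close> or \<open>-1\<close>.
\<close>

definition fssep_attempts :: "(int \<Rightarrow> bool) \<Rightarrow> int \<Rightarrow> int \<Rightarrow> bool" where
  "fssep_attempts \<eta> i d \<longleftrightarrow> \<eta> i \<and> \<not> \<eta> (i + d) \<and> \<eta> (i - d)"

text \<open>
  The coin at a site \<open>j\<close> matters only if both neighbors of \<open>j\<close> attempt to jump to \<open>j\<close>;
  if it shows \<^term>\<open>True\<close> the particle coming from \<open>j - 1\<close> succeeds.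
\<close>

definition fssep_jumps :: "(int \<Rightarrow> bool) \<Rightarrow> (int \<Rightarrow> bool) \<Rightarrow> int \<Rightarrow> int \<Rightarrow> bool" where
  "fssep_jumps \<omega> \<eta> i d \<longleftrightarrow> fssep_attempts \<eta> i d \<and>
     (fssep_attempts \<eta> (i + 2 * d) (- d) \<longrightarrow> (\<omega> (i + d) \<longleftrightarrow> d = 1))"

definition fssep_step :: "(int \<Rightarrow> bool) \<Rightarrow> (int \<Rightarrow> bool) \<Rightarrow> (int \<Rightarrow> bool)" where
  "fssep_step \<omega> \<eta> = (\<lambda>i.
     if \<eta> i then \<not> fssep_jumps \<omega> \<eta> i 1 \<and> \<not> fssep_jumps \<omega> \<eta> i (-1)
     else fssep_jumps \<omega> \<eta> (i - 1) 1 \<or> fssep_jumps \<omega> \<eta> (i + 1) (-1))"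

definition fssep :: "(int \<Rightarrow> bool) \<Rightarrow> (int \<Rightarrow> bool) measure" where
  "fssep \<eta> = distr coins config_space (\<lambda>\<omega>. fssep_step \<omega> \<eta>)"

definition short :: "nat \<Rightarrow> bool" where
  "short h \<longleftrightarrow> h \<le> 1"

text \<open>The net number of particles crossing the bond from \<open>k\<close> to \<open>k + 1\<close>; the coin is indexed by \<open>k\<close>.\<close>

definition ssm_current :: "(int \<Rightarrow> bool) \<Rightarrow> (int \<Rightarrow> nat) \<Rightarrow> int \<Rightarrow> int" where
  "ssm_current \<omega> n k =
     (if short (n k) \<and> short (n (k + 1)) then 0
      else if short (n (k + 1)) then 1
      else if short (n k) then -1
      else if \<omega> k then 1 else -1)"

text \<open>The argument of \<^term>\<open>nat\<close> is never negative, since short stacks do not lose particles.\<close>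

definition ssm_step :: "(int \<Rightarrow> bool) \<Rightarrow> (int \<Rightarrow> nat) \<Rightarrow> (int \<Rightarrow> nat)" where
  "ssm_step \<omega> n = (\<lambda>i. nat (int (n i) + ssm_current \<omega> n (i - 1) - ssm_current \<omega> n i))"

definition ssm :: "(int \<Rightarrow> nat) \<Rightarrow> (int \<Rightarrow> nat) measure" where
  "ssm n = distr coins config_space (\<lambda>\<omega>. ssm_step \<omega> n)"

definition X_star :: "(int \<Rightarrow> nat) set" where
  "X_star = {n. \<forall>i. \<not> (short (n i) \<and> short (n (i + 1)))}"

definition X_star_even :: "(int \<Rightarrow> nat) set" where
  "X_star_even = {n \<in> X_star. \<forall>i. even (n i)}"

text \<open>A state on a subset of the configuration space is a state giving that subset full measure.\<close>

definition state_on :: "(int \<Rightarrow> 'a) set \<Rightarrow> (int \<Rightarrow> 'a) measure \<Rightarrow> bool" where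
  "state_on X \<mu> \<longleftrightarrow> state \<mu> \<and> (AE n in \<mu>. n \<in> X)"


section \<open>The states \<open>\<mu>\<^sub>e\<close>\<close>

definition ring_sites :: "nat \<Rightarrow> int set" where
  "ring_sites L = {- int L..int L}"

definition ring_configs :: "nat \<Rightarrow> (int \<Rightarrow> nat) set" where
  "ring_configs L = {n \<in> ring_sites L \<rightarrow>\<^sub>E UNIV.
     (\<forall>i \<in> ring_sites L. even (n i)) \<and>
     (\<forall>i \<in> ring_sites L. \<not> (n i = 0 \<and> n (if i = int L then - int L else i + 1) = 0))}"

text \<open>
  On \<^term>\<open>ring_configs L\<close> the truncated subtraction is an ordinary one: at most \<open>L\<close> of the \<open>2 L + 1\<close>
  sites are empty, so the sum is at least \<open>2 L + 2\<close>.
\<close>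

definition ring_weight :: "real \<Rightarrow> nat \<Rightarrow> (int \<Rightarrow> nat) \<Rightarrow> real" where
  "ring_weight \<zeta> L n = \<zeta> ^ ((\<Sum>i \<in> ring_sites L. n i) - (2 * L + 2)) *
     (1 / 4) ^ card {i \<in> ring_sites L. n i = 0}"

definition ring_measure :: "real \<Rightarrow> nat \<Rightarrow> (int \<Rightarrow> nat) measure" where
  "ring_measure \<zeta> L = point_measure (ring_configs L)
     (\<lambda>n. ennreal (ring_weight \<zeta> L n / (\<Sum>\<^sub>\<infinity>m \<in> ring_configs L. ring_weight \<zeta> L m)))"

text \<open>
  The limit is taken along events depending only on the sites in a finite set \<open>F\<close>, which is contained
  in \<^term>\<open>ring_sites L\<close> for all large \<open>L\<close>.
\<close>

definition is_ring_limit :: "real \<Rightarrow> (int \<Rightarrow> nat) measure \<Rightarrow> bool" where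
  "is_ring_limit \<zeta> \<mu> \<longleftrightarrow>
     (\<forall>F B. finite F \<longrightarrow>
        (\<lambda>L. measure (ring_measure \<zeta> L) {n \<in> ring_configs L. restrict n F \<in> B})
          \<longlonglongrightarrow> measure \<mu> {n. restrict n F \<in> B})"

definition mu_e :: "real \<Rightarrow> (int \<Rightarrow> nat) measure" where
  "mu_e \<rho> = (THE \<mu>. state \<mu> \<and> is_ring_limit ((\<rho> - 1) / \<rho>) \<mu>)"


section \<open>The states on stack configurations obtained from \<open>\<mu>\<^sub>e\<close>\<close>

definition gamma_map :: "(int \<Rightarrow> nat) \<times> (int \<Rightarrow> bool) \<Rightarrow> (int \<Rightarrow> nat)" where
  "gamma_map = (\<lambda>(m, \<sigma>) i. m i + of_bool (\<sigma> i))"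

text \<open>The argument \<open>\<kappa>\<close> is meant to be the density of \<open>lam\<close>, which \<open>lam\<close> determines.\<close>

definition mu_hat :: "real \<Rightarrow> real \<Rightarrow> (int \<Rightarrow> bool) measure \<Rightarrow> (int \<Rightarrow> nat) measure" where
  "mu_hat \<rho> \<kappa> lam = distr (mu_e (\<rho> - \<kappa>) \<Otimes>\<^sub>M lam) config_space gamma_map"


section \<open>The substitution map\<close>

text \<open>The site at which the word for stack \<open>i\<close>, a zero followed by \<open>n i\<close> ones, begins.\<close>

definition word_start :: "(int \<Rightarrow> nat) \<Rightarrow> int \<Rightarrow> int" where
  "word_start n i =
     (if 1 \<le> i then 1 + (\<Sum>k \<in> {1..<i}. (int (n k) + 1)) else 1 - (\<Sum>k \<in> {i..<1}. (int (n k) + 1)))"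

definition subst_map :: "(int \<Rightarrow> nat) \<Rightarrow> (int \<Rightarrow> bool)" where
  "subst_map n = (\<lambda>x. x \<notin> range (word_start n))"

definition Phi_Z :: "(int \<Rightarrow> nat) measure \<Rightarrow> ennreal" where
  "Phi_Z \<nu> = (\<Sum>n. of_nat (n + 1) * emeasure \<nu> {m. m 1 = n})"

definition Phi :: "(int \<Rightarrow> nat) measure \<Rightarrow> (int \<Rightarrow> bool) measure" where
  "Phi \<nu> = measure_of UNIV (sets config_space)
     (\<lambda>A. (\<Sum>n. \<Sum>j\<le>n. emeasure (distr (restrict_space \<nu> {m. m 1 = n}) config_space
                                 (translate (- int j) \<circ> subst_map)) A) / Phi_Z \<nu>)"


section \<open>Measurability\<close>

lemma space_config_space [simp]: "space config_space = UNIV"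
  by (simp add: config_space_def space_PiM)

instance bool :: second_countable_topology
proof
  have "open = generate_topology (UNIV :: bool set set)"
    by (simp add: fun_eq_iff Topological_Spaces.open_discrete generate_topology.Basis)
  then show "\<exists>B :: bool set set. countable B \<and> open = generate_topology B"
    by (intro exI[of _ UNIV]) auto
qed

lemma sets_borel_discrete:
  "sets (borel :: 'a :: {discrete_topology} measure) = sets (count_space UNIV)"
  by (simp add: set_eq_iff borel_open Topological_Spaces.open_discrete)

lemma sets_config_space_nat: "sets (config_space :: (int \<Rightarrow> nat) measure) = sets borel"
  unfolding config_space_def sets_PiM_equal_borel[symmetric]
  by (intro sets_PiM_cong refl) (simp add: sets_borel_discrete)

lemma sets_config_space_bool: "sets (config_space :: (int \<Rightarrow> bool) measure) = sets borel"
  unfolding config_space_def sets_PiM_equal_borel[symmetric]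
  by (intro sets_PiM_cong refl) (simp add: sets_borel_discrete)

text \<open>The kernels are measurable, as the definition of \<^term>\<open>stationary\<close> through \<^const>\<open>bind\<close> needs.\<close>

lemma measurable_config_component [measurable]:
  "(\<lambda>\<eta>. \<eta> i) \<in> measurable config_space (count_space UNIV)"
  unfolding config_space_def by measurable

lemma sets_coins [measurable_cong]: "sets coins = sets config_space"
  unfolding coins_def config_space_def by (intro sets_PiM_cong refl) simp

lemma prob_space_coins: "prob_space coins"
  unfolding coins_def by (intro prob_space_PiM measure_pmf.prob_space_axioms)

lemma measurable_into_config_space:
  assumes "\<And>i. (\<lambda>x. f x i) \<in> measurable M (count_space UNIV)"
  shows "f \<in> measurable M config_space"
  unfolding config_space_def
  by (rule measurable_PiM_single') (use assms in auto)

lemma measurable_kernel_from_coins: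
  assumes "(\<lambda>(\<eta>, \<omega>). f \<omega> \<eta>) \<in> measurable (config_space \<Otimes>\<^sub>M coins) config_space"
  shows "(\<lambda>\<eta>. distr coins config_space (\<lambda>\<omega>. f \<omega> \<eta>)) \<in> measurable config_space (subprob_algebra config_space)"
proof (rule measurable_distr2)
  show "(\<lambda>_. coins) \<in> measurable config_space (subprob_algebra coins)"
    using prob_space_coins
    by (intro measurable_const) (simp add: space_subprob_algebra prob_space_imp_subprob_space)
qed (use assms in simp)

lemma measurable_countable2:
  fixes f :: "'a \<Rightarrow> 'b :: countable" and g :: "'a \<Rightarrow> 'c :: countable"
  assumes "f \<in> measurable M (count_space UNIV)" "g \<in> measurable M (count_space UNIV)"
  shows "(\<lambda>x. h (f x) (g x)) \<in> measurable M (count_space UNIV)"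
proof (rule measurable_compose_countable[OF _ assms(1)])
  fix a
  show "(\<lambda>x. h a (g x)) \<in> measurable M (count_space UNIV)"
    by (rule measurable_compose[OF assms(2)]) simp
qed

lemma measurable_fst_component:
  "(\<lambda>x. fst x i) \<in> measurable (config_space \<Otimes>\<^sub>M coins) (count_space UNIV)"
  by (rule measurable_compose[OF measurable_fst measurable_config_component])

lemma measurable_snd_component:
  "(\<lambda>x. snd x i) \<in> measurable (config_space \<Otimes>\<^sub>M coins) (count_space UNIV)"
  by (rule measurable_compose[OF measurable_snd])
     (simp add: measurable_cong_sets[OF sets_coins refl] measurable_config_component)

lemma measurable_fssep: "fssep \<in> measurable config_space (subprob_algebra config_space)"
proof -
  note [measurable] = measurable_fst_component measurable_snd_component
  have [measurable]: "(\<lambda>x. fssep_jumps (snd x) (fst x) i d)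
      \<in> measurable (config_space \<Otimes>\<^sub>M coins) (count_space UNIV)" for i d
    unfolding fssep_jumps_def fssep_attempts_def by measurable
  have "(\<lambda>(\<eta>, \<omega>). fssep_step \<omega> \<eta>) \<in> measurable (config_space \<Otimes>\<^sub>M coins) config_space"
    by (rule measurable_into_config_space) (unfold split_beta fssep_step_def, measurable)
  from measurable_kernel_from_coins[OF this] show ?thesis
    by (simp add: fssep_def[abs_def])
qed

lemma measurable_ssm: "ssm \<in> measurable config_space (subprob_algebra config_space)"
proof -
  note comp = measurable_fst_component measurable_snd_component
  have current: "(\<lambda>x. ssm_current (snd x) (fst x) k)
      \<in> measurable (config_space \<Otimes>\<^sub>M coins) (count_space UNIV)" for k
    unfolding ssm_current_def
    by (intro measurable_countable2[where h = "\<lambda>p c. (case p of (a, b) \<Rightarrow>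
          if short a \<and> short b then 0 else if short b then 1 else if short a then -1
          else if c then 1 else -1)" and f = "\<lambda>x. (fst x k, fst x (k + 1))"
          and g = "\<lambda>x. snd x k", simplified]
          measurable_countable2[where h = Pair] comp)
  have "(\<lambda>(n, \<omega>). ssm_step \<omega> n) \<in> measurable (config_space \<Otimes>\<^sub>M coins) config_space"
    unfolding split_beta ssm_step_def
    by (intro measurable_into_config_space measurable_countable2[where h = "\<lambda>a c. nat (a - c)"]
          measurable_countable2[where h = "\<lambda>n c. int n + c"] comp current)
  from measurable_kernel_from_coins[OF this] show ?thesis
    by (simp add: ssm_def[abs_def])
qed

text \<open>The set function in the definition of \<^const>\<open>Phi\<close> is a measure, so \<^const>\<open>Phi\<close> is not degenerate.\<close>

lemma sets_Phi [simp]: "sets (Phi \<nu>) = sets config_space"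
  unfolding Phi_def using sets.sigma_sets_eq[of config_space] by simp

lemma ennreal_suminf_swap: "(\<Sum>i. \<Sum>n. f i n :: ennreal) = (\<Sum>n. \<Sum>i. f i n)"
  using nn_integral_suminf[of "\<lambda>i n. f i n" "count_space UNIV"]
  by (simp add: nn_integral_count_space_nat)

lemma emeasure_Phi:
  assumes "A \<in> sets config_space"
  shows "emeasure (Phi \<nu>) A =
     (\<Sum>n. \<Sum>j\<le>n. emeasure (distr (restrict_space \<nu> {m. m 1 = n}) config_space
                                 (translate (- int j) \<circ> subst_map)) A) / Phi_Z \<nu>"
proof -
  define D where "D n j = distr (restrict_space \<nu> {m. m 1 = n}) config_space
                                 (translate (- int j) \<circ> subst_map)" for n j
  have "countably_additive (sets config_space) (\<lambda>A. (\<Sum>n. \<Sum>j\<le>n. emeasure (D n j) A) / Phi_Z \<nu>)"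
  proof (rule countably_additiveI)
    fix B :: "nat \<Rightarrow> (int \<Rightarrow> bool) set"
    assume B: "range B \<subseteq> sets config_space" "disjoint_family B"
    have "(\<Sum>i. emeasure (D n j) (B i)) = emeasure (D n j) (\<Union> (range B))" for n j
      using B by (intro suminf_emeasure) (auto simp: D_def)
    then have "(\<Sum>i. \<Sum>n. \<Sum>j\<le>n. emeasure (D n j) (B i))
        = (\<Sum>n. \<Sum>j\<le>n. emeasure (D n j) (\<Union> (range B)))"
      by (subst ennreal_suminf_swap) (simp add: suminf_sum)
    then show "(\<Sum>i. (\<Sum>n. \<Sum>j\<le>n. emeasure (D n j) (B i)) / Phi_Z \<nu>)
        = (\<Sum>n. \<Sum>j\<le>n. emeasure (D n j) (\<Union> (range B))) / Phi_Z \<nu>"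
      by (simp add: divide_ennreal_def)
  qed
  then show ?thesis
    using assms unfolding D_def
    by (intro emeasure_measure_of[OF Phi_def])
       (auto simp: positive_def sets_Phi)
qed

end

theory Submission
  imports Defs
begin

text \<open>
  Cutting a configuration at its zeros makes a stack configuration out of a particle configuration;
  the law of the stacks seen from a typical zero is the Palm measure, and \<^const>\<open>Phi\<close> is inverse to
  passing to it.  One step of the F-SSEP moves each zero by at most one site, exactly as one step of the
  SSM prescribes, and the contributions of the two ends of a word are translates of each other;
  hence \<^const>\<open>Phi\<close> intertwines the two dynamics on translation invariant states, and the TIS
  states of both systems correspond.

  A TIS state of the SSM of density greater than 1 lives on \<^const>\<open>X_star\<close>.  The number of zeros
  with a short neighbor cannot increase, so under stationarity it is conserved.  This forces an end of a
  run of short stacks that is a zero to advance at unit speed whatever the coins show,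
  which is impossible when the density ahead exceeds 1 and all coins push against it.  Without such ends
  runs of short stacks only shrink, so by stationarity there are none of length at least two.

  On \<^const>\<open>X_star\<close> the parities of the stacks are frozen, and the even part evolves as an
  SSM by itself.  Conditioned on any event for the parities, the law of the even part is stationary,
  though in general not translation invariant, so it is \<^const>\<open>mu_e\<close> by the uniqueness hypothesis:
  even part and parities are independent.  Extremality then amounts to ergodicity of the law of the
  parities, whose density exists by the pointwise ergodic theorem.
\<close>

section \<open>The pointwise ergodic theorem for bounded observables\<close>

text \<open>Two obstacles shape the proof. First, densities are almost sure limits and stack heights
  are unbounded: the ergodic theorem is applied only to bounded observables (parities, indicators),
  densities of heights are carried over pathwise between particles and stacks, and finiteness of the
  mean height is extracted by truncation. Second, the coins sit on sites in one system and on bonds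
  in the other; for a fixed stack configuration the bond coins are the site coins read at the zeros,
  an injective reindexing, hence again fair and independent. Equality of probabilities under
  stationarity only gives almost sure constraints for random coins. Each finite coin pattern has
  positive probability and the constraints are local, so they also hold for coins chosen at will,
  and a deterministic contradiction suffices. Extremality rests on a minimality property: a TIS
  state absolutely continuous with respect to \<open>Phi (mu_hat r \<kappa> lam)\<close> equals it.
  In the other direction, a nontrivial invariant parity event splits the Palm measure, and the parts
  return under \<open>Phi\<close> with weights biased by mean word length.\<close>

context prob_space
begin

context
  fixes T :: "'a \<Rightarrow> 'a"
  assumes T [measurable]: "T \<in> measurable M M" and T_preserving: "distr M M T = M"
begin

lemma measurable_funpow_T [measurable]: "(T ^^ k) \<in> measurable M M"
  by (induction k) (auto intro: measurable_comp[OF _ T] simp: measurable_ident)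

lemma integral_T:
  fixes h :: "'a \<Rightarrow> real"
  assumes [measurable]: "h \<in> borel_measurable M"
  shows "(\<integral>x. h (T x) \<partial>M) = (\<integral>x. h x \<partial>M)"
proof -
  have "(\<integral>x. h x \<partial>distr M M T) = (\<integral>x. h (T x) \<partial>M)"
    by (rule integral_distr) auto
  then show ?thesis by (simp add: T_preserving)
qed

text \<open>Unfolded, this is the maximum of the Birkhoff sums of \<open>g\<close> at
  \<open>x\<close> of lengths 0 to \<open>N\<close>. The recursion through \<open>T x\<close> yields
  the comparison of \<open>max_sum g N x\<close> with \<open>max_sum g N (T x)\<close>
  directly.\<close>

primrec max_sum :: "('a \<Rightarrow> real) \<Rightarrow> nat \<Rightarrow> 'a \<Rightarrow> real" where
  "max_sum g 0 x = 0"
| "max_sum g (Suc N) x = max 0 (g x + max_sum g N (T x))"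

lemma measurable_max_sum [measurable]:
  assumes [measurable]: "g \<in> borel_measurable M"
  shows "max_sum g N \<in> borel_measurable M"
  by (induction N) (auto simp: fun_eq_iff[of "max_sum g _"] intro!: borel_measurable_max borel_measurable_add
      intro: measurable_compose[OF T] cong: measurable_cong)

lemma max_sum_nonneg: "0 \<le> max_sum g N x"
  by (cases N) auto

lemma max_sum_mono: "max_sum g N x \<le> max_sum g (Suc N) x"
proof (induction N arbitrary: x)
  case (Suc N)
  have "max_sum g (Suc N) x = max 0 (g x + max_sum g N (T x))" by simp
  also have "\<dots> \<le> max 0 (g x + max_sum g (Suc N) (T x))"
    using Suc.IH[of "T x"] by (simp only: max.mono add_left_mono order_refl)
  finally show ?case by simp
qed simp

lemma max_sum_mono_le: "N \<le> N' \<Longrightarrow> max_sum g N x \<le> max_sum g N' x"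
  by (rule lift_Suc_mono_le[of "\<lambda>N. max_sum g N x"]) (use max_sum_mono in auto)

lemma max_sum_bound:
  assumes "\<And>x. \<bar>g x\<bar> \<le> B"
  shows "\<bar>max_sum g N x\<bar> \<le> real N * B"
proof (induction N arbitrary: x)
  case (Suc N)
  have "0 \<le> B" using assms[of x] by linarith
  then show ?case using Suc[of "T x"] assms[of x] max_sum_nonneg[of g N "T x"]
    by (auto simp: algebra_simps max_def mult_nonneg_nonneg)
qed simp

lemma birkhoff_sum_le_max_sum: "(\<Sum>k<N. g ((T ^^ k) x)) \<le> max_sum g N x"
proof (induction N arbitrary: x)
  case (Suc N)
  have "(\<Sum>k<Suc N. g ((T ^^ k) x)) = g x + (\<Sum>k<N. g ((T ^^ k) (T x)))"
    by (simp add: sum.lessThan_Suc_shift funpow_swap1 del: sum.lessThan_Suc)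
  with Suc[of "T x"] show ?case by simp
qed simp

text \<open>Garsia's argument.\<close>

lemma maximal_ergodic:
  fixes g :: "'a \<Rightarrow> real"
  assumes g [measurable]: "g \<in> borel_measurable M" and B: "\<And>x. \<bar>g x\<bar> \<le> B"
    and pos: "AE x in M. \<exists>N. 0 < (\<Sum>k<N. g ((T ^^ k) x))"
  shows "0 \<le> expectation g"
proof -
  let ?E = "\<lambda>N x. g x * indicator {x \<in> space M. 0 < max_sum g N x} x :: real"
  have ge: "0 \<le> (\<integral>x. ?E N x \<partial>M)" for N
  proof (cases N)
    case (Suc N')
    have int: "integrable M (max_sum g N)"
      by (rule integrable_const_bound[where B = "real N * B"])
         (use max_sum_bound[OF B] in auto)
    have int': "integrable M (\<lambda>x. max_sum g N (T x))"
      by (rule integrable_const_bound[where B = "real N * B"])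
         (use max_sum_bound[OF B] in auto)
    \<comment> \<open>By invariance the difference of \<open>max_sum g N\<close> at \<open>x\<close>
      and at \<open>T x\<close> has integral 0. Where the maximum is positive this difference is at
      most \<open>g\<close>; elsewhere it is at most 0.\<close>
    have "0 = (\<integral>x. max_sum g N x - max_sum g N (T x) \<partial>M)"
      using int int' by (simp add: integral_T)
    also have "\<dots> \<le> (\<integral>x. ?E N x \<partial>M)"
    proof (rule integral_mono)
      show "integrable M (?E N)"
        by (rule integrable_const_bound[where B = B])
           (use B abs_ge_zero order_trans in \<open>auto simp: indicator_def intro: order_trans[OF abs_ge_zero B]\<close>)
      fix x assume x: "x \<in> space M"
      show "max_sum g N x - max_sum g N (T x) \<le> ?E N x"
      proof (cases "0 < max_sum g N x")
        case True
        then have "max_sum g N x = g x + max_sum g N' (T x)" using Suc by (auto simp: max_def split: if_splits)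
        with True x show ?thesis using max_sum_mono[of g N' "T x"] Suc by (simp del: max_sum.simps)
      next
        case False
        with max_sum_nonneg[of g N "T x"] show ?thesis by simp
      qed
    qed (use int int' in auto)
    finally show ?thesis .
  qed simp
  \<comment> \<open>By \<open>pos\<close> the sets where \<open>max_sum g N\<close> is positive
    increase to almost the whole space, so the integrals over them tend to the full
    expectation.\<close>
  have "(\<lambda>N. \<integral>x. ?E N x \<partial>M) \<longlonglongrightarrow> expectation g"
  proof (rule integral_dominated_convergence[where w = "\<lambda>_. B"])
    show "AE x in M. (\<lambda>N. ?E N x) \<longlonglongrightarrow> g x"
      using pos AE_space
    proof (eventually_elim)
      case (elim x)
      then obtain N where N: "0 < (\<Sum>k<N. g ((T ^^ k) x))" by blast
      have "?E n x = g x" if "n \<ge> N" for n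
        using N birkhoff_sum_le_max_sum[where N = N and g = g and x = x] max_sum_mono_le[OF that, where g = g and x = x] elim(2) by simp
      then show ?case by (intro tendsto_eventually eventually_sequentiallyI)
    qed
    show "AE x in M. norm (?E N x) \<le> B" for N
      using B by (auto simp: indicator_def intro: order_trans[OF abs_ge_zero B])
  qed auto
  then show ?thesis using ge by (intro LIMSEQ_le_const) auto
qed

text \<open>If the upper limit of the averages exceeded some \<open>c\<close> above the mean with
  positive probability, ergodicity would make this almost sure, and the maximal inequality for
  \<open>f - c\<close> would give a mean of at least \<open>c\<close>. The lower bound is the same
  statement for \<open>- f\<close>.\<close>

lemma birkhoff_upper:
  fixes f :: "'a \<Rightarrow> real"
  assumes erg: "\<And>A. A \<in> sets M \<Longrightarrow> T -` A \<inter> space M = A \<Longrightarrow> prob A = 0 \<or> prob A = 1"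
    and f [measurable]: "f \<in> borel_measurable M" and B: "\<And>x. \<bar>f x\<bar> \<le> B"
  shows "AE x in M. \<forall>c > expectation f. eventually (\<lambda>N. (\<Sum>k<N. f ((T ^^ k) x)) / real N < c) sequentially"
proof -
  let ?avg = "\<lambda>N x. (\<Sum>k<N. f ((T ^^ k) x)) / real N"
  have *: "AE x in M. eventually (\<lambda>N. ?avg N x \<le> c + 1 / (real k + 1)) sequentially"
    if c: "c > expectation f" for c k
  proof -
    \<comment> \<open>The margin \<open>1 / (real k + 1)\<close> is existentially quantified so that
      \<open>A\<close> is invariant exactly, not only up to null sets: passing between
      \<open>x\<close> and \<open>T x\<close> changes the averages by at most
      \<open>2 * B / N\<close>, which costs one step from \<open>k\<close> to
      \<open>Suc k\<close>.\<close>
    define A where "A = {x \<in> space M. \<exists>k::nat. \<forall>m. \<exists>N\<ge>m. ?avg N x > c + 1 / (real k + 1)}"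
    have A [measurable]: "A \<in> sets M" unfolding A_def by measurable
    have B0: "0 \<le> B" using B abs_ge_zero order_trans by blast
    have close: "\<exists>m0. \<forall>N\<ge>m0. \<forall>x. \<bar>?avg N (T x) - ?avg N x\<bar> < 1 / (real k + 1) - 1 / (real (Suc k) + 1)" for k :: nat
    proof -
      have "(\<lambda>N. 2 * B / real N) \<longlonglongrightarrow> 0"
        by (rule lim_const_over_n)
      moreover have "0 < 1 / (real k + 1) - 1 / (real (Suc k) + 1)"
        by (simp add: frac_less2)
      ultimately have "\<forall>\<^sub>F N in sequentially. 2 * B / real N < 1 / (real k + 1) - 1 / (real (Suc k) + 1)"
        by (rule order_tendstoD(2))
      then obtain m0 where m0: "\<And>N. N \<ge> m0 \<Longrightarrow> 2 * B / real N < 1 / (real k + 1) - 1 / (real (Suc k) + 1)"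
        by (auto simp: eventually_sequentially)
      have "\<bar>?avg N (T x) - ?avg N x\<bar> \<le> 2 * B / real N" for N x
      proof -
        have "(\<Sum>k<Suc N. f ((T ^^ k) x)) = f x + (\<Sum>k<N. f ((T ^^ k) (T x)))"
          by (simp add: sum.lessThan_Suc_shift funpow_swap1 del: sum.lessThan_Suc)
        then have "(\<Sum>k<N. f ((T ^^ k) (T x))) - (\<Sum>k<N. f ((T ^^ k) x)) = f ((T ^^ N) x) - f x"
          by simp
        then have "?avg N (T x) - ?avg N x = (f ((T ^^ N) x) - f x) / real N"
          by (metis diff_divide_distrib)
        moreover have "\<bar>f ((T ^^ N) x) - f x\<bar> \<le> 2 * B" using B[of x] B[of "(T ^^ N) x"] by linarith
        ultimately show ?thesis by (simp add: abs_divide divide_right_mono)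
      qed
      with m0 show ?thesis by (intro exI[of _ m0]) (meson order_le_less_trans)
    qed
    have step: "\<exists>k::nat. \<forall>m. \<exists>N\<ge>m. ?avg N y > c + 1 / (real k + 1)"
      if ex: "\<exists>k::nat. \<forall>m. \<exists>N\<ge>m. ?avg N x > c + 1 / (real k + 1)" and xy: "y = T x \<or> x = T y" for x y
    proof -
      obtain k :: nat where k: "\<And>m. \<exists>N\<ge>m. ?avg N x > c + 1 / (real k + 1)" using ex by blast
      obtain m0 where m0: "\<And>N x. N \<ge> m0 \<Longrightarrow> \<bar>?avg N (T x) - ?avg N x\<bar> < 1 / (real k + 1) - 1 / (real (Suc k) + 1)"
        using close[of k] by blast
      have "\<exists>N\<ge>m. ?avg N y > c + 1 / (real (Suc k) + 1)" for m
      proof -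
        obtain N where N: "N \<ge> max m m0" "?avg N x > c + 1 / (real k + 1)" using k by blast
        then have "\<bar>?avg N x - ?avg N y\<bar> < 1 / (real k + 1) - 1 / (real (Suc k) + 1)"
          using m0[of N x] m0[of N y] xy by (auto simp: abs_minus_commute)
        with N have "?avg N y > c + 1 / (real (Suc k) + 1)" by linarith
        with N(1) show ?thesis by auto
      qed
      then show ?thesis by blast
    qed
    have "T -` A \<inter> space M = A"
      using step measurable_space[OF T] unfolding A_def by blast
    with erg[OF A] consider "prob A = 0" | "prob A = 1" by blast
    then have "prob A = 0"
    proof cases
      case 2
      then have "AE x in M. x \<in> A" by (simp add: prob_eq_1)
      then have "AE x in M. \<exists>N. 0 < (\<Sum>k<N. f ((T ^^ k) x) - c)"
      proof eventually_elim
        case (elim x)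
        then obtain k N where N: "N \<ge> Suc 0" "?avg N x > c + 1 / (real k + 1)" unfolding A_def by blast
        then have "?avg N x > c" by (smt (verit) divide_pos_pos of_nat_0_le_iff)
        with N have "0 < (\<Sum>k<N. f ((T ^^ k) x) - c)"
          by (simp add: sum_subtractf field_simps)
        then show ?case by blast
      qed
      then have "0 \<le> expectation (\<lambda>x. f x - c)"
        by (intro maximal_ergodic[where B = "B + \<bar>c\<bar>"])
           (auto intro: order_trans[OF abs_triangle_ineq4] add_mono B)
      moreover have "integrable M f"
        by (rule integrable_const_bound[where B = B]) (use B in auto)
      ultimately show ?thesis using c by (simp add: prob_space)
    qed
    then have "AE x in M. x \<notin> A" by (simp add: prob_eq_0)
    with AE_space show ?thesis
    proof eventually_elim
      case (elim x)
      then have "\<not> (\<forall>m. \<exists>N\<ge>m. ?avg N x > c + 1 / (real k + 1))" unfolding A_def by auto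
      then show ?case by (auto simp: eventually_sequentially not_less intro: less_imp_le)
    qed
  qed
  have "AE x in M. \<forall>j::nat. eventually (\<lambda>N. ?avg N x \<le> (expectation f + 1 / (real j + 1)) + 1 / (real j + 1)) sequentially"
    by (subst AE_all_countable) (intro allI *, simp)
  then show ?thesis
  proof eventually_elim
    case (elim x)
    show ?case
    proof (intro allI impI)
      fix c assume "c > expectation f"
      then obtain j :: nat where "inverse (real (Suc j)) < (c - expectation f) / 2"
        using reals_Archimedean[of "(c - expectation f) / 2"] by auto
      then have j: "(expectation f + 1 / (real j + 1)) + 1 / (real j + 1) < c" by (simp add: field_simps)
      show "\<forall>\<^sub>F N in sequentially. ?avg N x < c"
        using elim[rule_format, of j] by eventually_elim (use j in linarith)
    qed
  qed
qed

lemma birkhoff: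
  fixes f :: "'a \<Rightarrow> real"
  assumes erg: "\<And>A. A \<in> sets M \<Longrightarrow> T -` A \<inter> space M = A \<Longrightarrow> prob A = 0 \<or> prob A = 1"
    and f [measurable]: "f \<in> borel_measurable M" and B: "\<And>x. \<bar>f x\<bar> \<le> B"
  shows "AE x in M. (\<lambda>N. (\<Sum>k<N. f ((T ^^ k) x)) / real N) \<longlonglongrightarrow> expectation f"
proof -
  have "AE x in M. \<forall>c > expectation f. eventually (\<lambda>N. (\<Sum>k<N. f ((T ^^ k) x)) / real N < c) sequentially"
    by (rule birkhoff_upper[OF erg]) (use B in auto)
  moreover have "AE x in M. \<forall>c > expectation (\<lambda>x. - f x).
      eventually (\<lambda>N. (\<Sum>k<N. - f ((T ^^ k) x)) / real N < c) sequentially"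
    by (rule birkhoff_upper[OF erg]) (use B in auto)
  ultimately show ?thesis
  proof eventually_elim
    case (elim x)
    show ?case
    proof (rule order_tendstoI)
      fix c assume "c < expectation f"
      with elim(2) have "\<forall>\<^sub>F N in sequentially. (\<Sum>k<N. - f ((T ^^ k) x)) / real N < - c" by simp
      then show "\<forall>\<^sub>F N in sequentially. c < (\<Sum>k<N. f ((T ^^ k) x)) / real N"
        by (simp add: sum_negf)
    qed (use elim(1) in auto)
  qed
qed

end

end

section \<open>States and shifts\<close>

lemma translate_translate [simp]: "translate a (translate b \<eta>) = translate (a + b) \<eta>"
  by (simp add: translate_def fun_eq_iff algebra_simps)

lemma translate_0 [simp]: "translate 0 \<eta> = \<eta>"
  by (simp add: translate_def)

lemma translate_apply [simp]: "translate k \<eta> i = \<eta> (i - k)"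
  by (simp add: translate_def)

lemma measurable_translate [measurable]: "translate k \<in> measurable config_space config_space"
  unfolding translate_def by (rule measurable_into_config_space) measurable

lemma state_prob_space: "state \<mu> \<Longrightarrow> prob_space \<mu>"
  and sets_state: "state \<mu> \<Longrightarrow> sets \<mu> = sets config_space"
  by (auto simp: state_def)

lemma space_state: "state \<mu> \<Longrightarrow> space \<mu> = UNIV"
  by (metis sets_eq_imp_space_eq sets_state space_config_space)

lemma measurable_state: "state \<mu> \<Longrightarrow> measurable \<mu> N = measurable config_space N"
  by (rule measurable_cong_sets) (auto simp: state_def)

lemma state_eqI:
  assumes "state \<mu>" "state \<nu>" "\<And>A. A \<in> sets config_space \<Longrightarrow> emeasure \<mu> A = emeasure \<nu> A"
  shows "\<mu> = \<nu>"
  using assms by (intro measure_eqI) (auto simp: state_def)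

lemma state_distr:
  assumes "prob_space M" "f \<in> measurable M config_space"
  shows "state (distr M config_space f)"
  using assms by (auto simp: state_def intro: prob_space.prob_space_distr)

lemma state_distr_state:
  assumes "state \<mu>" "f \<in> measurable config_space config_space"
  shows "state (distr \<mu> config_space f)"
  using assms by (intro state_distr) (auto simp: measurable_state state_prob_space)

lemma emeasure_distr_state:
  assumes "state \<mu>" "f \<in> measurable config_space config_space" "A \<in> sets config_space"
  shows "emeasure (distr \<mu> config_space f) A = emeasure \<mu> (f -` A)"
  using assms by (subst emeasure_distr) (auto simp: measurable_state space_state)

lemma state_coins: "state coins"
  by (simp add: state_def prob_space_coins sets_coins)

lemma translation_invariant_translate:
  assumes \<mu>: "state \<mu>" "translation_invariant \<mu>"
  shows "distr \<mu> config_space (translate k) = \<mu>"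
proof -
  have *: "distr \<mu> config_space (translate (- 1)) = \<mu>"
  proof -
    have "distr \<mu> config_space (translate (- 1)) =
        distr (distr \<mu> config_space (translate 1)) config_space (translate (- 1))"
      using \<mu>(2) by (simp add: translation_invariant_def)
    also have "\<dots> = distr \<mu> config_space (\<lambda>x. x)"
      using \<mu>(1) by (subst distr_distr) (auto simp: measurable_state comp_def)
    also have "\<dots> = \<mu>" by (rule distr_id2[OF sets_state[OF \<mu>(1), symmetric]])
    finally show ?thesis .
  qed
  show ?thesis
  proof (induction k rule: int_induct[where k = 0])
    case base
    show ?case using distr_id2[OF sets_state[OF \<mu>(1), symmetric]] by (simp add: translate_def)
  next
    case (step1 i)
    have "distr \<mu> config_space (translate (i + 1)) =
        distr (distr \<mu> config_space (translate 1)) config_space (translate i)"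
      using \<mu>(1) by (subst distr_distr) (auto simp: measurable_state comp_def)
    then show ?case using \<mu>(2) step1 by (simp only: translation_invariant_def)
  next
    case (step2 i)
    have "distr \<mu> config_space (translate (i - 1)) =
        distr (distr \<mu> config_space (translate (- 1))) config_space (translate i)"
      using \<mu>(1) by (subst distr_distr) (auto simp: measurable_state comp_def)
    then show ?case using * step2 by (simp only:)
  qed
qed

lemma emeasure_translate:
  assumes "state \<mu>" "translation_invariant \<mu>" "A \<in> sets config_space"
  shows "emeasure \<mu> (translate k -` A) = emeasure \<mu> A"
proof -
  have "emeasure \<mu> A = emeasure (distr \<mu> config_space (translate k)) A"
    using translation_invariant_translate assms by metis
  also have "\<dots> = emeasure \<mu> (translate k -` A)"
    using assms by (subst emeasure_distr) (auto simp: measurable_state space_state)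
  finally show ?thesis by simp
qed

lemma AE_translate:
  assumes \<mu>: "state \<mu>" "translation_invariant \<mu>" and P: "AE x in \<mu>. P x"
  shows "AE x in \<mu>. \<forall>k. P (translate k x)"
proof (subst AE_all_countable, rule allI)
  fix k
  have "AE x in distr \<mu> config_space (translate k). P x"
    by (simp only: translation_invariant_translate[OF \<mu>] P)
  from AE_distrD[OF _ this] show "AE x in \<mu>. P (translate k x)"
    using \<mu>(1) by (simp add: measurable_state)
qed

section \<open>Coins\<close>

lemma coins_reindex:
  assumes "inj g"
  shows "distr coins config_space (\<lambda>\<omega> k. \<omega> (g k)) = coins"
proof -
  have "distr coins config_space (\<lambda>\<omega> k. \<omega> (g k)) = distr coins coins (\<lambda>\<omega>. \<lambda>k\<in>UNIV. \<omega> (g k))"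
    by (intro distr_cong) (auto simp: sets_coins restrict_def)
  also have "\<dots> = coins"
    unfolding coins_def using assms
    by (intro distr_PiM_reindex[of UNIV "\<lambda>_. measure_pmf (bernoulli_pmf (1/2))" g UNIV])
       (auto intro: measure_pmf.prob_space_axioms)
  finally show ?thesis .
qed

lemma translation_invariant_coins: "translation_invariant coins"
  unfolding translation_invariant_def translate_def
  by (rule coins_reindex) (auto simp: inj_def)

lemma emeasure_coins_cylinder:
  assumes "finite J"
  shows "emeasure coins {\<omega>. \<forall>j\<in>J. \<omega> j \<in> X j} = (\<Prod>j\<in>J. emeasure (measure_pmf (bernoulli_pmf (1/2))) (X j))"
proof -
  interpret product_prob_space "\<lambda>_::int. measure_pmf (bernoulli_pmf (1/2))" UNIV
    by (intro product_prob_spaceI measure_pmf.prob_space_axioms)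
  have "{\<omega>. \<forall>j\<in>J. \<omega> j \<in> X j} = prod_emb UNIV (\<lambda>_. measure_pmf (bernoulli_pmf (1/2))) J (Pi\<^sub>E J X)"
    by (auto simp: prod_emb_def PiE_iff restrict_def extensional_def)
  then show ?thesis
    unfolding coins_def using assms by (simp add: emeasure_PiM_emb)
qed

lemma coins_flip: "distr coins config_space (\<lambda>\<omega> k. \<not> \<omega> k) = coins"
proof -
  let ?b = "measure_pmf (bernoulli_pmf (1/2))"
  have meas: "(\<lambda>\<omega> k. \<not> \<omega> k) \<in> measurable coins config_space"
    by (rule measurable_into_config_space) (simp add: measurable_cong_sets[OF sets_coins refl])
  have flip: "emeasure ?b (Not -` X) = emeasure ?b X" for X
  proof -
    have "map_pmf Not (bernoulli_pmf (1/2)) = bernoulli_pmf (1/2)"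
    proof (rule pmf_eqI)
      fix b show "pmf (map_pmf Not (bernoulli_pmf (1/2))) b = pmf (bernoulli_pmf (1/2)) b"
        using pmf_map_inj'[of Not "bernoulli_pmf (1/2)" "\<not> b"] by (cases b) (auto simp: inj_def)
    qed
    then show ?thesis by (metis emeasure_map_pmf)
  qed
  show ?thesis
    unfolding coins_def
  proof (rule measure_eqI_PiM_infinite[where I = UNIV and M = "\<lambda>_. ?b"])
    fix X :: "int \<Rightarrow> bool set" and J :: "int set" assume J: "finite J"
    have emb: "prod_emb UNIV (\<lambda>_. ?b) J (Pi\<^sub>E J X) = {\<omega>. \<forall>j\<in>J. \<omega> j \<in> X j}"
      by (auto simp: prod_emb_def PiE_iff restrict_def extensional_def)
    have "{\<omega>. \<forall>j\<in>J. \<omega> j \<in> X j} \<in> sets config_space"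
    proof -
      have "{\<omega> \<in> space config_space. \<forall>j\<in>J. \<omega> j \<in> X j} \<in> sets config_space"
        using J measurable_sets[OF measurable_config_component, of "X _"]
        by (intro sets.sets_Collect_finite_All) (auto simp: vimage_def)
      then show ?thesis by simp
    qed
    then have "emeasure (distr coins config_space (\<lambda>\<omega> k. \<not> \<omega> k)) {\<omega>. \<forall>j\<in>J. \<omega> j \<in> X j}
        = emeasure coins {\<omega>. \<forall>j\<in>J. \<omega> j \<in> Not -` X j}"
      using space_state[OF state_coins] by (subst emeasure_distr[OF meas]) (auto intro!: arg_cong[where f = "emeasure coins"])
    also have "\<dots> = emeasure coins {\<omega>. \<forall>j\<in>J. \<omega> j \<in> X j}"
      by (simp only: emeasure_coins_cylinder[OF J] flip)
    finally show "emeasure (distr (Pi\<^sub>M UNIV (\<lambda>_. ?b)) config_space (\<lambda>\<omega> k. \<not> \<omega> k)) (prod_emb UNIV (\<lambda>_. ?b) J (Pi\<^sub>E J X))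
       = emeasure (Pi\<^sub>M UNIV (\<lambda>_. ?b)) (prod_emb UNIV (\<lambda>_. ?b) J (Pi\<^sub>E J X))"
      by (simp add: emb coins_def)
  next
    show "finite_measure (distr (Pi\<^sub>M UNIV (\<lambda>_. ?b)) config_space (\<lambda>\<omega> k. \<not> \<omega> k))"
      using prob_space.prob_space_distr[OF prob_space_coins meas]
      by (simp add: coins_def prob_space.finite_measure)
  qed (simp_all add: sets_coins[unfolded coins_def])
qed

text \<open>This turns almost sure statements about random coins into statements about one
  prescribed finite pattern.\<close>

lemma emeasure_coins_pos:
  assumes "finite J"
  shows "emeasure coins {\<omega>. \<forall>j\<in>J. \<omega> j = u j} > 0"
proof -
  have "emeasure coins {\<omega>. \<forall>j\<in>J. \<omega> j \<in> {u j}} > 0"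
    using assms by (subst emeasure_coins_cylinder) (auto simp: emeasure_pmf_single zero_less_iff_neq_zero prod_zero_iff set_pmf_iff[symmetric] pmf_eq_0_set_pmf)
  then show ?thesis by simp
qed

section \<open>One step with explicit coins\<close>

text \<open>A step becomes the image of the product of state and coins, so that configurations
  before and after it live on one probability space, where their events can be compared and
  intersected.\<close>

lemma bind_distr_coins:
  assumes \<mu>: "state \<mu>"
    and f: "(\<lambda>(\<eta>, \<omega>). f \<omega> \<eta>) \<in> measurable (config_space \<Otimes>\<^sub>M coins) config_space"
  shows "\<mu> \<bind> (\<lambda>\<eta>. distr coins config_space (\<lambda>\<omega>. f \<omega> \<eta>)) = distr (\<mu> \<Otimes>\<^sub>M coins) config_space (\<lambda>(\<eta>, \<omega>). f \<omega> \<eta>)"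
    (is "\<mu> \<bind> ?K = ?D")
proof (rule measure_eqI)
  have K: "?K \<in> measurable \<mu> (subprob_algebra config_space)"
    using measurable_kernel_from_coins[OF f] \<mu> by (simp add: measurable_state)
  have ne: "space \<mu> \<noteq> {}" using \<mu> by (simp add: space_state)
  show sets: "sets (\<mu> \<bind> ?K) = sets ?D"
    using sets_bind[of \<mu> ?K config_space] ne by simp
  fix A assume "A \<in> sets (\<mu> \<bind> ?K)"
  then have A: "A \<in> sets config_space" using sets by simp
  have f': "(\<lambda>(\<eta>, \<omega>). f \<omega> \<eta>) \<in> measurable (\<mu> \<Otimes>\<^sub>M coins) config_space"
    using f by (subst measurable_cong_sets[OF sets_pair_measure_cong[OF sets_state[OF \<mu>] refl] refl])
  interpret sigma_finite_measure coins
    using prob_space_coins prob_space_imp_sigma_finite by blast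
  have fx: "(\<lambda>\<omega>. f \<omega> \<eta>) \<in> measurable coins config_space" for \<eta>
    using measurable_compose[OF measurable_Pair1' f, of \<eta>] by simp
  have "emeasure (\<mu> \<bind> ?K) A = (\<integral>\<^sup>+ \<eta>. emeasure (?K \<eta>) A \<partial>\<mu>)"
    by (rule emeasure_bind[OF ne K A])
  also have "\<dots> = (\<integral>\<^sup>+ \<eta>. emeasure coins (Pair \<eta> -` ((\<lambda>(\<eta>, \<omega>). f \<omega> \<eta>) -` A \<inter> space (\<mu> \<Otimes>\<^sub>M coins))) \<partial>\<mu>)"
    using space_state[OF \<mu>] space_state[OF state_coins] A fx
    by (intro nn_integral_cong) (auto simp: emeasure_distr space_pair_measure intro!: arg_cong[where f = "emeasure coins"])
  also have "\<dots> = emeasure ?D A"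
    using A f' by (simp add: emeasure_distr emeasure_pair_measure_alt)
  finally show "emeasure (\<mu> \<bind> ?K) A = emeasure ?D A" .
qed

lemma measurable_fssep_step [measurable]:
  "(\<lambda>(\<eta>, \<omega>). fssep_step \<omega> \<eta>) \<in> measurable (config_space \<Otimes>\<^sub>M coins) config_space"
proof -
  note [measurable] = measurable_fst_component measurable_snd_component
  have [measurable]: "(\<lambda>x. fssep_jumps (snd x) (fst x) i d)
      \<in> measurable (config_space \<Otimes>\<^sub>M coins) (count_space UNIV)" for i d
    unfolding fssep_jumps_def fssep_attempts_def by measurable
  show ?thesis
    by (rule measurable_into_config_space) (unfold split_beta fssep_step_def, measurable)
qed

lemma measurable_ssm_current:
  "(\<lambda>x. ssm_current (snd x) (fst x) k) \<in> measurable (config_space \<Otimes>\<^sub>M coins) (count_space UNIV)"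
  unfolding ssm_current_def
  by (intro measurable_countable2[where h = "\<lambda>p c. (case p of (a, b) \<Rightarrow>
        if short a \<and> short b then 0 else if short b then 1 else if short a then -1
        else if c then 1 else -1)" and f = "\<lambda>x. (fst x k, fst x (k + 1))"
        and g = "\<lambda>x. snd x k", simplified]
        measurable_countable2[where h = Pair] measurable_fst_component measurable_snd_component)

lemma measurable_ssm_step [measurable]:
  "(\<lambda>(n, \<omega>). ssm_step \<omega> n) \<in> measurable (config_space \<Otimes>\<^sub>M coins) config_space"
  unfolding split_beta ssm_step_def
  by (intro measurable_into_config_space measurable_countable2[where h = "\<lambda>a c. nat (a - c)"]
        measurable_countable2[where h = "\<lambda>n c. int n + c"] measurable_fst_component measurable_ssm_current)

lemma bind_fssep: "state \<mu> \<Longrightarrow> \<mu> \<bind> fssep = distr (\<mu> \<Otimes>\<^sub>M coins) config_space (\<lambda>(\<eta>, \<omega>). fssep_step \<omega> \<eta>)"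
  unfolding fssep_def[abs_def] by (rule bind_distr_coins[OF _ measurable_fssep_step])

lemma bind_ssm: "state \<mu> \<Longrightarrow> \<mu> \<bind> ssm = distr (\<mu> \<Otimes>\<^sub>M coins) config_space (\<lambda>(n, \<omega>). ssm_step \<omega> n)"
  unfolding ssm_def[abs_def] by (rule bind_distr_coins[OF _ measurable_ssm_step])

lemma sets_joint: "state \<mu> \<Longrightarrow> sets (\<mu> \<Otimes>\<^sub>M coins) = sets (config_space \<Otimes>\<^sub>M coins)"
  by (intro sets_pair_measure_cong sets_state refl)

lemma measurable_joint: "state \<mu> \<Longrightarrow> measurable (\<mu> \<Otimes>\<^sub>M coins) N = measurable (config_space \<Otimes>\<^sub>M coins) N"
  by (rule measurable_cong_sets[OF sets_joint refl])

lemma space_joint: "state \<mu> \<Longrightarrow> space (\<mu> \<Otimes>\<^sub>M coins) = UNIV"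
  by (simp add: space_pair_measure space_state state_coins)

lemma prob_space_joint: "state \<mu> \<Longrightarrow> prob_space (\<mu> \<Otimes>\<^sub>M coins)"
  by (intro prob_space_pair state_prob_space prob_space_coins)

lemma state_bind_ssm: "state \<mu> \<Longrightarrow> state (\<mu> \<bind> ssm)"
  by (simp add: bind_ssm state_distr prob_space_joint measurable_joint)

lemma state_bind_fssep: "state \<mu> \<Longrightarrow> state (\<mu> \<bind> fssep)"
  by (simp add: bind_fssep state_distr prob_space_joint measurable_joint)

definition shift2 :: "int \<Rightarrow> (int \<Rightarrow> 'a) \<times> (int \<Rightarrow> bool) \<Rightarrow> (int \<Rightarrow> 'a) \<times> (int \<Rightarrow> bool)" where
  "shift2 k = map_prod (translate k) (translate k)"

lemma measurable_shift2 [measurable]: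
  "shift2 k \<in> measurable (config_space \<Otimes>\<^sub>M coins) (config_space \<Otimes>\<^sub>M coins)"
proof -
  have [measurable]: "translate k \<in> measurable coins coins"
    using measurable_translate by (simp add: measurable_cong_sets[OF sets_coins sets_coins])
  show ?thesis unfolding shift2_def map_prod_def by measurable
qed

lemma joint_shift:
  assumes \<mu>: "state \<mu>" "translation_invariant \<mu>"
  shows "distr (\<mu> \<Otimes>\<^sub>M coins) (config_space \<Otimes>\<^sub>M coins) (shift2 k) = \<mu> \<Otimes>\<^sub>M coins"
proof -
  have "distr \<mu> \<mu> (translate k) = \<mu>"
    using translation_invariant_translate[OF \<mu>] distr_cong[OF refl sets_state[OF \<mu>(1)], of \<mu>]
    by (metis)
  moreover have "distr coins coins (translate k) = coins"
    using translation_invariant_translate[OF state_coins translation_invariant_coins, of k]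
      distr_cong[OF refl sets_coins, of coins "translate k" "translate k"] by metis
  moreover have "distr \<mu> \<mu> (translate k) \<Otimes>\<^sub>M distr coins coins (translate k) =
      distr (\<mu> \<Otimes>\<^sub>M coins) (\<mu> \<Otimes>\<^sub>M coins) (\<lambda>(x, y). (translate k x, translate k y))"
  proof (rule pair_measure_distr)
    show "sigma_finite_measure (distr coins coins (translate k))"
      using prob_space_coins calculation(2) by (simp add: prob_space_imp_sigma_finite)
  qed (use \<mu> state_coins measurable_translate in
        \<open>auto simp: measurable_state measurable_cong_sets[OF refl sets_state] measurable_cong_sets[OF sets_coins sets_coins]\<close>)
  ultimately have "\<mu> \<Otimes>\<^sub>M coins = distr (\<mu> \<Otimes>\<^sub>M coins) (\<mu> \<Otimes>\<^sub>M coins) (shift2 k)"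
    by (simp add: shift2_def map_prod_def)
  also have "\<dots> = distr (\<mu> \<Otimes>\<^sub>M coins) (config_space \<Otimes>\<^sub>M coins) (shift2 k)"
    by (rule distr_cong) (auto simp: sets_joint \<mu>)
  finally show ?thesis by simp
qed

lemma emeasure_joint_shift:
  assumes "state \<mu>" "translation_invariant \<mu>" "{x. P x} \<in> sets (config_space \<Otimes>\<^sub>M coins)"
  shows "emeasure (\<mu> \<Otimes>\<^sub>M coins) {x. P (shift2 k x)} = emeasure (\<mu> \<Otimes>\<^sub>M coins) {x. P x}"
proof -
  have "emeasure (\<mu> \<Otimes>\<^sub>M coins) {x. P x} =
      emeasure (distr (\<mu> \<Otimes>\<^sub>M coins) (config_space \<Otimes>\<^sub>M coins) (shift2 k)) {x. P x}"
    using joint_shift assms by metis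
  also have "\<dots> = emeasure (\<mu> \<Otimes>\<^sub>M coins) (shift2 k -` {x. P x} \<inter> space (\<mu> \<Otimes>\<^sub>M coins))"
    using assms by (subst emeasure_distr) (auto simp: measurable_joint)
  finally show ?thesis using assms by (simp add: space_joint)
qed

lemma ssm_current_translate: "ssm_current (translate k \<omega>) (translate k n) i = ssm_current \<omega> n (i - k)"
  by (simp add: ssm_current_def algebra_simps)

lemma ssm_step_translate: "ssm_step (translate k \<omega>) (translate k n) = translate k (ssm_step \<omega> n)"
  by (simp add: ssm_step_def ssm_current_translate fun_eq_iff algebra_simps)

lemma fssep_step_translate: "fssep_step (translate k \<omega>) (translate k \<eta>) = translate k (fssep_step \<omega> \<eta>)"
proof -
  have att: "fssep_attempts (translate k \<eta>) i d = fssep_attempts \<eta> (i - k) d" for i d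
    by (simp add: fssep_attempts_def algebra_simps)
  have "fssep_jumps (translate k \<omega>) (translate k \<eta>) i d = fssep_jumps \<omega> \<eta> (i - k) d" for i d
    unfolding fssep_jumps_def att by (simp add: algebra_simps)
  then show ?thesis by (simp add: fssep_step_def fun_eq_iff algebra_simps)
qed

section \<open>The substitution map and its inverse\<close>

lemma int_induct_both:
  assumes "P (1::int)" "\<And>i. P i \<longleftrightarrow> P (i + 1)"
  shows "P i"
proof (induction i rule: int_induct[where k = 1])
  case (step2 i)
  then show ?case using assms(2)[of "i - 1"] by simp
qed (use assms in auto)

lemma word_start_1 [simp]: "word_start n 1 = 1"
  by (simp add: word_start_def)

lemma word_start_add1 [simp]: "word_start n (i + 1) = word_start n i + int (n i) + 1"
proof (cases "1 \<le> i")
  case True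
  then have "{1..<i + 1} = insert i {1..<i}" by auto
  with True show ?thesis by (simp add: word_start_def)
next
  case False
  then have "{i..<1} = insert i {i + 1..<1}" by auto
  with False show ?thesis by (cases "i = 0") (auto simp: word_start_def)
qed

text \<open>The value at 1 and the gaps determine the enumeration in both directions. The formulas
  for the word starts of a shifted, a reconstructed and an updated configuration are all verified by
  this criterion.\<close>

lemma word_start_eqI:
  assumes "f 1 = 1" "\<And>i. f (i + 1) = f i + int (n i) + 1"
  shows "word_start n = f"
proof
  fix i show "word_start n i = f i"
    by (induction i rule: int_induct_both) (use assms in auto)
qed

lemma strict_mono_int_iff:
  "strict_mono (f :: int \<Rightarrow> int) \<longleftrightarrow> (\<forall>i. f i < f (i + 1))"
proof
  assume f: "\<forall>i. f i < f (i + 1)"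
  show "strict_mono f"
  proof (rule strict_monoI)
    fix i j :: int assume "i < j"
    then show "f i < f j"
    proof (induction j rule: int_gr_induct)
      case (step j)
      then show ?case using f[rule_format, of j] by linarith
    qed (use f in simp)
  qed
qed (auto simp: strict_mono_def)

lemma strict_mono_word_start: "strict_mono (word_start n)"
  by (simp add: strict_mono_int_iff)

lemma word_start_less_iff [simp]: "word_start n i < word_start n j \<longleftrightarrow> i < j"
  and word_start_le_iff [simp]: "word_start n i \<le> word_start n j \<longleftrightarrow> i \<le> j"
  and word_start_eq_iff [simp]: "word_start n i = word_start n j \<longleftrightarrow> i = j"
  using strict_mono_word_start by (auto simp: strict_mono_less strict_mono_less_eq strict_mono_eq)

lemma strict_mono_int_locate:
  assumes "strict_mono (f :: int \<Rightarrow> int)"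
  obtains i where "f i \<le> x" "x < f (i + 1)"
proof -
  have f: "f i + 1 \<le> f (i + 1)" for i
    using assms[unfolded strict_mono_int_iff, rule_format, of i] by linarith
  have up: "f i + int k \<le> f (i + int k)" for i k
  proof (induction k)
    case (Suc k)
    have "i + int (Suc k) = (i + int k) + 1" by simp
    then show ?case using Suc f[of "i + int k"] by (simp only: of_nat_Suc)
  qed simp
  define k where "k = nat \<bar>x - f 0\<bar>"
  have lo: "f (- int k) \<le> x" using up[of "- int k" k] by (auto simp: k_def)
  have hi: "\<not> f (int k + 1) \<le> x" using up[of 0 k] f[of "int k"] by (auto simp: k_def)
  have "\<exists>m::nat. f (- int k + int m) \<le> x \<and> \<not> f (- int k + int (Suc m)) \<le> x"
  proof (rule ccontr)
    assume "\<not> ?thesis"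
    then have "f (- int k + int m) \<le> x" for m
      by (induction m) (use lo in auto)
    from this[of "2 * k + 1"] hi show False by (simp add: algebra_simps)
  qed
  then obtain m where "f (- int k + int m) \<le> x" "x < f ((- int k + int m) + 1)"
    by (auto simp: algebra_simps)
  then show ?thesis using that by blast
qed

lemma word_start_locate:
  obtains i where "word_start n i \<le> x" "x < word_start n (i + 1)"
  using strict_mono_int_locate[OF strict_mono_word_start] by metis

lemma subst_map_word_start [simp]: "\<not> subst_map n (word_start n i)"
  by (simp add: subst_map_def)

lemma subst_map_zeroE:
  assumes "\<not> subst_map n x"
  obtains i where "x = word_start n i"
  using assms by (auto simp: subst_map_def)

lemma subst_map_between:
  assumes "word_start n i < x" "x < word_start n (i + 1)"
  shows "subst_map n x"
  using assms by (auto simp: subst_map_def simp del: word_start_add1)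

lemma subst_map_1 [simp]: "\<not> subst_map n 1"
  using subst_map_word_start[of n 1] by simp

text \<open>A set of integers fixes its increasing enumeration up to a shift of the index, and the
  common value at 1 removes this freedom. Hence the zeros of \<open>subst_map n\<close> determine
  \<open>n\<close>.\<close>

lemma strict_mono_range_eq:
  fixes f g :: "int \<Rightarrow> int"
  assumes f: "strict_mono f" and g: "strict_mono g" and eq: "range f = range g" "f 1 = g 1"
  shows "f = g"
proof
  have step: "f (i + 1) = g (i + 1) \<longleftrightarrow> f i = g i" for i
  proof -
    obtain j k where jk: "f (i + 1) = g j" "g (i + 1) = f k" using eq(1) by (metis rangeE rangeI)
    obtain j' k' where jk': "f i = g j'" "g i = f k'" using eq(1) by (metis rangeE rangeI)
    show ?thesis
    proof
      assume "f i = g i"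
      then have "i < j" "i < k" using jk f g by (metis less_add_one strict_mono_less)+
      then have "g (i + 1) \<le> f (i + 1)" "f (i + 1) \<le> g (i + 1)"
        using jk strict_mono_less_eq[OF g, of "i + 1" j] strict_mono_less_eq[OF f, of "i + 1" k] by auto
      then show "f (i + 1) = g (i + 1)" by simp
    next
      assume "f (i + 1) = g (i + 1)"
      then have "j' < i + 1" "k' < i + 1" using jk' f g by (metis less_add_one strict_mono_less)+
      then have "f i \<le> g i" "g i \<le> f i"
        using jk' strict_mono_less_eq[OF g, of j' i] strict_mono_less_eq[OF f, of k' i] by auto
      then show "f i = g i" by simp
    qed
  qed
  fix i show "f i = g i"
    by (induction i rule: int_induct_both) (use eq step in auto)
qed

lemma subst_map_inj: "inj subst_map"
proof (rule injI)
  fix n m assume "subst_map n = subst_map m"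
  then have "range (word_start n) = range (word_start m)"
    by (auto simp: subst_map_def fun_eq_iff)
  then have *: "word_start n = word_start m"
    by (intro strict_mono_range_eq strict_mono_word_start) auto
  show "n = m"
  proof
    fix i show "n i = m i"
      using word_start_add1[of n i] word_start_add1[of m i] unfolding * by simp
  qed
qed

text \<open>Relabelling makes the word of the old stack 2 start at site 1, so the particle picture
  moves by the length \<open>n 1 + 1\<close> of the word of stack 1.\<close>

lemma subst_map_shift:
  "subst_map (translate (- 1) n) = translate (- (int (n 1) + 1)) (subst_map n)"
proof -
  have "word_start (translate (- 1) n) = (\<lambda>i. word_start n (i + 1) - (int (n 1) + 1))"
    by (rule word_start_eqI) (simp_all only: word_start_add1 word_start_1 translate_apply, simp_all)
  then have "x \<in> range (word_start (translate (- 1) n)) \<longleftrightarrow> x + (int (n 1) + 1) \<in> range (word_start n)" for x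
    by (auto simp: image_iff algebra_simps simp del: word_start_add1) (metis add.commute diff_add_cancel)
  then show ?thesis
    by (simp add: subst_map_def fun_eq_iff algebra_simps)
qed

section \<open>Recovering the stacks from the zeros\<close>

definition zeros_unbounded :: "(int \<Rightarrow> bool) \<Rightarrow> bool" where
  "zeros_unbounded \<eta> \<longleftrightarrow> (\<forall>x. (\<exists>y>x. \<not> \<eta> y) \<and> (\<exists>y<x. \<not> \<eta> y))"

lemma zeros_unbounded_subst_map: "zeros_unbounded (subst_map n)"
  unfolding zeros_unbounded_def
proof
  fix x
  obtain i where "word_start n i \<le> x" "x < word_start n (i + 1)" using word_start_locate .
  moreover have "word_start n (i - 1) < word_start n i" by (simp del: word_start_add1)
  ultimately show "(\<exists>y>x. \<not> subst_map n y) \<and> (\<exists>y<x. \<not> subst_map n y)"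
    by (metis order_less_le_trans subst_map_word_start)
qed

text \<open>Zeros are located by \<open>LEAST\<close> searches iterated along each half line, so
  that measurability of \<open>stack_map\<close> follows by countable composition.\<close>

definition next_gap :: "(int \<Rightarrow> bool) \<Rightarrow> int \<Rightarrow> nat" where
  "next_gap \<eta> x = (LEAST k. \<not> \<eta> (x + 1 + int k))"

definition prev_gap :: "(int \<Rightarrow> bool) \<Rightarrow> int \<Rightarrow> nat" where
  "prev_gap \<eta> x = (LEAST k. \<not> \<eta> (x - 1 - int k))"

primrec zero_right :: "(int \<Rightarrow> bool) \<Rightarrow> nat \<Rightarrow> int" where
  "zero_right \<eta> 0 = 1"
| "zero_right \<eta> (Suc k) = zero_right \<eta> k + 1 + int (next_gap \<eta> (zero_right \<eta> k))"

primrec zero_left :: "(int \<Rightarrow> bool) \<Rightarrow> nat \<Rightarrow> int" where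
  "zero_left \<eta> 0 = 1"
| "zero_left \<eta> (Suc k) = zero_left \<eta> k - 1 - int (prev_gap \<eta> (zero_left \<eta> k))"

definition zero_pos :: "(int \<Rightarrow> bool) \<Rightarrow> int \<Rightarrow> int" where
  "zero_pos \<eta> i = (if 1 \<le> i then zero_right \<eta> (nat (i - 1)) else zero_left \<eta> (nat (1 - i)))"

text \<open>Inverse to \<^const>\<open>subst_map\<close> on the configurations with infinitely many zeros on both
  sides and a zero at site 1; the gaps are junk elsewhere.\<close>

definition stack_map :: "(int \<Rightarrow> bool) \<Rightarrow> (int \<Rightarrow> nat)" where
  "stack_map \<eta> i = nat (zero_pos \<eta> (i + 1) - zero_pos \<eta> i - 1)"

lemma measurable_gap [measurable]:
  "(\<lambda>\<eta>. next_gap \<eta> x) \<in> measurable config_space (count_space UNIV)"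
  "(\<lambda>\<eta>. prev_gap \<eta> x) \<in> measurable config_space (count_space UNIV)"
  unfolding next_gap_def prev_gap_def by measurable

lemma measurable_zero_right [measurable]:
  "(\<lambda>\<eta>. zero_right \<eta> k) \<in> measurable config_space (count_space UNIV)"
proof (induction k)
  case (Suc k)
  have "(\<lambda>\<eta>. (\<lambda>x \<eta>. x + 1 + int (next_gap \<eta> x)) (zero_right \<eta> k) \<eta>) \<in> measurable config_space (count_space UNIV)"
    by (rule measurable_compose_countable[OF _ Suc]) measurable
  then show ?case by simp
qed simp

lemma measurable_zero_left [measurable]:
  "(\<lambda>\<eta>. zero_left \<eta> k) \<in> measurable config_space (count_space UNIV)"
proof (induction k)
  case (Suc k)
  have "(\<lambda>\<eta>. (\<lambda>x \<eta>. x - 1 - int (prev_gap \<eta> x)) (zero_left \<eta> k) \<eta>) \<in> measurable config_space (count_space UNIV)"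
    by (rule measurable_compose_countable[OF _ Suc]) measurable
  then show ?case by simp
qed simp

lemma measurable_stack_map [measurable]: "stack_map \<in> measurable config_space config_space"
proof (rule measurable_into_config_space)
  fix i
  have "(\<lambda>\<eta>. zero_pos \<eta> i) \<in> measurable config_space (count_space UNIV)" for i
    unfolding zero_pos_def by (cases "1 \<le> i") auto
  then show "(\<lambda>\<eta>. stack_map \<eta> i) \<in> measurable config_space (count_space UNIV)"
    unfolding stack_map_def
    by (intro measurable_countable2[where h = "\<lambda>a b. nat (a - b - 1)"])
qed

lemma zero_pos_step:
  assumes \<eta>: "zeros_unbounded \<eta>" and 1: "\<not> \<eta> 1"
  shows "\<not> \<eta> (zero_pos \<eta> i) \<and> zero_pos \<eta> i < zero_pos \<eta> (i + 1) \<and>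
     (\<forall>x. zero_pos \<eta> i < x \<and> x < zero_pos \<eta> (i + 1) \<longrightarrow> \<eta> x)"
proof -
  have next_zero: "\<not> \<eta> (x + 1 + int (next_gap \<eta> x))" for x
  proof -
    obtain y where "x < y" "\<not> \<eta> y" using \<eta> zeros_unbounded_def by blast
    then have "\<not> \<eta> (x + 1 + int (nat (y - x - 1)))" by simp
    then show ?thesis unfolding next_gap_def by (rule LeastI)
  qed
  have next_one: "\<eta> y" if "x < y" "y < x + 1 + int (next_gap \<eta> x)" for x y
    using not_less_Least[of "nat (y - x - 1)" "\<lambda>k. \<not> \<eta> (x + 1 + int k)"] that
    by (auto simp: next_gap_def)
  have prev_zero: "\<not> \<eta> (x - 1 - int (prev_gap \<eta> x))" for x
  proof -
    obtain y where "y < x" "\<not> \<eta> y" using \<eta> zeros_unbounded_def by blast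
    then have "\<not> \<eta> (x - 1 - int (nat (x - y - 1)))" by simp
    then show ?thesis unfolding prev_gap_def by (rule LeastI)
  qed
  have prev_one: "\<eta> y" if "y < x" "y > x - 1 - int (prev_gap \<eta> x)" for x y
    using not_less_Least[of "nat (x - y - 1)" "\<lambda>k. \<not> \<eta> (x - 1 - int k)"] that
    by (auto simp: prev_gap_def)
  have zr: "\<not> \<eta> (zero_right \<eta> k)" and zl: "\<not> \<eta> (zero_left \<eta> k)" for k
    using 1 next_zero prev_zero by (cases k; simp)+
  show ?thesis
  proof (cases "1 \<le> i")
    case True
    then have "nat i = Suc (nat (i - 1))" by simp
    then have "zero_pos \<eta> (i + 1) = zero_pos \<eta> i + 1 + int (next_gap \<eta> (zero_pos \<eta> i))"
      using True by (simp add: zero_pos_def)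
    with True next_one[of "zero_pos \<eta> i"] zr show ?thesis by (auto simp: zero_pos_def)
  next
    \<comment> \<open>For \<open>i\<close> below 1 the zeros are found leftwards, so the gap to the
      right of zero \<open>i\<close> is the \<open>prev_gap\<close> of zero
      \<open>i + 1\<close>.\<close>
    case False
    have eq: "zero_pos \<eta> (i + 1) = zero_left \<eta> (nat (- i))"
      using False by (cases "i = 0") (auto simp: zero_pos_def)
    have "nat (1 - i) = Suc (nat (- i))" using False by simp
    then have "zero_pos \<eta> i = zero_pos \<eta> (i + 1) - 1 - int (prev_gap \<eta> (zero_pos \<eta> (i + 1)))"
      using False by (simp add: eq) (simp add: zero_pos_def)
    moreover have "\<not> \<eta> (zero_pos \<eta> i)" using zl False by (simp add: zero_pos_def)
    ultimately show ?thesis using prev_one[of _ "zero_pos \<eta> (i + 1)"] by auto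
  qed
qed

lemma word_start_stack_map:
  assumes "zeros_unbounded \<eta>" "\<not> \<eta> 1"
  shows "word_start (stack_map \<eta>) = zero_pos \<eta>"
proof (rule word_start_eqI)
  show "zero_pos \<eta> 1 = 1" by (simp add: zero_pos_def)
  fix i show "zero_pos \<eta> (i + 1) = zero_pos \<eta> i + int (stack_map \<eta> i) + 1"
    using zero_pos_step[OF assms, of i] by (simp add: stack_map_def)
qed

lemma subst_map_stack_map:
  assumes "zeros_unbounded \<eta>" "\<not> \<eta> 1"
  shows "subst_map (stack_map \<eta>) = \<eta>"
proof
  fix x
  let ?n = "stack_map \<eta>"
  have w: "word_start ?n = zero_pos \<eta>" by (rule word_start_stack_map[OF assms])
  obtain i where i: "word_start ?n i \<le> x" "x < word_start ?n (i + 1)" using word_start_locate .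
  note step = zero_pos_step[OF assms, of i, folded w]
  show "subst_map ?n x = \<eta> x"
  proof (cases "word_start ?n i = x")
    case True
    then show ?thesis using step subst_map_word_start[of ?n i] by metis
  next
    case False
    then have "word_start ?n i < x" using i(1) by linarith
    then show ?thesis using i(2) subst_map_between[of ?n i x] step by metis
  qed
qed

lemma stack_map_subst_map [simp]: "stack_map (subst_map n) = n"
  by (rule injD[OF subst_map_inj]) (simp add: subst_map_stack_map zeros_unbounded_subst_map)

lemma measurable_subst_map [measurable]: "subst_map \<in> measurable config_space config_space"
proof (rule measurable_into_config_space)
  fix x
  have [measurable]: "(\<lambda>n. word_start n i) \<in> measurable config_space (count_space UNIV)" for i
  proof -
    have "(\<lambda>n. \<Sum>k\<in>K. int (n k) + 1) \<in> measurable config_space (count_space UNIV)" if "finite K" for K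
      using that
    proof induction
      case (insert k K)
      then show ?case
        using measurable_countable2[OF measurable_config_component insert.IH, of "\<lambda>a b. int a + 1 + b" k] by simp
    qed simp
    then show ?thesis
      unfolding word_start_def
      by (cases "1 \<le> i")
         (simp_all add: measurable_compose[of _ config_space "count_space UNIV" "\<lambda>x. 1 + x"]
           measurable_compose[of _ config_space "count_space UNIV" "\<lambda>x. 1 - x"])
  qed
  show "(\<lambda>n. subst_map n x) \<in> measurable config_space (count_space UNIV)"
    unfolding subst_map_def by (simp add: image_iff) measurable
qed

section \<open>The two processes under the substitution map\<close>

text \<open>A particle next to a zero has its other neighbor occupied exactly when its word contains
  at least two ones; a lone particle between two zeros has no occupied neighbor. Hence the attempts
  to fill a zero come from the tall stacks on its two sides.\<close>

lemma subst_map_attempts: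
  shows "fssep_attempts (subst_map n) x 1 \<longleftrightarrow> (\<exists>k. x + 1 = word_start n (k + 1) \<and> \<not> short (n k))"
    and "fssep_attempts (subst_map n) x (- 1) \<longleftrightarrow> (\<exists>k. x - 1 = word_start n k \<and> \<not> short (n k))"
proof -
  have one: "subst_map n y" if "word_start n k < y" "y < word_start n k + int (n k) + 1" for y k
    using that subst_map_between[of n k y] by simp
  have small: "n k \<ge> 2" if "subst_map n (word_start n k + int (n k))"
    "subst_map n (word_start n k + int (n k) - 1)" for k
    using that subst_map_word_start[of n k] by (cases "n k"; cases "n k - 1") auto
  have small': "n k \<ge> 2" if "subst_map n (word_start n k + 1)"
    "subst_map n (word_start n k + 2)" for k
  proof (rule ccontr)
    assume "\<not> n k \<ge> 2"
    then have "n k = 0 \<or> n k = 1" by auto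
    then have "word_start n (k + 1) = word_start n k + 1 \<or> word_start n (k + 1) = word_start n k + 2" by auto
    then show False using that subst_map_word_start[of n "k + 1"] by metis
  qed
  show "fssep_attempts (subst_map n) x 1 \<longleftrightarrow> (\<exists>k. x + 1 = word_start n (k + 1) \<and> \<not> short (n k))"
  proof
    assume att: "fssep_attempts (subst_map n) x 1"
    then obtain j where j: "x + 1 = word_start n j" unfolding fssep_attempts_def using subst_map_zeroE by metis
    have e: "word_start n j = word_start n (j - 1) + int (n (j - 1)) + 1"
      using word_start_add1[of n "j - 1"] by simp
    have x: "word_start n (j - 1) + int (n (j - 1)) = x" using e j by linarith
    have "n (j - 1) \<ge> 2"
      using att small[of "j - 1"] unfolding x fssep_attempts_def by simp
    with j show "\<exists>k. x + 1 = word_start n (k + 1) \<and> \<not> short (n k)"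
      by (intro exI[of _ "j - 1"]) (auto simp: short_def simp del: word_start_add1)
  next
    assume "\<exists>k. x + 1 = word_start n (k + 1) \<and> \<not> short (n k)"
    then obtain k where k: "x + 1 = word_start n (k + 1)" "\<not> short (n k)" by blast
    then have "\<not> subst_map n (x + 1)" by (simp del: word_start_add1)
    moreover have "subst_map n x" "subst_map n (x - 1)"
      using k by (auto simp: short_def intro!: one[of k])
    ultimately show "fssep_attempts (subst_map n) x 1" by (simp add: fssep_attempts_def)
  qed
  show "fssep_attempts (subst_map n) x (- 1) \<longleftrightarrow> (\<exists>k. x - 1 = word_start n k \<and> \<not> short (n k))"
  proof
    assume att: "fssep_attempts (subst_map n) x (- 1)"
    then obtain j where j: "x - 1 = word_start n j" unfolding fssep_attempts_def using subst_map_zeroE[of n "x + - 1"] by auto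
    then have x: "x = word_start n j + 1" by simp
    have "n j \<ge> 2"
      using att small'[of j] unfolding x fssep_attempts_def by (auto simp: algebra_simps)
    with j show "\<exists>k. x - 1 = word_start n k \<and> \<not> short (n k)" by (auto simp: short_def)
  next
    assume "\<exists>k. x - 1 = word_start n k \<and> \<not> short (n k)"
    then obtain k where k: "x - 1 = word_start n k" "\<not> short (n k)" by blast
    then have "\<not> subst_map n (x - 1)" by simp
    moreover have "subst_map n x" "subst_map n (x + 1)"
      using k by (auto simp: short_def intro!: one[of k])
    ultimately show "fssep_attempts (subst_map n) x (- 1)" by (simp add: fssep_attempts_def)
  qed
qed

text \<open>The bond from \<open>k\<close> to \<open>k + 1\<close> corresponds to the zero that
  separates the words of these stacks, so its coin is the one at the site of that zero. The
  reindexing depends on \<open>n\<close> but is injective for each \<open>n\<close>.\<close>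

definition zero_coins :: "(int \<Rightarrow> nat) \<Rightarrow> (int \<Rightarrow> bool) \<Rightarrow> (int \<Rightarrow> bool)" where
  "zero_coins n \<omega> = (\<lambda>k. \<omega> (word_start n (k + 1)))"

lemma subst_map_jumps:
  shows "fssep_jumps \<omega> (subst_map n) x 1 \<longleftrightarrow>
      (\<exists>k. x + 1 = word_start n (k + 1) \<and> ssm_current (zero_coins n \<omega>) n k = 1)"
    and "fssep_jumps \<omega> (subst_map n) x (- 1) \<longleftrightarrow>
      (\<exists>k. x - 1 = word_start n (k + 1) \<and> ssm_current (zero_coins n \<omega>) n k = - 1)"
proof -
  have cur1: "ssm_current (zero_coins n \<omega>) n k = 1 \<longleftrightarrow> \<not> short (n k) \<and> (\<not> short (n (k + 1)) \<longrightarrow> \<omega> (word_start n (k + 1)))"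
    and cur2: "ssm_current (zero_coins n \<omega>) n k = - 1 \<longleftrightarrow> \<not> short (n (k + 1)) \<and> (\<not> short (n k) \<longrightarrow> \<not> \<omega> (word_start n (k + 1)))" for k
    by (auto simp: ssm_current_def zero_coins_def)
  have right: "fssep_attempts (subst_map n) (x + 2) (- 1) \<longleftrightarrow> \<not> short (n (k + 1))"
    if "x + 1 = word_start n (k + 1)" for k
  proof -
    have "fssep_attempts (subst_map n) (x + 2) (- 1) \<longleftrightarrow> (\<exists>j. x + 1 = word_start n j \<and> \<not> short (n j))"
      by (simp add: subst_map_attempts add.commute)
    then show ?thesis unfolding that word_start_eq_iff by auto
  qed
  have left: "fssep_attempts (subst_map n) (x - 2) 1 \<longleftrightarrow> \<not> short (n k)"
    if "x - 1 = word_start n (k + 1)" for k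
  proof -
    have "fssep_attempts (subst_map n) (x - 2) 1 \<longleftrightarrow> (\<exists>j. x - 1 = word_start n (j + 1) \<and> \<not> short (n j))"
      by (simp add: subst_map_attempts algebra_simps)
    then show ?thesis unfolding that word_start_eq_iff by auto
  qed
  show "fssep_jumps \<omega> (subst_map n) x 1 \<longleftrightarrow>
      (\<exists>k. x + 1 = word_start n (k + 1) \<and> ssm_current (zero_coins n \<omega>) n k = 1)"
  proof
    assume jump: "fssep_jumps \<omega> (subst_map n) x 1"
    then obtain k where k: "x + 1 = word_start n (k + 1)" "\<not> short (n k)"
      unfolding fssep_jumps_def subst_map_attempts by blast
    with jump right[OF k(1)] show "\<exists>k. x + 1 = word_start n (k + 1) \<and> ssm_current (zero_coins n \<omega>) n k = 1"
      unfolding cur1 by (intro exI[of _ k]) (auto simp: fssep_jumps_def simp del: word_start_add1)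
  next
    assume "\<exists>k. x + 1 = word_start n (k + 1) \<and> ssm_current (zero_coins n \<omega>) n k = 1"
    then obtain k where k: "x + 1 = word_start n (k + 1)" and c: "ssm_current (zero_coins n \<omega>) n k = 1" by blast
    with right[OF k] show "fssep_jumps \<omega> (subst_map n) x 1"
      unfolding cur1 fssep_jumps_def subst_map_attempts(1) by (auto simp del: word_start_add1)
  qed
  show "fssep_jumps \<omega> (subst_map n) x (- 1) \<longleftrightarrow>
      (\<exists>k. x - 1 = word_start n (k + 1) \<and> ssm_current (zero_coins n \<omega>) n k = - 1)"
  proof
    assume jump: "fssep_jumps \<omega> (subst_map n) x (- 1)"
    then obtain j where j: "x - 1 = word_start n j" "\<not> short (n j)"
      unfolding fssep_jumps_def subst_map_attempts by blast
    define k where "k = j - 1"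
    have k: "x - 1 = word_start n (k + 1)" "\<not> short (n (k + 1))" using j by (auto simp: k_def simp del: word_start_add1)
    with jump left[OF k(1)] show "\<exists>k. x - 1 = word_start n (k + 1) \<and> ssm_current (zero_coins n \<omega>) n k = - 1"
      unfolding cur2 by (intro exI[of _ k]) (auto simp: fssep_jumps_def simp del: word_start_add1)
  next
    assume "\<exists>k. x - 1 = word_start n (k + 1) \<and> ssm_current (zero_coins n \<omega>) n k = - 1"
    then obtain k where k: "x - 1 = word_start n (k + 1)" and c: "ssm_current (zero_coins n \<omega>) n k = - 1" by blast
    with left[OF k] show "fssep_jumps \<omega> (subst_map n) x (- 1)"
      unfolding cur2 fssep_jumps_def subst_map_attempts(2) by (auto simp del: word_start_add1)
  qed
qed

lemma ssm_current_cases: "ssm_current \<omega> n k \<in> {-1, 0, 1}"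
  by (auto simp: ssm_current_def)

lemma fssep_step_zero_iff:
  "\<not> fssep_step \<omega> (subst_map n) x \<longleftrightarrow>
     (\<exists>k. x = word_start n (k + 1) - ssm_current (zero_coins n \<omega>) n k)"
  (is "_ \<longleftrightarrow> (\<exists>k. x = word_start n (k + 1) - ?c k)")
proof (cases "subst_map n x")
  case True
  then have "\<not> fssep_step \<omega> (subst_map n) x \<longleftrightarrow>
      (\<exists>k. x + 1 = word_start n (k + 1) \<and> ?c k = 1) \<or> (\<exists>k. x - 1 = word_start n (k + 1) \<and> ?c k = - 1)"
    by (simp add: fssep_step_def subst_map_jumps del: word_start_add1)
  also have "\<dots> \<longleftrightarrow> (\<exists>k. x = word_start n (k + 1) - ?c k)"
  proof
    assume "\<exists>k. x = word_start n (k + 1) - ?c k"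
    then obtain k where k: "x = word_start n (k + 1) - ?c k" by blast
    then have "?c k \<noteq> 0" using True subst_map_word_start[of n "k + 1"] by (auto simp del: word_start_add1)
    then show "(\<exists>k. x + 1 = word_start n (k + 1) \<and> ?c k = 1) \<or> (\<exists>k. x - 1 = word_start n (k + 1) \<and> ?c k = - 1)"
      using ssm_current_cases[of "zero_coins n \<omega>" n k] k by (auto simp del: word_start_add1)
  qed (smt (verit))
  finally show ?thesis .
next
  case False
  then obtain j where j: "x = word_start n (j + 1)" by (metis subst_map_zeroE diff_add_cancel)
  have "\<not> fssep_step \<omega> (subst_map n) x \<longleftrightarrow>
      \<not> (\<exists>k. x = word_start n (k + 1) \<and> ?c k = 1) \<and> \<not> (\<exists>k. x = word_start n (k + 1) \<and> ?c k = - 1)"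
    using False by (simp add: fssep_step_def subst_map_jumps del: word_start_add1)
  also have "\<dots> \<longleftrightarrow> ?c j = 0"
    using ssm_current_cases[of "zero_coins n \<omega>" n j] unfolding j word_start_eq_iff by auto
  also have "\<dots> \<longleftrightarrow> (\<exists>k. x = word_start n (k + 1) - ?c k)"
  proof
    assume "\<exists>k. x = word_start n (k + 1) - ?c k"
    then obtain k where "x = word_start n (k + 1) - ?c k" by blast
    with j have k: "word_start n (j + 1) = word_start n (k + 1) - ?c k" by simp
    consider "?c k = 0" | "?c k = 1" | "?c k = - 1" using ssm_current_cases[of "zero_coins n \<omega>" n k] by auto
    then show "?c j = 0"
    proof cases
      case 1
      with k show ?thesis by (simp del: word_start_add1)
    next
      \<comment> \<open>Stack \<open>k\<close> is tall, so the zero that starts word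
        \<open>k + 1\<close> moves left into the interior of word \<open>k\<close>, where no zero
        stood before; the place of zero \<open>j + 1\<close> cannot be there.\<close>
      case 2
      then have tall: "n k \<ge> 2" by (auto simp: ssm_current_def short_def split: if_splits)
      have "word_start n k < word_start n (j + 1)" "word_start n (j + 1) < word_start n (k + 1)"
        using k 2 tall by auto
      then have "k < j + 1" "j + 1 < k + 1" unfolding word_start_less_iff by auto
      then show ?thesis by simp
    next
      case 3
      then have tall: "n (k + 1) \<ge> 2" by (auto simp: ssm_current_def short_def split: if_splits)
      have "word_start n (k + 1) < word_start n (j + 1)" "word_start n (j + 1) < word_start n (k + 1 + 1)"
        using k 3 tall word_start_add1[of n "k + 1"] by (auto simp del: word_start_add1)
      then have "k + 1 < j + 1" "j + 1 < k + 1 + 1" unfolding word_start_less_iff by auto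
      then show ?thesis by simp
    qed
  qed (use j in \<open>metis diff_zero\<close>)
  finally show ?thesis .
qed

lemma ssm_step_height: "int (ssm_step \<omega> n i) = int (n i) + ssm_current \<omega> n (i - 1) - ssm_current \<omega> n i"
proof -
  have "0 \<le> int (n i) + ssm_current \<omega> n (i - 1) - ssm_current \<omega> n i"
    by (auto simp: ssm_current_def short_def)
  then show ?thesis by (simp add: ssm_step_def)
qed

lemma word_start_ssm_step:
  "word_start (ssm_step \<omega> n) i = word_start n i - ssm_current \<omega> n (i - 1) + ssm_current \<omega> n 0"
proof -
  have "word_start (ssm_step \<omega> n) = (\<lambda>i. word_start n i - ssm_current \<omega> n (i - 1) + ssm_current \<omega> n 0)"
    by (rule word_start_eqI) (auto simp: ssm_step_height)
  then show ?thesis by simp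
qed

text \<open>Each zero moves by minus the current across its bond. Since \<open>subst_map\<close>
  puts the start of word 1 at site 1, a translation has to restore the displacement of that
  zero.\<close>

lemma fssep_step_subst_map:
  "fssep_step \<omega> (subst_map n) =
     translate (- ssm_current (zero_coins n \<omega>) n 0) (subst_map (ssm_step (zero_coins n \<omega>) n))"
proof
  fix x
  let ?\<omega> = "zero_coins n \<omega>"
  have "(\<exists>k. x = word_start n (k + 1) - ssm_current ?\<omega> n k) \<longleftrightarrow>
      (\<exists>k. x = word_start n k - ssm_current ?\<omega> n (k - 1))"
    by (metis diff_add_cancel add_diff_cancel)
  also have "\<dots> \<longleftrightarrow> (\<exists>k. x + ssm_current ?\<omega> n 0 = word_start (ssm_step ?\<omega> n) k)"
    by (simp add: word_start_ssm_step algebra_simps)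
  also have "\<dots> \<longleftrightarrow> \<not> subst_map (ssm_step ?\<omega> n) (x + ssm_current ?\<omega> n 0)"
    by (auto simp: subst_map_def)
  finally show "fssep_step \<omega> (subst_map n) x =
      translate (- ssm_current ?\<omega> n 0) (subst_map (ssm_step ?\<omega> n)) x"
    using fssep_step_zero_iff[of \<omega> n x] by simp
qed

section \<open>The map \<open>\<Phi>\<close>\<close>

lemma nn_integral_translate:
  assumes "state \<mu>" "translation_invariant \<mu>" "f \<in> borel_measurable config_space"
  shows "(\<integral>\<^sup>+ x. f (translate k x) \<partial>\<mu>) = (\<integral>\<^sup>+ x. f x \<partial>\<mu>)"
proof -
  have "(\<integral>\<^sup>+ x. f x \<partial>\<mu>) = (\<integral>\<^sup>+ x. f x \<partial>distr \<mu> config_space (translate k))"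
    by (simp only: translation_invariant_translate[OF assms(1,2)])
  also have "\<dots> = (\<integral>\<^sup>+ x. f (translate k x) \<partial>\<mu>)"
    by (rule nn_integral_distr) (use assms in \<open>auto simp: measurable_state\<close>)
  finally show ?thesis by simp
qed

lemma nn_integral_joint_shift:
  assumes "state \<mu>" "translation_invariant \<mu>" "f \<in> borel_measurable (config_space \<Otimes>\<^sub>M coins)"
  shows "(\<integral>\<^sup>+ x. f (shift2 k x) \<partial>(\<mu> \<Otimes>\<^sub>M coins)) = (\<integral>\<^sup>+ x. f x \<partial>(\<mu> \<Otimes>\<^sub>M coins))"
proof -
  have "(\<integral>\<^sup>+ x. f x \<partial>(\<mu> \<Otimes>\<^sub>M coins)) =
      (\<integral>\<^sup>+ x. f x \<partial>distr (\<mu> \<Otimes>\<^sub>M coins) (config_space \<Otimes>\<^sub>M coins) (shift2 k))"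
    by (simp only: joint_shift[OF assms(1,2)])
  also have "\<dots> = (\<integral>\<^sup>+ x. f (shift2 k x) \<partial>(\<mu> \<Otimes>\<^sub>M coins))"
    by (rule nn_integral_distr) (use assms in \<open>auto simp: measurable_joint\<close>)
  finally show ?thesis by simp
qed

text \<open>The contribution of the word of stack 1 to integrals under \<open>Phi\<close>: its
  \<open>n 1 + 1\<close> sites are brought to site 1 in turn.\<close>

definition word_sum :: "((int \<Rightarrow> bool) \<Rightarrow> ennreal) \<Rightarrow> (int \<Rightarrow> nat) \<Rightarrow> ennreal" where
  "word_sum f n = (\<Sum>j\<le>n 1. f (translate (- int j) (subst_map n)))"

lemma word_sum_1: "word_sum (\<lambda>_. 1) n = of_nat (n 1 + 1)"
  by (simp add: word_sum_def)

lemma measurable_word_sum [measurable]: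
  assumes [measurable]: "f \<in> borel_measurable config_space"
  shows "word_sum f \<in> borel_measurable config_space"
proof -
  have "(\<lambda>n. (\<lambda>k n. \<Sum>j\<le>k. f (translate (- int j) (subst_map n))) (n 1) n) \<in> borel_measurable config_space"
    by (rule measurable_compose_countable[OF _ measurable_config_component]) measurable
  then show ?thesis by (simp add: word_sum_def[abs_def])
qed

lemma sets_site_value: "{m. m i = k} \<in> sets config_space"
  using measurable_sets[OF measurable_config_component, of "{k}" i] by (simp add: vimage_def)

lemma suminf_indicator_single: "(\<Sum>k. indicator {k} (m::nat) * f k) = (f m :: ennreal)"
  using suminf_finite[of "{m}" "\<lambda>k. indicator {k} m * f k"] by simp

lemma Phi_Z_eq:
  assumes \<nu>: "state \<nu>"
  shows "Phi_Z \<nu> = (\<integral>\<^sup>+ n. of_nat (n 1 + 1) \<partial>\<nu>)"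
proof -
  have [measurable]: "(\<lambda>m. indicator {k} (m 1) :: ennreal) \<in> borel_measurable \<nu>" for k :: nat
    using \<nu> by (simp add: measurable_state)
  have "Phi_Z \<nu> = (\<Sum>k. \<integral>\<^sup>+ m. indicator {k} (m 1) * of_nat (k + 1) \<partial>\<nu>)"
    unfolding Phi_Z_def
  proof (intro suminf_cong)
    fix k
    have S: "{m. m 1 = k} \<in> sets \<nu>" unfolding sets_state[OF \<nu>] by (rule sets_site_value)
    have "(\<integral>\<^sup>+ m. indicator {k} (m 1) * of_nat (k + 1) \<partial>\<nu>) =
        (\<integral>\<^sup>+ m. of_nat (k + 1) * indicator {m. m 1 = k} m \<partial>\<nu>)"
      by (intro nn_integral_cong) (simp add: indicator_def)
    also have "\<dots> = of_nat (k + 1) * emeasure \<nu> {m. m 1 = k}"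
      by (rule nn_integral_cmult_indicator[OF S])
    finally show "of_nat (k + 1) * emeasure \<nu> {m. m 1 = k} = (\<integral>\<^sup>+ m. indicator {k} (m 1) * of_nat (k + 1) \<partial>\<nu>)" by simp
  qed
  also have "\<dots> = (\<integral>\<^sup>+ m. (\<Sum>k. indicator {k} (m 1) * of_nat (k + 1)) \<partial>\<nu>)"
    by (subst nn_integral_suminf) auto
  finally show ?thesis by (simp only: suminf_indicator_single)
qed

lemma emeasure_Phi_word_sum:
  assumes \<nu>: "state \<nu>" and A: "A \<in> sets config_space"
  shows "emeasure (Phi \<nu>) A = (\<integral>\<^sup>+ n. word_sum (indicator A) n \<partial>\<nu>) / Phi_Z \<nu>"
proof -
  note [measurable] = A
  have [measurable]: "(\<lambda>m. indicator {k} (m 1) * indicator A (translate (- int j) (subst_map m)) :: ennreal) \<in> borel_measurable \<nu>" for k j :: nat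
    using \<nu> by (simp add: measurable_state)
  have *: "emeasure (distr (restrict_space \<nu> {m. m 1 = k}) config_space (translate (- int j) \<circ> subst_map)) A =
      (\<integral>\<^sup>+ m. indicator {k} (m 1) * indicator A (translate (- int j) (subst_map m)) \<partial>\<nu>)" for j k
  proof -
    let ?f = "translate (- int j) \<circ> subst_map"
    have f [measurable]: "?f \<in> measurable \<nu> config_space"
      using \<nu> by (simp add: measurable_state)
    have S: "{m. m (1::int) = k} \<in> sets \<nu>"
      using sets_site_value by (simp add: sets_state[OF \<nu>])
    have "emeasure (distr (restrict_space \<nu> {m. m 1 = k}) config_space ?f) A =
        emeasure (restrict_space \<nu> {m. m 1 = k}) (?f -` A \<inter> {m. m 1 = k})"
      using f by (subst emeasure_distr) (auto intro: measurable_restrict_space1 simp: space_restrict_space space_state[OF \<nu>])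
    also have "\<dots> = emeasure \<nu> (?f -` A \<inter> {m. m 1 = k})"
      using S by (subst emeasure_restrict_space) (auto simp: space_state[OF \<nu>])
    also have "\<dots> = (\<integral>\<^sup>+ m. indicator (?f -` A \<inter> {m. m 1 = k}) m \<partial>\<nu>)"
      using measurable_sets[OF f A] S by (subst nn_integral_indicator) (auto simp: space_state[OF \<nu>])
    also have "\<dots> = (\<integral>\<^sup>+ m. indicator {k} (m 1) * indicator A (translate (- int j) (subst_map m)) \<partial>\<nu>)"
      by (intro nn_integral_cong) (auto simp: indicator_def)
    finally show ?thesis .
  qed
  have "(\<Sum>k. \<Sum>j\<le>k. emeasure (distr (restrict_space \<nu> {m. m 1 = k}) config_space (translate (- int j) \<circ> subst_map)) A)
      = (\<Sum>k. \<integral>\<^sup>+ m. (\<Sum>j\<le>k. indicator {k} (m 1) * indicator A (translate (- int j) (subst_map m))) \<partial>\<nu>)"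
    unfolding * by (subst nn_integral_sum) auto
  also have "\<dots> = (\<integral>\<^sup>+ m. (\<Sum>k. indicator {k} (m 1) * (\<Sum>j\<le>k. indicator A (translate (- int j) (subst_map m)))) \<partial>\<nu>)"
    unfolding sum_distrib_left by (intro nn_integral_suminf[symmetric] borel_measurable_sum) measurable
  also have "\<dots> = (\<integral>\<^sup>+ m. word_sum (indicator A) m \<partial>\<nu>)"
    by (simp only: suminf_indicator_single word_sum_def)
  finally show ?thesis using emeasure_Phi[OF A, of \<nu>] by simp
qed

text \<open>\<open>Phi\<close> is given only through its values on sets. It is identified here with
  a rescaled image of the product of \<nu> and the counting measure on the offsets \<open>j\<close>,
  cut down to \<open>j \<le> n 1\<close>, so that integrals follow from the rules for image, density
  and product measures.\<close>

lemma nn_integral_Phi: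
  assumes \<nu>: "state \<nu>" and f: "f \<in> borel_measurable config_space"
  shows "(\<integral>\<^sup>+ \<eta>. f \<eta> \<partial>Phi \<nu>) = (\<integral>\<^sup>+ n. word_sum f n \<partial>\<nu>) / Phi_Z \<nu>"
proof -
  let ?C = "count_space (UNIV :: nat set)"
  let ?g = "\<lambda>(n, j). translate (- int j) (subst_map n)"
  let ?d = "\<lambda>(n, j). indicator {..n (1::int)} j :: ennreal"
  let ?D = "distr (density (\<nu> \<Otimes>\<^sub>M ?C) ?d) config_space ?g"
  interpret C: sigma_finite_measure ?C by (rule sigma_finite_measure_count_space)
  have sets: "sets (\<nu> \<Otimes>\<^sub>M ?C) = sets (config_space \<Otimes>\<^sub>M ?C)"
    by (intro sets_pair_measure_cong sets_state \<nu> refl)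
  have g: "?g \<in> measurable (\<nu> \<Otimes>\<^sub>M ?C) config_space"
    unfolding measurable_cong_sets[OF sets refl] by measurable
  have d: "?d \<in> borel_measurable (\<nu> \<Otimes>\<^sub>M ?C)"
  proof -
    have "(\<lambda>x. indicator {..fst x (1::int)} (snd x) :: ennreal) \<in> borel_measurable (config_space \<Otimes>\<^sub>M ?C)"
      by (rule measurable_compose_countable[where f = "\<lambda>k x. indicator {..k} (snd x)" and g = "\<lambda>x. fst x (1::int)"]) measurable
    then show ?thesis unfolding measurable_cong_sets[OF sets refl] by (simp add: case_prod_beta')
  qed
  have D: "(\<integral>\<^sup>+ \<eta>. h \<eta> \<partial>?D) = (\<integral>\<^sup>+ n. word_sum h n \<partial>\<nu>)" if h [measurable]: "h \<in> borel_measurable config_space" for h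
  proof -
    have hg: "(\<lambda>x. h (?g x)) \<in> borel_measurable (\<nu> \<Otimes>\<^sub>M ?C)"
      by (rule measurable_compose[OF g h])
    have "(\<integral>\<^sup>+ \<eta>. h \<eta> \<partial>?D) = (\<integral>\<^sup>+ x. ?d x * h (?g x) \<partial>(\<nu> \<Otimes>\<^sub>M ?C))"
      using g d hg by (subst nn_integral_distr) (auto simp: nn_integral_density)
    also have "\<dots> = (\<integral>\<^sup>+ n. \<integral>\<^sup>+ j. ?d (n, j) * h (?g (n, j)) \<partial>?C \<partial>\<nu>)"
      by (rule C.nn_integral_fst[symmetric]) (intro borel_measurable_times_ennreal d hg)
    also have "\<dots> = (\<integral>\<^sup>+ n. word_sum h n \<partial>\<nu>)"
    proof (rule nn_integral_cong)
      fix n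
      have "(\<integral>\<^sup>+ j. ?d (n, j) * h (?g (n, j)) \<partial>?C) = (\<Sum>j\<in>{..n 1}. ?d (n, j) * h (?g (n, j)))"
        by (rule nn_integral_count_space') auto
      then show "(\<integral>\<^sup>+ j. ?d (n, j) * h (?g (n, j)) \<partial>?C) = word_sum h n"
        by (auto simp: word_sum_def intro!: sum.cong)
    qed
    finally show ?thesis .
  qed
  have "Phi \<nu> = scale_measure (inverse (Phi_Z \<nu>)) ?D"
  proof (rule measure_eqI)
    fix A assume "A \<in> sets (Phi \<nu>)"
    then have A: "A \<in> sets config_space" by simp
    then have "emeasure ?D A = (\<integral>\<^sup>+ n. word_sum (indicator A) n \<partial>\<nu>)"
      using D[of "indicator A"] by simp
    then show "emeasure (Phi \<nu>) A = emeasure (scale_measure (inverse (Phi_Z \<nu>)) ?D) A"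
      using emeasure_Phi_word_sum[OF \<nu> A] A by (simp add: divide_ennreal_def mult.commute)
  qed simp
  then show ?thesis
    using f D[OF f] by (simp add: nn_integral_scale_measure divide_ennreal_def mult.commute)
qed

lemma Phi_Z_ge_1: "state \<nu> \<Longrightarrow> 1 \<le> Phi_Z \<nu>"
proof -
  assume \<nu>: "state \<nu>"
  have "1 = (\<integral>\<^sup>+ n. 1 \<partial>\<nu>)"
    using prob_space.emeasure_space_1[OF state_prob_space[OF \<nu>]] by simp
  also have "\<dots> \<le> Phi_Z \<nu>"
    unfolding Phi_Z_eq[OF \<nu>] by (intro nn_integral_mono) (simp add: of_nat_add)
  finally show ?thesis .
qed

lemma state_Phi:
  assumes \<nu>: "state \<nu>" and Z: "Phi_Z \<nu> < \<infinity>"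
  shows "state (Phi \<nu>)"
proof -
  have "emeasure (Phi \<nu>) UNIV = Phi_Z \<nu> / Phi_Z \<nu>"
  proof -
    have "word_sum (indicator UNIV) = (\<lambda>n. of_nat (n 1 + 1))" by (simp add: fun_eq_iff word_sum_def)
    then show ?thesis
      using emeasure_Phi_word_sum[OF \<nu>, of UNIV] sets.top[of "config_space :: (int \<Rightarrow> bool) measure"]
      by (simp only: Phi_Z_eq[OF \<nu>] space_config_space)
  qed
  also have "\<dots> = 1" using Z Phi_Z_ge_1[OF \<nu>] by (intro ennreal_divide_self) auto
  moreover have "space (Phi \<nu>) = UNIV"
    using sets_eq_imp_space_eq[OF sets_Phi, of \<nu>] by simp
  ultimately show ?thesis
    by (auto simp: state_def intro: prob_spaceI)
qed

text \<open>The two windows of sites differ by one site at each end. The end terms are placed on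
  opposite sides to stay with sums of nonnegative terms; they are one function taken at
  \<open>n\<close> and at its translate.\<close>

lemma word_sum_translate:
  "word_sum (\<lambda>\<eta>. f (translate 1 \<eta>)) n + f (translate 1 (subst_map (translate (- 1) n))) =
     word_sum f n + f (translate 1 (subst_map n))"
proof -
  have "word_sum (\<lambda>\<eta>. f (translate 1 \<eta>)) n = f (translate 1 (subst_map n)) + (\<Sum>j<n 1. f (translate (- int j) (subst_map n)))"
    unfolding word_sum_def
    by (subst sum.atMost_shift) (auto intro!: sum.cong)
  moreover have "word_sum f n = (\<Sum>j<n 1. f (translate (- int j) (subst_map n))) + f (translate (- int (n 1)) (subst_map n))"
    unfolding word_sum_def lessThan_Suc_atMost[symmetric] by simp
  moreover have "translate 1 (subst_map (translate (- 1) n)) = translate (- int (n 1)) (subst_map n)"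
    by (simp add: subst_map_shift)
  ultimately show ?thesis by (simp add: ac_simps)
qed

lemma translation_invariant_Phi:
  assumes \<nu>: "state \<nu>" "translation_invariant \<nu>" and Z: "Phi_Z \<nu> < \<infinity>"
  shows "translation_invariant (Phi \<nu>)"
  unfolding translation_invariant_def
proof (rule state_eqI)
  have S: "state (Phi \<nu>)" by (rule state_Phi[OF \<nu>(1) Z])
  then show "state (Phi \<nu>)" .
  show "state (distr (Phi \<nu>) config_space (translate 1))"
    by (rule state_distr_state[OF S]) measurable
  fix A :: "(int \<Rightarrow> bool) set" assume A [measurable]: "A \<in> sets config_space"
  let ?f = "indicator A :: _ \<Rightarrow> ennreal"
  have "emeasure (distr (Phi \<nu>) config_space (translate 1)) A = (\<integral>\<^sup>+ \<eta>. ?f \<eta> \<partial>distr (Phi \<nu>) config_space (translate 1))"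
    by simp
  also have "\<dots> = (\<integral>\<^sup>+ \<eta>. ?f (translate 1 \<eta>) \<partial>Phi \<nu>)"
    by (rule nn_integral_distr) (auto simp: measurable_state S)
  also have "\<dots> = (\<integral>\<^sup>+ n. word_sum (\<lambda>\<eta>. ?f (translate 1 \<eta>)) n \<partial>\<nu>) / Phi_Z \<nu>"
    by (rule nn_integral_Phi[OF \<nu>(1)]) measurable
  also have "(\<integral>\<^sup>+ n. word_sum (\<lambda>\<eta>. ?f (translate 1 \<eta>)) n \<partial>\<nu>) = (\<integral>\<^sup>+ n. word_sum ?f n \<partial>\<nu>)"
  proof -
    let ?g = "\<lambda>n. ?f (translate 1 (subst_map n))"
    have [measurable]: "word_sum (\<lambda>\<eta>. ?f (translate 1 \<eta>)) \<in> borel_measurable \<nu>" "word_sum ?f \<in> borel_measurable \<nu>"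
      "?g \<in> borel_measurable \<nu>" "(\<lambda>n. ?g (translate (- 1) n)) \<in> borel_measurable \<nu>"
      using \<nu>(1) by (simp_all add: measurable_state)
    have "(\<integral>\<^sup>+ n. word_sum (\<lambda>\<eta>. ?f (translate 1 \<eta>)) n \<partial>\<nu>) + (\<integral>\<^sup>+ n. ?g (translate (- 1) n) \<partial>\<nu>)
        = (\<integral>\<^sup>+ n. word_sum ?f n \<partial>\<nu>) + (\<integral>\<^sup>+ n. ?g n \<partial>\<nu>)"
      by (subst (1 2) nn_integral_add[symmetric]) (auto simp: word_sum_translate)
    moreover have "(\<integral>\<^sup>+ n. ?g (translate (- 1) n) \<partial>\<nu>) = (\<integral>\<^sup>+ n. ?g n \<partial>\<nu>)"
      by (rule nn_integral_translate[OF \<nu>]) measurable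
    moreover have "(\<integral>\<^sup>+ n. ?g n \<partial>\<nu>) \<le> (\<integral>\<^sup>+ n. 1 \<partial>\<nu>)"
      by (intro nn_integral_mono) (auto simp: indicator_def)
    then have "(\<integral>\<^sup>+ n. ?g n \<partial>\<nu>) \<noteq> \<infinity>"
      using prob_space.emeasure_space_1[OF state_prob_space[OF \<nu>(1)]] by (auto simp: top_unique)
    \<comment> \<open>The equal end terms can be cancelled because their integral is at most
      1.\<close>
    ultimately show ?thesis
      by (simp add: ennreal_add_left_cancel add.commute)
  qed
  also have "(\<integral>\<^sup>+ n. word_sum ?f n \<partial>\<nu>) / Phi_Z \<nu> = emeasure (Phi \<nu>) A"
    by (rule emeasure_Phi_word_sum[OF \<nu>(1) A, symmetric])
  finally show "emeasure (distr (Phi \<nu>) config_space (translate 1)) A = emeasure (Phi \<nu>) A" .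
qed

section \<open>Intertwining of the two steps\<close>

lemma nn_integral_coins_reindex:
  assumes "inj g" "f \<in> borel_measurable config_space"
  shows "(\<integral>\<^sup>+ \<omega>. f (\<lambda>k. \<omega> (g k)) \<partial>coins) = (\<integral>\<^sup>+ \<omega>. f \<omega> \<partial>coins)"
proof -
  have "(\<lambda>\<omega> k. \<omega> (g k)) \<in> measurable coins config_space"
    by (rule measurable_into_config_space) (simp add: measurable_cong_sets[OF sets_coins refl])
  then have "(\<integral>\<^sup>+ \<omega>. f \<omega> \<partial>distr coins config_space (\<lambda>\<omega> k. \<omega> (g k))) = (\<integral>\<^sup>+ \<omega>. f (\<lambda>k. \<omega> (g k)) \<partial>coins)"
    using assms(2) by (subst nn_integral_distr) auto
  then show ?thesis by (simp only: coins_reindex[OF assms(1)])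
qed

text \<open>The zero that starts the word of stack 1 moves by minus the current across the bond from 0 to 1.
  The words before and after the step are compared through the two boundary terms, each a
  translate of the other.\<close>

definition moved_sum :: "((int \<Rightarrow> bool) \<Rightarrow> ennreal) \<Rightarrow> (int \<Rightarrow> nat) \<times> (int \<Rightarrow> bool) \<Rightarrow> ennreal" where
  "moved_sum f = (\<lambda>(n, \<omega>). \<Sum>j\<le>n 1. f (translate (- int j - ssm_current \<omega> n 0) (subst_map (ssm_step \<omega> n))))"

definition bdry_plus :: "((int \<Rightarrow> bool) \<Rightarrow> ennreal) \<Rightarrow> (int \<Rightarrow> nat) \<times> (int \<Rightarrow> bool) \<Rightarrow> ennreal" where
  "bdry_plus f = (\<lambda>(n, \<omega>). if ssm_current \<omega> n 0 = 1 then f (subst_map (ssm_step \<omega> n)) else 0)"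

definition bdry_minus :: "((int \<Rightarrow> bool) \<Rightarrow> ennreal) \<Rightarrow> (int \<Rightarrow> nat) \<times> (int \<Rightarrow> bool) \<Rightarrow> ennreal" where
  "bdry_minus f = (\<lambda>(n, \<omega>). if ssm_current \<omega> n 0 = - 1 then f (translate 1 (subst_map (ssm_step \<omega> n))) else 0)"

lemma measurable_moved [measurable]:
  assumes [measurable]: "f \<in> borel_measurable config_space"
  shows "moved_sum f \<in> borel_measurable (config_space \<Otimes>\<^sub>M coins)"
    and "bdry_plus f \<in> borel_measurable (config_space \<Otimes>\<^sub>M coins)"
    and "bdry_minus f \<in> borel_measurable (config_space \<Otimes>\<^sub>M coins)"
proof -
  have [measurable]: "(\<lambda>x. ssm_step (snd x) (fst x)) \<in> measurable (config_space \<Otimes>\<^sub>M coins) config_space"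
    using measurable_ssm_step by (simp add: case_prod_beta')
  note [measurable] = measurable_ssm_current measurable_fst_component
  have *: "(\<lambda>x. f (translate (a - ssm_current (snd x) (fst x) 0) (subst_map (ssm_step (snd x) (fst x)))))
      \<in> borel_measurable (config_space \<Otimes>\<^sub>M coins)" for a
    by (rule measurable_compose_countable[where f = "\<lambda>c x. f (translate (a - c) (subst_map (ssm_step (snd x) (fst x))))"
          and g = "\<lambda>x. ssm_current (snd x) (fst x) 0"]) measurable
  have "(\<lambda>x. (\<lambda>k x. \<Sum>j\<le>k. f (translate (- int j - ssm_current (snd x) (fst x) 0) (subst_map (ssm_step (snd x) (fst x))))) (fst x 1) x)
      \<in> borel_measurable (config_space \<Otimes>\<^sub>M coins)"
    by (rule measurable_compose_countable[OF _ measurable_fst_component]) (intro borel_measurable_sum *)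
  then show "moved_sum f \<in> borel_measurable (config_space \<Otimes>\<^sub>M coins)"
    by (simp add: moved_sum_def case_prod_beta')
  show "bdry_plus f \<in> borel_measurable (config_space \<Otimes>\<^sub>M coins)"
    "bdry_minus f \<in> borel_measurable (config_space \<Otimes>\<^sub>M coins)"
    unfolding bdry_plus_def bdry_minus_def case_prod_beta' by measurable
qed

lemma sum_atMost_int: "(\<Sum>j\<le>m. g (int j + c)) = (\<Sum>x\<in>{c..c + int m}. (g x :: 'a :: comm_monoid_add))"
  by (rule sum.reindex_bij_witness[where i = "\<lambda>x. nat (x - c)" and j = "\<lambda>j. int j + c"]) auto

text \<open>As offsets from the new start of word 1, the sites of the old word run from
  \<open>?c 0\<close> to \<open>m + ?c 1\<close>, those of the new word from 0 to \<open>m\<close>.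
  The intervals differ by at most one site at each end, and the sign of the current decides which of
  them has the extra site.\<close>

lemma moved_sum_eq:
  "moved_sum f (n, \<omega>) + bdry_plus f (n, \<omega>) + bdry_minus f (shift2 (- 1) (n, \<omega>)) =
   word_sum f (ssm_step \<omega> n) + bdry_minus f (n, \<omega>) + bdry_plus f (shift2 (- 1) (n, \<omega>))"
proof -
  let ?n' = "ssm_step \<omega> n" and ?c = "ssm_current \<omega> n"
  define g where "g x = f (translate (- x) (subst_map ?n'))" for x
  define m where "m = int (?n' 1)"
  have m: "m = int (n 1) + ?c 0 - ?c 1" and m0: "0 \<le> m"
    using ssm_step_height[of \<omega> n 1] by (simp_all add: m_def)
  have moved: "moved_sum f (n, \<omega>) = (\<Sum>x\<in>{?c 0..m + ?c 1}. g x)"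
  proof -
    have "moved_sum f (n, \<omega>) = (\<Sum>j\<le>n 1. g (int j + ?c 0))" by (simp add: moved_sum_def g_def)
    also have "\<dots> = (\<Sum>x\<in>{?c 0..?c 0 + int (n 1)}. g x)" by (rule sum_atMost_int)
    finally show ?thesis by (simp add: m add.commute)
  qed
  have new: "word_sum f ?n' = (\<Sum>x\<in>{0..m}. g x)"
    using sum_atMost_int[of g 0 "?n' 1"] by (simp add: word_sum_def g_def m_def)
  have n'_shift: "subst_map (ssm_step (translate (- 1) \<omega>) (translate (- 1) n)) = translate (- (m + 1)) (subst_map ?n')"
    by (simp add: ssm_step_translate subst_map_shift m_def)
  have plus: "bdry_plus f (n, \<omega>) = (if ?c 0 = 1 then g 0 else 0)"
    and minus: "bdry_minus f (n, \<omega>) = (if ?c 0 = - 1 then g (- 1) else 0)"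
    and plus': "bdry_plus f (shift2 (- 1) (n, \<omega>)) = (if ?c 1 = 1 then g (m + 1) else 0)"
    and minus': "bdry_minus f (shift2 (- 1) (n, \<omega>)) = (if ?c 1 = - 1 then g m else 0)"
    by (simp_all add: bdry_plus_def bdry_minus_def g_def shift2_def ssm_current_translate n'_shift)
  have left: "(\<Sum>x\<in>{?c 0..e}. g x) + bdry_plus f (n, \<omega>) = (\<Sum>x\<in>{0..e}. g x) + bdry_minus f (n, \<omega>)" if "0 \<le> e \<or> e = -1 \<and> ?c 0 \<le> 0" for e
  proof -
    have "{0..e} = insert 0 {1..e}" if "0 \<le> e" using that by auto
    moreover have "{-1..e} = insert (-1) {0..e}" using that by auto
    moreover have "e = -1 \<Longrightarrow> {0..e} = {}" by auto
    ultimately show ?thesis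
      using ssm_current_cases[of \<omega> n 0] that unfolding plus minus by (auto simp: ac_simps)
  qed
  have right: "(\<Sum>x\<in>{0..m + ?c 1}. g x) + bdry_minus f (shift2 (- 1) (n, \<omega>)) =
      (\<Sum>x\<in>{0..m}. g x) + bdry_plus f (shift2 (- 1) (n, \<omega>))"
  proof -
    have "{0..m + 1} = insert (m + 1) {0..m}" "{0..m} = insert m {0..m - 1}" using m0 by auto
    then show ?thesis
      using ssm_current_cases[of \<omega> n 1] unfolding plus' minus' by (auto simp: ac_simps)
  qed
  have "0 \<le> m + ?c 1 \<or> m + ?c 1 = - 1 \<and> ?c 0 \<le> 0"
    using m ssm_current_cases[of \<omega> n 0] ssm_current_cases[of \<omega> n 1] by auto
  from left[OF this] have "moved_sum f (n, \<omega>) + bdry_plus f (n, \<omega>) + bdry_minus f (shift2 (- 1) (n, \<omega>)) =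
      (\<Sum>x\<in>{0..m + ?c 1}. g x) + bdry_minus f (n, \<omega>) + bdry_minus f (shift2 (- 1) (n, \<omega>))"
    unfolding moved by simp
  also have "\<dots> = ((\<Sum>x\<in>{0..m + ?c 1}. g x) + bdry_minus f (shift2 (- 1) (n, \<omega>))) + bdry_minus f (n, \<omega>)"
    by (simp only: ac_simps)
  also have "\<dots> = word_sum f ?n' + bdry_minus f (n, \<omega>) + bdry_plus f (shift2 (- 1) (n, \<omega>))"
    unfolding right new by (simp only: ac_simps)
  finally show ?thesis .
qed

text \<open>Each boundary term occurs on both sides of \<open>moved_sum_eq\<close>, once of them
  shifted. The joint law is invariant under \<open>shift2\<close>, so the integrals agree, and
  \<open>bound\<close> keeps them finite, which permits the cancellation.\<close>

lemma nn_integral_moved_sum: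
  assumes \<nu>: "state \<nu>" "translation_invariant \<nu>" and f [measurable]: "f \<in> borel_measurable config_space"
    and bound: "\<And>\<eta>. f \<eta> \<le> 1"
  shows "(\<integral>\<^sup>+ x. moved_sum f x \<partial>(\<nu> \<Otimes>\<^sub>M coins)) = (\<integral>\<^sup>+ n. word_sum f n \<partial>(\<nu> \<bind> ssm))"
proof -
  let ?J = "\<nu> \<Otimes>\<^sub>M coins"
  interpret J: prob_space ?J by (rule prob_space_joint[OF \<nu>(1)])
  have step: "(\<integral>\<^sup>+ n. word_sum f n \<partial>(\<nu> \<bind> ssm)) = (\<integral>\<^sup>+ x. word_sum f (ssm_step (snd x) (fst x)) \<partial>?J)"
    unfolding bind_ssm[OF \<nu>(1)]
    by (subst nn_integral_distr) (auto simp: measurable_joint[OF \<nu>(1)] case_prod_beta')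
  have [measurable]: "(\<lambda>x. word_sum f (ssm_step (snd x) (fst x))) \<in> borel_measurable (config_space \<Otimes>\<^sub>M coins)"
    using measurable_compose[OF measurable_ssm_step measurable_word_sum[OF f]] by (simp add: case_prod_beta')
  have meas: "moved_sum f \<in> borel_measurable ?J" "bdry_plus f \<in> borel_measurable ?J" "bdry_minus f \<in> borel_measurable ?J"
    "(\<lambda>x. bdry_plus f (shift2 (- 1) x)) \<in> borel_measurable ?J" "(\<lambda>x. bdry_minus f (shift2 (- 1) x)) \<in> borel_measurable ?J"
    "(\<lambda>x. word_sum f (ssm_step (snd x) (fst x))) \<in> borel_measurable ?J"
    unfolding measurable_joint[OF \<nu>(1)] by measurable
  have fin: "(\<integral>\<^sup>+ x. bdry_plus f x \<partial>?J) + (\<integral>\<^sup>+ x. bdry_minus f x \<partial>?J) \<noteq> \<infinity>"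
  proof -
    have "(\<integral>\<^sup>+ x. bdry_plus f x \<partial>?J) \<le> (\<integral>\<^sup>+ x. 1 \<partial>?J)" "(\<integral>\<^sup>+ x. bdry_minus f x \<partial>?J) \<le> (\<integral>\<^sup>+ x. 1 \<partial>?J)"
      by (rule nn_integral_mono, use bound in \<open>simp add: bdry_plus_def bdry_minus_def split: prod.split\<close>)+
    then show ?thesis by (auto simp: J.emeasure_space_1 top_unique)
  qed
  have "(\<integral>\<^sup>+ x. moved_sum f x \<partial>?J) + (\<integral>\<^sup>+ x. bdry_plus f x \<partial>?J) + (\<integral>\<^sup>+ x. bdry_minus f (shift2 (- 1) x) \<partial>?J) =
      (\<integral>\<^sup>+ x. word_sum f (ssm_step (snd x) (fst x)) \<partial>?J) + (\<integral>\<^sup>+ x. bdry_minus f x \<partial>?J) + (\<integral>\<^sup>+ x. bdry_plus f (shift2 (- 1) x) \<partial>?J)"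
  proof -
    have "(\<integral>\<^sup>+ x. moved_sum f x \<partial>?J) + (\<integral>\<^sup>+ x. bdry_plus f x \<partial>?J) + (\<integral>\<^sup>+ x. bdry_minus f (shift2 (- 1) x) \<partial>?J) =
       (\<integral>\<^sup>+ x. moved_sum f x + bdry_plus f x + bdry_minus f (shift2 (- 1) x) \<partial>?J)"
      using meas by (simp add: nn_integral_add)
    also have "\<dots> = (\<integral>\<^sup>+ x. word_sum f (ssm_step (snd x) (fst x)) + bdry_minus f x + bdry_plus f (shift2 (- 1) x) \<partial>?J)"
    proof (rule nn_integral_cong)
      fix x show "moved_sum f x + bdry_plus f x + bdry_minus f (shift2 (- 1) x) =
          word_sum f (ssm_step (snd x) (fst x)) + bdry_minus f x + bdry_plus f (shift2 (- 1) x)"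
        using moved_sum_eq[of f "fst x" "snd x"] by simp
    qed
    finally show ?thesis using meas by (simp add: nn_integral_add)
  qed
  moreover have "(\<integral>\<^sup>+ x. bdry_plus f (shift2 (- 1) x) \<partial>?J) = (\<integral>\<^sup>+ x. bdry_plus f x \<partial>?J)"
    "(\<integral>\<^sup>+ x. bdry_minus f (shift2 (- 1) x) \<partial>?J) = (\<integral>\<^sup>+ x. bdry_minus f x \<partial>?J)"
    by (intro nn_integral_joint_shift \<nu>; measurable)+
  ultimately have "((\<integral>\<^sup>+ x. bdry_plus f x \<partial>?J) + (\<integral>\<^sup>+ x. bdry_minus f x \<partial>?J)) + (\<integral>\<^sup>+ x. moved_sum f x \<partial>?J) =
      ((\<integral>\<^sup>+ x. bdry_plus f x \<partial>?J) + (\<integral>\<^sup>+ x. bdry_minus f x \<partial>?J)) + (\<integral>\<^sup>+ x. word_sum f (ssm_step (snd x) (fst x)) \<partial>?J)"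
    by (simp add: ac_simps)
  then show ?thesis using fin step by (simp only: ennreal_add_left_cancel) auto
qed

text \<open>Comparing words with the constant function 1 shows that a step conserves the mean word
  length.\<close>

lemma Phi_Z_bind:
  assumes \<nu>: "state \<nu>" "translation_invariant \<nu>"
  shows "Phi_Z (\<nu> \<bind> ssm) = Phi_Z \<nu>"
proof -
  have "Phi_Z (\<nu> \<bind> ssm) = (\<integral>\<^sup>+ x. moved_sum (\<lambda>_. 1) x \<partial>(\<nu> \<Otimes>\<^sub>M coins))"
    unfolding Phi_Z_eq[OF state_bind_ssm[OF \<nu>(1)]] word_sum_1[symmetric]
    by (rule nn_integral_moved_sum[OF \<nu>, symmetric]) auto
  also have "\<dots> = (\<integral>\<^sup>+ x. of_nat (fst x 1 + 1) \<partial>(\<nu> \<Otimes>\<^sub>M coins))"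
    by (simp add: moved_sum_def case_prod_beta')
  also have "\<dots> = (\<integral>\<^sup>+ n. \<integral>\<^sup>+ \<omega>. of_nat (n 1 + 1) \<partial>coins \<partial>\<nu>)"
  proof -
    interpret C: sigma_finite_measure coins
      using prob_space_coins prob_space_imp_sigma_finite by blast
    have "(\<lambda>x. of_nat (fst x 1 + 1) :: ennreal) \<in> borel_measurable (\<nu> \<Otimes>\<^sub>M coins)"
      unfolding measurable_joint[OF \<nu>(1)]
      by (rule measurable_compose[OF measurable_fst_component]) simp
    from C.nn_integral_fst[OF this] show ?thesis by simp
  qed
  also have "\<dots> = Phi_Z \<nu>"
    using prob_space.emeasure_space_1[OF prob_space_coins] by (simp add: Phi_Z_eq[OF \<nu>(1)])
  finally show ?thesis .
qed

lemma Phi_bind: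
  assumes \<nu>: "state \<nu>" "translation_invariant \<nu>" and Z: "Phi_Z \<nu> < \<infinity>"
  shows "Phi \<nu> \<bind> fssep = Phi (\<nu> \<bind> ssm)"
proof (rule state_eqI)
  interpret C: sigma_finite_measure coins
    using prob_space_coins prob_space_imp_sigma_finite by blast
  have S: "state (Phi \<nu>)" by (rule state_Phi[OF \<nu>(1) Z])
  then show "state (Phi \<nu> \<bind> fssep)" by (rule state_bind_fssep)
  show "state (Phi (\<nu> \<bind> ssm))"
    by (rule state_Phi) (use \<nu> Z in \<open>auto simp: state_bind_ssm Phi_Z_bind\<close>)
  fix A :: "(int \<Rightarrow> bool) set" assume A [measurable]: "A \<in> sets config_space"
  let ?f = "indicator A :: _ \<Rightarrow> ennreal"
  define G where "G \<eta> = (\<integral>\<^sup>+ \<omega>. ?f (fssep_step \<omega> \<eta>) \<partial>coins)" for \<eta>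
  have f_step: "(\<lambda>x. ?f (fssep_step (snd x) (fst x))) \<in> borel_measurable (config_space \<Otimes>\<^sub>M coins)"
    using measurable_compose[OF measurable_fssep_step borel_measurable_indicator[OF A]] by (simp add: case_prod_beta')
  have [measurable]: "G \<in> borel_measurable config_space"
    unfolding G_def using f_step by (intro C.borel_measurable_nn_integral) (simp add: case_prod_beta')
  have "emeasure (Phi \<nu> \<bind> fssep) A = (\<integral>\<^sup>+ \<eta>. ?f \<eta> \<partial>(Phi \<nu> \<bind> fssep))"
    using A sets_state[OF state_bind_fssep[OF S]] by simp
  also have "\<dots> = (\<integral>\<^sup>+ x. ?f (fssep_step (snd x) (fst x)) \<partial>(Phi \<nu> \<Otimes>\<^sub>M coins))"
    unfolding bind_fssep[OF S]
    by (subst nn_integral_distr) (auto simp: measurable_joint[OF S] case_prod_beta')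
  also have "\<dots> = (\<integral>\<^sup>+ \<eta>. G \<eta> \<partial>Phi \<nu>)"
    unfolding G_def using f_step by (subst C.nn_integral_fst[symmetric]) (auto simp: measurable_joint[OF S])
  also have "\<dots> = (\<integral>\<^sup>+ n. word_sum G n \<partial>\<nu>) / Phi_Z \<nu>"
    by (rule nn_integral_Phi[OF \<nu>(1)]) measurable
  also have "(\<integral>\<^sup>+ n. word_sum G n \<partial>\<nu>) = (\<integral>\<^sup>+ n. \<integral>\<^sup>+ \<omega>. moved_sum ?f (n, \<omega>) \<partial>coins \<partial>\<nu>)"
  proof (rule nn_integral_cong)
    fix n
    have meas: "(\<lambda>\<omega>. ?f (translate (a - ssm_current \<omega> n 0) (subst_map (ssm_step \<omega> n)))) \<in> borel_measurable coins" for a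
    proof -
      have "(\<lambda>\<omega>. ssm_step \<omega> n) \<in> measurable coins config_space"
        using measurable_compose[OF measurable_Pair1' measurable_ssm_step, of n] by simp
      note [measurable] = this
      have "(\<lambda>\<omega>. ssm_current \<omega> n 0) \<in> measurable coins (count_space UNIV)"
        using measurable_compose[OF measurable_Pair1' measurable_ssm_current, of n] by simp
      then show ?thesis
        by (rule measurable_compose_countable[rotated, where f = "\<lambda>c \<omega>. ?f (translate (a - c) (subst_map (ssm_step \<omega> n)))"]) measurable
    qed
    have "G (translate (- int j) (subst_map n)) =
        (\<integral>\<^sup>+ \<omega>. ?f (translate (- int j - ssm_current \<omega> n 0) (subst_map (ssm_step \<omega> n))) \<partial>coins)" for j
    proof -
      \<comment> \<open>The law of the coins is translation invariant, so the coins may be moved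
        along with the configuration; afterwards the coins read at the zeros are replaced by bond
        coins.\<close>
      have "G (translate (- int j) (subst_map n)) = (\<integral>\<^sup>+ \<omega>. ?f (fssep_step (translate (- int j) \<omega>) (translate (- int j) (subst_map n))) \<partial>coins)"
        unfolding G_def
      proof (rule nn_integral_translate[OF state_coins translation_invariant_coins, symmetric])
        show "(\<lambda>\<omega>. ?f (fssep_step \<omega> (translate (- int j) (subst_map n)))) \<in> borel_measurable config_space"
          using measurable_compose[OF measurable_Pair1' f_step, of "translate (- int j) (subst_map n)"]
          by (simp add: measurable_cong_sets[OF sets_coins refl])
      qed
      also have "\<dots> = (\<integral>\<^sup>+ \<omega>. ?f (translate (- int j - ssm_current (zero_coins n \<omega>) n 0) (subst_map (ssm_step (zero_coins n \<omega>) n))) \<partial>coins)"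
        by (simp add: fssep_step_translate fssep_step_subst_map)
      also have "\<dots> = (\<integral>\<^sup>+ \<omega>. ?f (translate (- int j - ssm_current \<omega> n 0) (subst_map (ssm_step \<omega> n))) \<partial>coins)"
        unfolding zero_coins_def
        by (rule nn_integral_coins_reindex) (use meas in \<open>auto simp: inj_def measurable_cong_sets[OF sets_coins refl] simp del: word_start_add1\<close>)
      finally show ?thesis .
    qed
    then show "word_sum G n = (\<integral>\<^sup>+ \<omega>. moved_sum ?f (n, \<omega>) \<partial>coins)"
      unfolding word_sum_def moved_sum_def using meas by (simp add: nn_integral_sum)
  qed
  also have "\<dots> = (\<integral>\<^sup>+ x. moved_sum ?f x \<partial>(\<nu> \<Otimes>\<^sub>M coins))"
    by (rule C.nn_integral_fst) (simp add: measurable_joint[OF \<nu>(1)])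
  also have "\<dots> = (\<integral>\<^sup>+ n. word_sum ?f n \<partial>(\<nu> \<bind> ssm))"
    by (rule nn_integral_moved_sum[OF \<nu>]) (auto simp: indicator_def)
  also have "\<dots> / Phi_Z \<nu> = emeasure (Phi (\<nu> \<bind> ssm)) A"
    by (simp add: emeasure_Phi_word_sum[OF state_bind_ssm[OF \<nu>(1)] A] Phi_Z_bind[OF \<nu>])
  finally show "emeasure (Phi \<nu> \<bind> fssep) A = emeasure (Phi (\<nu> \<bind> ssm)) A" .
qed

lemma TIS_Phi:
  assumes "TIS ssm \<nu>" "Phi_Z \<nu> < \<infinity>"
  shows "TIS fssep (Phi \<nu>)"
  using assms unfolding TIS_def stationary_def
  by (metis Phi_bind state_Phi translation_invariant_Phi)

section \<open>The Palm measure\<close>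

lemma translation_invariantI:
  assumes \<mu>: "state \<mu>"
    and eq: "\<And>A. A \<in> sets config_space \<Longrightarrow> emeasure \<mu> (translate (- 1) -` A) = emeasure \<mu> A"
  shows "translation_invariant \<mu>"
  unfolding translation_invariant_def
proof (rule state_eqI)
  show "state (distr \<mu> config_space (translate 1))"
    by (rule state_distr_state[OF \<mu>]) measurable
  fix A :: "(int \<Rightarrow> 'a) set" assume A: "A \<in> sets config_space"
  then have A': "translate 1 -` A \<in> sets config_space"
    using measurable_sets[OF measurable_translate A, of 1] by simp
  have "emeasure (distr \<mu> config_space (translate 1)) A = emeasure \<mu> (translate 1 -` A)"
    using A \<mu> by (subst emeasure_distr) (auto simp: measurable_state space_state)
  also have "\<dots> = emeasure \<mu> (translate (- 1) -` (translate 1 -` A))"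
    using eq[OF A'] by simp
  also have "translate (- 1) -` (translate 1 -` A) = A" by auto
  finally show "emeasure (distr \<mu> config_space (translate 1)) A = emeasure \<mu> A" .
qed (rule \<mu>)

lemma ennreal_mult_inverse_self: "0 < x \<Longrightarrow> x < \<top> \<Longrightarrow> x * inverse x = (1::ennreal)"
  using ennreal_divide_self[of x] by (auto simp: divide_ennreal_def)

lemma ennreal_times_divide_cancel: "p \<noteq> 0 \<Longrightarrow> p \<noteq> \<top> \<Longrightarrow> p * (x / p) = (x :: ennreal)"
  using ennreal_mult_inverse_self[of p]
  by (simp add: divide_ennreal_def mult.left_commute[of p] zero_less_iff_neq_zero less_top)

lemma ennreal_inverse_inverse: "inverse (inverse x) = (x :: ennreal)"
proof (cases x)
  case (real r)
  then show ?thesis by (cases "r = 0") (auto simp: inverse_ennreal)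
qed simp

definition palm :: "(int \<Rightarrow> bool) measure \<Rightarrow> (int \<Rightarrow> nat) measure" where
  "palm \<mu> = distr (uniform_measure \<mu> {\<eta>. \<not> \<eta> 1}) config_space stack_map"

lemma sets_zero_at: "{\<eta>. \<not> \<eta> (i::int)} \<in> sets config_space"
  using sets_site_value[of i False] by simp

lemma emeasure_palm:
  assumes \<mu>: "state \<mu>" and B: "B \<in> sets config_space"
  shows "emeasure (palm \<mu>) B = emeasure \<mu> {\<eta>. \<not> \<eta> 1 \<and> stack_map \<eta> \<in> B} / emeasure \<mu> {\<eta>. \<not> \<eta> 1}"
proof -
  have S: "{\<eta>. \<not> \<eta> (1::int)} \<in> sets \<mu>" and f: "stack_map \<in> measurable \<mu> config_space"
    using \<mu> sets_zero_at by (auto simp: sets_state measurable_state)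
  have "emeasure (palm \<mu>) B = emeasure (uniform_measure \<mu> {\<eta>. \<not> \<eta> 1}) (stack_map -` B)"
    unfolding palm_def using B f by (subst emeasure_distr) (auto simp: space_state[OF \<mu>])
  also have "\<dots> = emeasure \<mu> ({\<eta>. \<not> \<eta> 1} \<inter> stack_map -` B) / emeasure \<mu> {\<eta>. \<not> \<eta> 1}"
    using S measurable_sets[OF f B] by (subst emeasure_uniform_measure) (auto simp: space_state[OF \<mu>])
  finally show ?thesis by (simp add: vimage_def Int_def)
qed

lemma state_palm:
  assumes \<mu>: "state \<mu>" and p: "emeasure \<mu> {\<eta>. \<not> \<eta> 1} \<noteq> 0"
  shows "state (palm \<mu>)"
  unfolding palm_def
proof (rule state_distr)
  show "prob_space (uniform_measure \<mu> {\<eta>. \<not> \<eta> 1})"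
    using p prob_space.emeasure_le_1[OF state_prob_space[OF \<mu>], of "{\<eta>. \<not> \<eta> 1}"]
    by (intro prob_space_uniform_measure) (auto simp: top_unique)
qed (use \<mu> in \<open>simp add: measurable_cong_sets[OF sets_uniform_measure refl] measurable_state\<close>)

lemma all_shift_window:
  "(\<forall>i. 1 - int j < i \<and> i \<le> 1 \<longrightarrow> P (i + int j)) \<longleftrightarrow> (\<forall>i. 1 < i \<and> i \<le> 1 + int j \<longrightarrow> P i)" (is "?l \<longleftrightarrow> ?r")
proof
  assume ?l
  show ?r
  proof (intro allI impI)
    fix i assume "1 < i \<and> i \<le> 1 + int j"
    then show "P i" using \<open>?l\<close>[rule_format, of "i - int j"] by simp
  qed
qed auto

lemma subst_map_word_one:
  assumes "0 < j" "j \<le> n 1"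
  shows "subst_map n (1 + int j)"
  using assms subst_map_between[of n 1 "1 + int j"] word_start_add1[of n 1] by simp

text \<open>Among the sites of the word of stack 1 only the first is a zero. The event of a zero at
  site 1 therefore keeps just the term with offset 0 and returns the law of the stacks with the
  factor \<open>1 / Phi_Z \<nu>\<close>.\<close>

lemma palm_Phi:
  assumes \<nu>: "state \<nu>" and Z: "Phi_Z \<nu> < \<infinity>"
  shows "palm (Phi \<nu>) = \<nu>"
proof -
  have S: "state (Phi \<nu>)" by (rule state_Phi[OF \<nu> Z])
  have Z0: "Phi_Z \<nu> \<noteq> 0" using Phi_Z_ge_1[OF \<nu>] by auto
  have *: "emeasure (Phi \<nu>) {\<eta>. \<not> \<eta> 1 \<and> stack_map \<eta> \<in> B} = emeasure \<nu> B / Phi_Z \<nu>"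
    if B: "B \<in> sets config_space" for B
  proof -
    let ?A = "{\<eta>. \<not> \<eta> 1 \<and> stack_map \<eta> \<in> B}"
    have "stack_map -` B \<in> sets config_space"
      using measurable_sets[OF measurable_stack_map B] by simp
    from sets.Int[OF sets_zero_at this, of 1] have A: "?A \<in> sets config_space"
      by (simp add: vimage_def Int_def)
    have "word_sum (indicator ?A) n = indicator B n" for n
    proof -
      have "word_sum (indicator ?A) n = (\<Sum>j\<le>n 1. if j = 0 then indicator B n else 0)"
        unfolding word_sum_def
      proof (rule sum.cong)
        fix j assume "j \<in> {..n 1}"
        then have "subst_map n (1 + int j)" if "j \<noteq> 0" using that by (intro subst_map_word_one) auto
        then show "indicator ?A (translate (- int j) (subst_map n)) = (if j = 0 then indicator B n else 0)"
          by (auto simp: indicator_def)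
      qed simp
      then show ?thesis by (simp add: sum.delta)
    qed
    then show ?thesis
      using B emeasure_Phi_word_sum[OF \<nu> A] by (simp add: sets_state[OF \<nu>])
  qed
  have p: "emeasure (Phi \<nu>) {\<eta>. \<not> \<eta> 1} = 1 / Phi_Z \<nu>"
    using *[of UNIV] prob_space.emeasure_space_1[OF state_prob_space[OF \<nu>]] sets.top[of "config_space :: (int \<Rightarrow> nat) measure"]
    by (simp add: space_state[OF \<nu>])
  have p0: "1 / Phi_Z \<nu> \<noteq> 0" using Z by (simp add: divide_ennreal_def ennreal_inverse_eq_0_iff less_top)
  show ?thesis
  proof (rule state_eqI)
    show "state (palm (Phi \<nu>))" by (rule state_palm[OF S]) (simp only: p p0 not_False_eq_True)
    fix B :: "(int \<Rightarrow> nat) set" assume B: "B \<in> sets config_space"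
    have "emeasure (palm (Phi \<nu>)) B = (emeasure \<nu> B / Phi_Z \<nu>) / (1 / Phi_Z \<nu>)"
      by (simp only: emeasure_palm[OF S B] * [OF B] p)
    also have "\<dots> = emeasure \<nu> B * (Phi_Z \<nu> * inverse (Phi_Z \<nu>))"
      by (simp add: divide_ennreal_def ennreal_inverse_inverse ac_simps)
    also have "Phi_Z \<nu> * inverse (Phi_Z \<nu>) = 1"
      using Z Z0 by (intro ennreal_mult_inverse_self) (auto simp: zero_less_iff_neq_zero)
    finally have "emeasure (palm (Phi \<nu>)) B = emeasure \<nu> B * 1" .
    then show "emeasure (palm (Phi \<nu>)) B = emeasure \<nu> B" by simp
  qed (rule \<nu>)
qed

lemma AE_zeros_unbounded:
  assumes \<mu>: "regular \<mu>"
  shows "AE \<eta> in \<mu>. zeros_unbounded \<eta>"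
proof -
  have S: "state \<mu>" and TI: "translation_invariant \<mu>" and full: "measure \<mu> {\<lambda>_. True} = 0"
    using \<mu> by (auto simp: regular_def)
  interpret prob_space \<mu> by (rule state_prob_space[OF S])
  \<comment> \<open>If an event can hold for at most one translate of a configuration, its preimages
    under distinct translations are disjoint and equally likely, hence null. It is applied to a zero
    at 0 with no further zero in the direction \<open>s\<close>.\<close>
  have null: "AE \<eta> in \<mu>. \<not> P \<eta>"
    if meas: "{\<eta>. P \<eta>} \<in> sets config_space"
      and disj: "\<And>\<eta> x y. P (translate x \<eta>) \<Longrightarrow> P (translate y \<eta>) \<Longrightarrow> x = y" for P :: "(int \<Rightarrow> bool) \<Rightarrow> bool"
  proof -
    let ?D = "\<lambda>k::nat. translate (int k) -` {\<eta>. P \<eta>}"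
    have D: "range ?D \<subseteq> sets \<mu>"
      using measurable_sets[OF measurable_translate meas] by (auto simp: sets_state[OF S])
    have dis: "disjoint_family ?D"
      using disj unfolding disjoint_family_on_def by fastforce
    have "(\<lambda>k. measure \<mu> (?D k)) sums measure \<mu> (\<Union>k. ?D k)"
      using D dis by (rule finite_measure_UNION)
    then have "(\<lambda>k. measure \<mu> (?D k)) \<longlonglongrightarrow> 0"
      by (intro summable_LIMSEQ_zero) (auto simp: sums_iff)
    moreover have "measure \<mu> (?D k) = measure \<mu> {\<eta>. P \<eta>}" for k
      using emeasure_translate[OF S TI meas] by (simp add: measure_def)
    ultimately have "measure \<mu> {\<eta>. P \<eta>} = 0" by (simp add: LIMSEQ_const_iff)
    then show ?thesis
      using AE_iff_measurable[of "{\<eta>. P \<eta>}" \<mu> "\<lambda>\<eta>. \<not> P \<eta>"] meas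
      by (simp add: sets_state[OF S] space_state[OF S] emeasure_eq_measure)
  qed
  have extreme: "AE \<eta> in \<mu>. \<not> (\<not> \<eta> (0::int) \<and> (\<forall>y>0. \<eta> (s * y)))" if s: "s = 1 \<or> s = - 1" for s
  proof (rule null)
    have "{\<eta> \<in> space config_space. \<not> \<eta> (0::int) \<and> (\<forall>y>0. \<eta> (s * y))} \<in> sets config_space" by measurable
    then show "{\<eta>. \<not> \<eta> (0::int) \<and> (\<forall>y>0. \<eta> (s * y))} \<in> sets config_space" by simp
    fix \<eta> :: "int \<Rightarrow> bool" and x y
    assume "\<not> translate x \<eta> 0 \<and> (\<forall>z>0. translate x \<eta> (s * z))" "\<not> translate y \<eta> 0 \<and> (\<forall>z>0. translate y \<eta> (s * z))"
    then have zero: "\<not> \<eta> (- x)" "\<not> \<eta> (- y)" and one: "\<And>z. 0 < z \<Longrightarrow> \<eta> (s * z - x)" "\<And>z. 0 < z \<Longrightarrow> \<eta> (s * z - y)"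
      by simp_all
    have eq: "s * (s * z) = z" for z using s by auto
    have "\<not> 0 < s * (y - x)" "\<not> 0 < s * (x - y)"
      using zero one(1)[of "s * (x - y)"] one(2)[of "s * (y - x)"] unfolding eq by auto
    then show "x = y" using s by auto
  qed
  have one: "AE \<eta> in \<mu>. \<eta> \<noteq> (\<lambda>_. True)"
  proof -
    have "{\<eta> \<in> space config_space. \<forall>i::int. \<eta> i} \<in> sets config_space" by measurable
    moreover have "{\<eta> \<in> space config_space. \<forall>i::int. \<eta> i} = {\<lambda>_. True}" by (auto simp: fun_eq_iff)
    ultimately have "{\<lambda>_. True} \<in> sets \<mu>" by (simp add: sets_state[OF S])
    with full show ?thesis
      using AE_iff_measurable[of "{\<lambda>_. True}" \<mu> "\<lambda>\<eta>. \<eta> \<noteq> (\<lambda>_. True)"]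
      by (simp add: space_state[OF S] emeasure_eq_measure)
  qed
  from AE_translate[OF S TI extreme[OF disjI1[OF refl]]] AE_translate[OF S TI extreme[OF disjI2[OF refl]]] one
  show ?thesis
  proof eventually_elim
    case (elim \<eta>)
    obtain z where z: "\<not> \<eta> z" using elim(3) by (auto simp: fun_eq_iff)
    have R: "\<exists>y>x. \<not> \<eta> y" if nz: "\<not> \<eta> x" for x
    proof -
      obtain y where "y > 0" "\<not> \<eta> (y + x)" using elim(1)[rule_format, of "- x"] nz by auto
      then show ?thesis by (intro exI[of _ "y + x"]) auto
    qed
    have L: "\<exists>y<x. \<not> \<eta> y" if nz: "\<not> \<eta> x" for x
    proof -
      obtain y where "y > 0" "\<not> \<eta> (x - y)" using elim(2)[rule_format, of "- x"] nz by auto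
      then show ?thesis by (intro exI[of _ "x - y"]) auto
    qed
    have far: "\<exists>y\<ge>z + int k. \<not> \<eta> y" "\<exists>y\<le>z - int k. \<not> \<eta> y" for k
    proof (induction k)
      case 0
      show "\<exists>y\<ge>z + int 0. \<not> \<eta> y" "\<exists>y\<le>z - int 0. \<not> \<eta> y" using z by auto
    next
      case (Suc k)
      obtain y where "y \<ge> z + int k" "\<not> \<eta> y" using Suc(1) by blast
      moreover then obtain y' where "y < y'" "\<not> \<eta> y'" using R[of y] by blast
      ultimately show "\<exists>y\<ge>z + int (Suc k). \<not> \<eta> y" by (intro exI[of _ y']) simp
      obtain y where "y \<le> z - int k" "\<not> \<eta> y" using Suc(2) by blast
      moreover then obtain y' where "y' < y" "\<not> \<eta> y'" using L[of y] by blast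
      ultimately show "\<exists>y\<le>z - int (Suc k). \<not> \<eta> y" by (intro exI[of _ y']) simp
    qed
    show "zeros_unbounded \<eta>"
      unfolding zeros_unbounded_def
    proof
      fix x
      obtain y where "y \<ge> z + int (nat \<bar>x - z\<bar> + 1)" "\<not> \<eta> y" using far(1) by blast
      moreover obtain y' where "y' \<le> z - int (nat \<bar>x - z\<bar> + 1)" "\<not> \<eta> y'" using far(2) by blast
      ultimately show "(\<exists>y>x. \<not> \<eta> y) \<and> (\<exists>y<x. \<not> \<eta> y)"
        by (intro conjI exI[of _ y] exI[of _ y']) auto
    qed
  qed
qed

definition last_zero :: "nat \<Rightarrow> (int \<Rightarrow> bool) set" where
  "last_zero j = {\<eta>. \<not> \<eta> (1 - int j) \<and> (\<forall>i. 1 - int j < i \<and> i \<le> 1 \<longrightarrow> \<eta> i)}"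

lemma sets_last_zero: "last_zero j \<in> sets config_space"
proof -
  have "{\<eta> \<in> space config_space. \<not> \<eta> (1 - int j) \<and> (\<forall>i. 1 - int j < i \<and> i \<le> 1 \<longrightarrow> \<eta> i)} \<in> sets config_space"
    by measurable
  then show ?thesis by (simp add: last_zero_def)
qed

lemma disjoint_last_zero: "disjoint_family last_zero"
proof -
  have "j \<le> k" if "\<eta> \<in> last_zero j" "\<eta> \<in> last_zero k" for \<eta> j k
  proof (rule ccontr)
    assume "\<not> j \<le> k"
    then have "\<eta> (1 - int k)" using that(1) by (simp add: last_zero_def)
    then show False using that(2) by (simp add: last_zero_def)
  qed
  then show ?thesis by (auto simp: disjoint_family_on_def intro: antisym)
qed

lemma last_zero_exists:
  assumes "zeros_unbounded \<eta>"
  shows "\<exists>j. \<eta> \<in> last_zero j"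
proof -
  obtain y where "y < 2" "\<not> \<eta> y" using assms zeros_unbounded_def by blast
  then have "\<not> \<eta> (1 - int (nat (1 - y)))" by simp
  define j where "j = (LEAST j. \<not> \<eta> (1 - int j))"
  have 1: "\<not> \<eta> (1 - int j)" unfolding j_def by (rule LeastI) fact
  have 2: "\<eta> i" if "1 - int j < i" "i \<le> 1" for i
    using not_less_Least[of "nat (1 - i)" "\<lambda>j. \<not> \<eta> (1 - int j)"] that by (auto simp: j_def)
  show ?thesis using 1 2 by (auto simp: last_zero_def)
qed

lemma stack_map_ge_iff:
  assumes "zeros_unbounded \<eta>" "\<not> \<eta> 1"
  shows "j \<le> stack_map \<eta> 1 \<longleftrightarrow> (\<forall>i. 1 < i \<and> i \<le> 1 + int j \<longrightarrow> \<eta> i)"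
proof -
  let ?n = "stack_map \<eta>"
  have \<eta>: "subst_map ?n = \<eta>" by (rule subst_map_stack_map[OF assms])
  have end0: "\<not> \<eta> (1 + int (?n 1) + 1)"
    using subst_map_word_start[of ?n "1 + 1"] unfolding \<eta> word_start_add1 word_start_1 .
  show ?thesis
  proof
    assume j: "j \<le> ?n 1"
    show "\<forall>i. 1 < i \<and> i \<le> 1 + int j \<longrightarrow> \<eta> i"
    proof (intro allI impI)
      fix i :: int assume i: "1 < i \<and> i \<le> 1 + int j"
      then have "nat (i - 1) \<le> ?n 1" using j by linarith
      then show "\<eta> i" using subst_map_word_one[of "nat (i - 1)" ?n] i unfolding \<eta> by simp
    qed
  next
    assume *: "\<forall>i. 1 < i \<and> i \<le> 1 + int j \<longrightarrow> \<eta> i"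
    show "j \<le> ?n 1"
    proof (rule ccontr)
      assume "\<not> j \<le> ?n 1"
      then show False using end0 *[rule_format, of "1 + int (?n 1) + 1"] by simp
    qed
  qed
qed

context
  fixes \<mu> :: "(int \<Rightarrow> bool) measure"
  assumes \<mu>: "state \<mu>" "translation_invariant \<mu>" and zeros: "AE \<eta> in \<mu>. zeros_unbounded \<eta>"
begin

lemma emeasure_split_last_zero:
  assumes A: "A \<in> sets config_space"
  shows "emeasure \<mu> A = (\<Sum>j. emeasure \<mu> (A \<inter> last_zero j))"
proof -
  have "emeasure \<mu> A = emeasure \<mu> (\<Union>j. A \<inter> last_zero j)"
  proof (rule emeasure_eq_AE)
    show "AE \<eta> in \<mu>. \<eta> \<in> A \<longleftrightarrow> \<eta> \<in> (\<Union>j. A \<inter> last_zero j)"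
      using zeros by eventually_elim (use last_zero_exists in auto)
  qed (use A sets_last_zero in \<open>auto simp: sets_state[OF \<mu>(1)]\<close>)
  also have "\<dots> = (\<Sum>j. emeasure \<mu> (A \<inter> last_zero j))"
    using A sets_last_zero disjoint_last_zero
    by (intro suminf_emeasure[symmetric]) (auto simp: sets_state[OF \<mu>(1)] disjoint_family_on_def)
  finally show ?thesis .
qed

lemma emeasure_zero_pos: "emeasure \<mu> {\<eta>. \<not> \<eta> 1} \<noteq> 0"
proof
  assume 0: "emeasure \<mu> {\<eta>. \<not> \<eta> 1} = 0"
  have "emeasure \<mu> {\<eta>. \<not> \<eta> (1 - int j)} = 0" for j
    using emeasure_translate[OF \<mu> sets_zero_at[of 1], of "int j"] 0 by (simp add: vimage_def)
  then have "emeasure \<mu> (UNIV \<inter> last_zero j) = 0" for j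
    using emeasure_mono[of "UNIV \<inter> last_zero j" "{\<eta>. \<not> \<eta> (1 - int j)}" \<mu>] sets_zero_at
    by (auto simp: last_zero_def sets_state[OF \<mu>(1)])
  then have "emeasure \<mu> UNIV = 0"
    using emeasure_split_last_zero[of UNIV] sets.top[of "config_space :: (int \<Rightarrow> bool) measure"] by simp
  then show False
    using prob_space.emeasure_space_1[OF state_prob_space[OF \<mu>(1)]] by (simp add: space_state[OF \<mu>(1)])
qed

lemma emeasure_zero_finite: "emeasure \<mu> {\<eta>. \<not> \<eta> 1} \<noteq> \<top>"
  using prob_space.emeasure_le_1[OF state_prob_space[OF \<mu>(1)], of "{\<eta>. \<not> \<eta> 1}"] by (auto simp: top_unique)

lemma state_palm_zeros: "state (palm \<mu>)"
  by (rule state_palm[OF \<mu>(1) emeasure_zero_pos])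

text \<open>Inversion formula: split by the last zero at or before site 1 and move that zero to site
  1. The event \<open>last_zero j\<close> becomes the condition that stack 1 has height at least
  \<open>j\<close>, and the sum over \<open>j\<close> is \<open>word_sum\<close>.\<close>

lemma emeasure_from_palm:
  assumes A: "A \<in> sets config_space"
  shows "emeasure \<mu> A = emeasure \<mu> {\<eta>. \<not> \<eta> 1} * (\<integral>\<^sup>+ n. word_sum (indicator A) n \<partial>palm \<mu>)"
proof -
  let ?p = "emeasure \<mu> {\<eta>. \<not> \<eta> 1}"
  let ?B = "\<lambda>j. {n. j \<le> n 1 \<and> translate (- int j) (subst_map n) \<in> A}"
  have B: "?B j \<in> sets config_space" for j :: nat
  proof -
    note [measurable] = A
    have "{n \<in> space config_space. j \<le> n (1::int) \<and> translate (- int j) (subst_map n) \<in> A} \<in> sets config_space"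
      by measurable
    then show ?thesis by simp
  qed
  have one: "emeasure \<mu> (A \<inter> last_zero j) = ?p * emeasure (palm \<mu>) (?B j)" for j
  proof -
    have "emeasure \<mu> (A \<inter> last_zero j) = emeasure \<mu> (translate (- int j) -` (A \<inter> last_zero j))"
      by (rule emeasure_translate[OF \<mu>, symmetric]) (use A sets_last_zero in auto)
    also have "\<dots> = emeasure \<mu> {\<eta>. \<not> \<eta> 1 \<and> stack_map \<eta> \<in> ?B j}"
    proof (rule emeasure_eq_AE)
      show "AE \<eta> in \<mu>. \<eta> \<in> translate (- int j) -` (A \<inter> last_zero j) \<longleftrightarrow> \<eta> \<in> {\<eta>. \<not> \<eta> 1 \<and> stack_map \<eta> \<in> ?B j}"
        using zeros
      proof eventually_elim
        case (elim \<eta>)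
        show ?case
        proof (cases "\<eta> 1")
          case False
          show ?thesis
            using False elim all_shift_window[of j \<eta>]
            by (simp add: last_zero_def stack_map_ge_iff subst_map_stack_map conj_commute)
        qed (simp add: last_zero_def)
      qed
      have "stack_map -` (?B j) \<in> sets config_space"
        using measurable_sets[OF measurable_stack_map B] by simp
      from sets.Int[OF sets_zero_at this, of 1]
      show "{\<eta>. \<not> \<eta> 1 \<and> stack_map \<eta> \<in> ?B j} \<in> sets \<mu>"
        by (simp add: sets_state[OF \<mu>(1)] vimage_def Int_def)
      show "translate (- int j) -` (A \<inter> last_zero j) \<in> sets \<mu>"
        using measurable_sets[OF measurable_translate sets.Int[OF A sets_last_zero]] by (simp add: sets_state[OF \<mu>(1)])
    qed
    also have "\<dots> = ?p * emeasure (palm \<mu>) (?B j)"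
      unfolding emeasure_palm[OF \<mu>(1) B]
      by (rule ennreal_times_divide_cancel[OF emeasure_zero_pos emeasure_zero_finite, symmetric])
    finally show ?thesis .
  qed
  have "(\<Sum>j. emeasure (palm \<mu>) (?B j)) = (\<integral>\<^sup>+ n. (\<Sum>j. indicator (?B j) n) \<partial>palm \<mu>)"
  proof -
    have "indicator (?B j) \<in> borel_measurable (palm \<mu>)" for j
      by (rule borel_measurable_indicator) (simp only: sets_state[OF state_palm_zeros] B)
    then show ?thesis
      by (subst nn_integral_suminf) (simp_all add: sets_state[OF state_palm_zeros] B)
  qed
  also have "\<dots> = (\<integral>\<^sup>+ n. word_sum (indicator A) n \<partial>palm \<mu>)"
  proof (rule nn_integral_cong)
    fix n
    have "(\<Sum>j. indicator (?B j) n :: ennreal) = (\<Sum>j\<in>{..n 1}. indicator (?B j) n)"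
      by (rule suminf_finite) auto
    also have "\<dots> = word_sum (indicator A) n"
      unfolding word_sum_def by (rule sum.cong) (auto simp: indicator_def)
    finally show "(\<Sum>j. indicator (?B j) n) = word_sum (indicator A) n" .
  qed
  finally show ?thesis
    using emeasure_split_last_zero[OF A] by (simp add: one)
qed

text \<open>Kac's formula: the probability of a zero is the reciprocal of the mean word
  length.\<close>

lemma Phi_Z_palm: "emeasure \<mu> {\<eta>. \<not> \<eta> 1} * Phi_Z (palm \<mu>) = 1"
proof -
  have "word_sum (indicator UNIV) = (\<lambda>n. of_nat (n 1 + 1))" by (simp add: fun_eq_iff word_sum_def)
  then show ?thesis
    using emeasure_from_palm[of UNIV] sets.top[of "config_space :: (int \<Rightarrow> bool) measure"]
      prob_space.emeasure_space_1[OF state_prob_space[OF \<mu>(1)]]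
    by (simp only: Phi_Z_eq[OF state_palm_zeros] space_state[OF \<mu>(1)] space_config_space)
qed

lemma Phi_Z_palm_finite: "Phi_Z (palm \<mu>) < \<infinity>"
proof (rule ccontr)
  assume "\<not> ?thesis"
  then have "Phi_Z (palm \<mu>) = \<top>" by (simp add: less_top[symmetric])
  then show False using Phi_Z_palm emeasure_zero_pos by (simp add: ennreal_mult_top)
qed

lemma Phi_palm: "Phi (palm \<mu>) = \<mu>"
proof (rule state_eqI)
  show "state (Phi (palm \<mu>))" by (rule state_Phi[OF state_palm_zeros Phi_Z_palm_finite])
  show "state \<mu>" by (rule \<mu>(1))
  fix A :: "(int \<Rightarrow> bool) set" assume A: "A \<in> sets config_space"
  let ?p = "emeasure \<mu> {\<eta>. \<not> \<eta> 1}" and ?I = "\<integral>\<^sup>+ n. word_sum (indicator A) n \<partial>palm \<mu>"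
  have "?I / Phi_Z (palm \<mu>) = ?I * ?p"
  proof -
    have "inverse (Phi_Z (palm \<mu>)) = ?p"
    proof -
      have Z0: "Phi_Z (palm \<mu>) \<noteq> 0" using Phi_Z_ge_1[OF state_palm_zeros] by auto
      have "?p = ?p * (Phi_Z (palm \<mu>) * inverse (Phi_Z (palm \<mu>)))"
        using Z0 Phi_Z_palm_finite ennreal_mult_inverse_self[of "Phi_Z (palm \<mu>)"]
        by (simp add: zero_less_iff_neq_zero)
      also have "\<dots> = inverse (Phi_Z (palm \<mu>))"
        using Phi_Z_palm by (simp add: mult.assoc[symmetric])
      finally show ?thesis by simp
    qed
    then show ?thesis by (simp add: divide_ennreal_def)
  qed
  then show "emeasure (Phi (palm \<mu>)) A = emeasure \<mu> A"
    using emeasure_from_palm[OF A] emeasure_Phi_word_sum[OF state_palm_zeros A] by (simp add: mult.commute)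
qed

text \<open>The origin moves from one zero to the next. Splitting by the height of stack 1 on one
  side and by the distance back to the preceding zero on the other gives pieces that are translates
  of each other in the particle picture.\<close>

lemma translation_invariant_palm: "translation_invariant (palm \<mu>)"
proof (rule translation_invariantI[OF state_palm_zeros])
  fix B :: "(int \<Rightarrow> nat) set" assume B [measurable]: "B \<in> sets config_space"
  let ?S = "{\<eta>. \<not> \<eta> 1 \<and> stack_map \<eta> \<in> B}"
  let ?C = "\<lambda>k. {\<eta>. \<not> \<eta> 1 \<and> stack_map \<eta> 1 = k \<and> translate (- 1) (stack_map \<eta>) \<in> B}"
  have meas: "{\<eta>. \<not> \<eta> 1 \<and> Q (stack_map \<eta>)} \<in> sets config_space"
    if "{n. Q n} \<in> sets config_space" for Q
  proof -
    have "stack_map -` {n. Q n} \<in> sets config_space"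
      using measurable_sets[OF measurable_stack_map that] by simp
    from sets.Int[OF sets_zero_at this, of 1] show ?thesis by (simp add: vimage_def Int_def)
  qed
  have S: "?S \<in> sets config_space" using meas[of "\<lambda>n. n \<in> B"] B by simp
  have Q: "{n. n (1::int) = k \<and> translate (- 1) n \<in> B} \<in> sets config_space" for k
  proof -
    have "{n \<in> space config_space. n (1::int) = k \<and> translate (- 1) n \<in> B} \<in> sets config_space" by measurable
    then show ?thesis by simp
  qed
  have C: "?C k \<in> sets config_space" for k using meas[OF Q] .
  have tB: "translate (- 1) -` B \<in> sets config_space"
    using measurable_sets[OF measurable_translate B] by simp
  have "emeasure \<mu> {\<eta>. \<not> \<eta> 1 \<and> stack_map \<eta> \<in> translate (- 1) -` B} = emeasure \<mu> (\<Union>k. ?C k)"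
    by (rule arg_cong[where f = "emeasure \<mu>"]) auto
  also have "\<dots> = (\<Sum>k. emeasure \<mu> (?C k))"
    using C by (intro suminf_emeasure[symmetric]) (auto simp: sets_state[OF \<mu>(1)] disjoint_family_on_def)
  also have "\<dots> = (\<Sum>k. emeasure \<mu> (translate (- 1) -` ?S \<inter> last_zero k))"
  proof (rule suminf_cong)
    fix k
    \<comment> \<open>A zero at site 2, with stacks in \<open>B\<close> seen from it, whose
      preceding zero is at \<open>1 - k\<close>. Moved so that the preceding zero lies at site 1,
      this is a word with exactly \<open>k\<close> ones followed by the next zero.\<close>
    let ?D = "translate (- 1) -` ?S \<inter> last_zero k"
    have D: "?D \<in> sets config_space"
      using measurable_sets[OF measurable_translate S, of "- 1"] sets_last_zero by auto
    have "emeasure \<mu> (?C k) = emeasure \<mu> (translate (- int k) -` ?D)"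
    proof (rule emeasure_eq_AE)
      show "AE \<eta> in \<mu>. \<eta> \<in> ?C k \<longleftrightarrow> \<eta> \<in> translate (- int k) -` ?D"
        using zeros
      proof eventually_elim
        case (elim \<eta>)
        show ?case
        proof (cases "\<eta> 1")
          case False
          have n: "subst_map (stack_map \<eta>) = \<eta>" by (rule subst_map_stack_map[OF elim False])
          have shift: "translate (- 1) (stack_map \<eta>) = stack_map (translate (- (int (stack_map \<eta> 1) + 1)) \<eta>)"
            using stack_map_subst_map[of "translate (- 1) (stack_map \<eta>)"] by (simp add: subst_map_shift n)
          have "stack_map \<eta> 1 = k \<longleftrightarrow> k \<le> stack_map \<eta> 1 \<and> \<not> Suc k \<le> stack_map \<eta> 1" by auto
          also have "\<dots> \<longleftrightarrow> (\<forall>i. 1 < i \<and> i \<le> 1 + int k \<longrightarrow> \<eta> i) \<and> \<not> \<eta> (2 + int k)"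
            unfolding stack_map_ge_iff[OF elim False]
          proof -
            have "(\<forall>i. 1 < i \<and> i \<le> 1 + int (Suc k) \<longrightarrow> \<eta> i) \<longleftrightarrow> (\<forall>i. 1 < i \<and> i \<le> 1 + int k \<longrightarrow> \<eta> i) \<and> \<eta> (2 + int k)"
            proof (intro iffI allI impI conjI)
              fix i :: int
              assume *: "(\<forall>i. 1 < i \<and> i \<le> 1 + int k \<longrightarrow> \<eta> i) \<and> \<eta> (2 + int k)" and i: "1 < i \<and> i \<le> 1 + int (Suc k)"
              show "\<eta> i"
              proof (cases "i \<le> 1 + int k")
                case False
                then have "i = 2 + int k" using i by simp
                then show ?thesis using * by simp
              qed (use * i in auto)
            qed auto
            then show "((\<forall>i. 1 < i \<and> i \<le> 1 + int k \<longrightarrow> \<eta> i) \<and> \<not> (\<forall>i. 1 < i \<and> i \<le> 1 + int (Suc k) \<longrightarrow> \<eta> i)) \<longleftrightarrow>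
               ((\<forall>i. 1 < i \<and> i \<le> 1 + int k \<longrightarrow> \<eta> i) \<and> \<not> \<eta> (2 + int k))" by blast
          qed
          also have "(\<forall>i. 1 < i \<and> i \<le> 1 + int k \<longrightarrow> \<eta> i) \<longleftrightarrow> (\<forall>i. 1 - int k < i \<and> i \<le> 1 \<longrightarrow> \<eta> (i + int k))"
            by (rule all_shift_window[symmetric])
          finally show ?thesis
            using False shift by (auto simp: last_zero_def algebra_simps)
        qed (simp add: last_zero_def)
      qed
      show "?C k \<in> sets \<mu>" using C by (simp add: sets_state[OF \<mu>(1)])
      show "translate (- int k) -` ?D \<in> sets \<mu>"
        using measurable_sets[OF measurable_translate D, of "- int k"] by (simp add: sets_state[OF \<mu>(1)])
    qed
    also have "\<dots> = emeasure \<mu> ?D" by (rule emeasure_translate[OF \<mu> D])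
    finally show "emeasure \<mu> (?C k) = emeasure \<mu> ?D" .
  qed
  also have "\<dots> = emeasure \<mu> (translate (- 1) -` ?S)"
    by (rule emeasure_split_last_zero[symmetric]) (use measurable_sets[OF measurable_translate S, of "- 1"] in simp)
  also have "\<dots> = emeasure \<mu> ?S" by (rule emeasure_translate[OF \<mu> S])
  finally show "emeasure (palm \<mu>) (translate (- 1) -` B) = emeasure (palm \<mu>) B"
    by (simp only: emeasure_palm[OF \<mu>(1) tB] emeasure_palm[OF \<mu>(1) B])
qed

text \<open>Stationarity transfers backwards because \<open>palm\<close> is a left inverse of
  \<open>Phi\<close>: the measure \<open>palm \<mu>\<close> and its image under a step have the same
  image under \<open>Phi\<close>.\<close>

lemma TIS_palm:
  assumes "stationary fssep \<mu>"
  shows "TIS ssm (palm \<mu>)"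
proof -
  let ?\<nu> = "palm \<mu>"
  have "Phi (?\<nu> \<bind> ssm) = Phi ?\<nu>"
    using Phi_bind[OF state_palm_zeros translation_invariant_palm Phi_Z_palm_finite] assms
    by (simp add: Phi_palm stationary_def)
  then have "palm (Phi (?\<nu> \<bind> ssm)) = palm (Phi ?\<nu>)" by simp
  moreover have "palm (Phi (?\<nu> \<bind> ssm)) = ?\<nu> \<bind> ssm"
    by (rule palm_Phi) (use Phi_Z_palm_finite Phi_Z_bind[OF state_palm_zeros translation_invariant_palm]
        state_bind_ssm[OF state_palm_zeros] in auto)
  ultimately show ?thesis
    using state_palm_zeros translation_invariant_palm palm_Phi[OF state_palm_zeros Phi_Z_palm_finite]
    by (simp add: TIS_def stationary_def)
qed

end

section \<open>Densities\<close>

definition averages_to :: "(nat \<Rightarrow> real) \<Rightarrow> real \<Rightarrow> bool" where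
  "averages_to a r \<longleftrightarrow> (\<lambda>N. (\<Sum>k<N. a k) / real N) \<longlonglongrightarrow> r"

lemma averages_to_Suc_iff: "averages_to (\<lambda>k. a (Suc k)) r \<longleftrightarrow> averages_to a r"
proof -
  let ?A = "\<lambda>N. \<Sum>k<N. a k" and ?B = "\<lambda>N. \<Sum>k<N. a (Suc k)"
  have AB: "?A (Suc N) = a 0 + ?B N" for N by (rule sum.lessThan_Suc_shift)
  have c0: "(\<lambda>N. a 0 / real N) \<longlonglongrightarrow> 0" by (rule lim_const_over_n)
  have q: "(\<lambda>N. real N / real (Suc N)) \<longlonglongrightarrow> 1" by (rule LIMSEQ_n_over_Suc_n)
  have q': "(\<lambda>N. real (Suc N) / real N) \<longlonglongrightarrow> 1" by (rule LIMSEQ_Suc_n_over_n)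
  show ?thesis
  proof
    assume "averages_to (\<lambda>k. a (Suc k)) r"
    then have "(\<lambda>N. ?B N / real N * (real N / real (Suc N)) + a 0 / real (Suc N)) \<longlonglongrightarrow> r * 1 + 0"
      unfolding averages_to_def by (intro tendsto_add tendsto_mult q LIMSEQ_Suc[OF c0])
    moreover have "\<forall>\<^sub>F N in sequentially. ?B N / real N * (real N / real (Suc N)) + a 0 / real (Suc N) = ?A (Suc N) / real (Suc N)"
      using eventually_gt_at_top[of 0] by eventually_elim (simp add: AB add_divide_distrib del: sum.lessThan_Suc of_nat_Suc)
    ultimately have "(\<lambda>N. ?A (Suc N) / real (Suc N)) \<longlonglongrightarrow> r"
      by (subst (asm) tendsto_cong) auto
    then show "averages_to a r" unfolding averages_to_def by (rule LIMSEQ_imp_Suc)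
  next
    assume "averages_to a r"
    then have "(\<lambda>N. ?A (Suc N) / real (Suc N) * (real (Suc N) / real N) - a 0 / real N) \<longlonglongrightarrow> r * 1 - 0"
      unfolding averages_to_def by (intro tendsto_diff tendsto_mult q' c0 LIMSEQ_Suc)
    moreover have "\<forall>\<^sub>F N in sequentially. ?A (Suc N) / real (Suc N) * (real (Suc N) / real N) - a 0 / real N = ?B N / real N"
      using eventually_gt_at_top[of 0] by eventually_elim (simp add: AB field_simps del: sum.lessThan_Suc of_nat_Suc)
    ultimately show "averages_to (\<lambda>k. a (Suc k)) r"
      unfolding averages_to_def by (subst (asm) tendsto_cong) auto
  qed
qed

lemma averages_to_add: "averages_to a r \<Longrightarrow> averages_to b s \<Longrightarrow> averages_to (\<lambda>k. a k + b k) (r + s)"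
  unfolding averages_to_def using tendsto_add by (fastforce simp: sum.distrib add_divide_distrib)

lemma averages_to_diff: "averages_to a r \<Longrightarrow> averages_to b s \<Longrightarrow> averages_to (\<lambda>k. a k - b k) (r - s)"
  unfolding averages_to_def using tendsto_diff by (fastforce simp: sum_subtractf diff_divide_distrib)

definition config_density :: "('a \<Rightarrow> real) \<Rightarrow> (int \<Rightarrow> 'a) \<Rightarrow> real \<Rightarrow> bool" where
  "config_density v \<eta> r \<longleftrightarrow>
     averages_to (\<lambda>k. v (\<eta> (1 + int k))) r \<and> averages_to (\<lambda>k. v (\<eta> (- 1 - int k))) r"

lemma has_density_iff: "has_density v \<mu> r \<longleftrightarrow> (AE \<eta> in \<mu>. config_density v \<eta> r)"
proof -
  have 1: "(\<Sum>i\<in>{1..int N}. v (\<eta> i)) = (\<Sum>k<N. v (\<eta> (1 + int k)))" for \<eta> N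
    by (rule sum.reindex_bij_witness[where i = "\<lambda>k. 1 + int k" and j = "\<lambda>i. nat (i - 1)"]) auto
  have 2: "(\<Sum>i\<in>{- int N..-1}. v (\<eta> i)) = (\<Sum>k<N. v (\<eta> (- 1 - int k)))" for \<eta> N
    by (rule sum.reindex_bij_witness[where i = "\<lambda>k. - 1 - int k" and j = "\<lambda>i. nat (- 1 - i)"]) auto
  show ?thesis unfolding has_density_def config_density_def averages_to_def 1 2 ..
qed

lemma config_density_translate: "config_density v (translate k \<eta>) r \<longleftrightarrow> config_density v \<eta> r"
proof -
  have 1: "config_density v (translate 1 \<eta>) r \<longleftrightarrow> config_density v \<eta> r" for \<eta>
    using averages_to_Suc_iff[of "\<lambda>k. v (\<eta> (int k))" r] averages_to_Suc_iff[of "\<lambda>k. v (\<eta> (- 1 - int k))" r]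
    by (simp add: config_density_def algebra_simps)
  show ?thesis
  proof (induction k rule: int_induct[where k = 0])
    case (step1 i)
    have "translate (i + 1) \<eta> = translate 1 (translate i \<eta>)" by (simp only: translate_translate add.commute)
    then show ?case using step1 by (simp only: 1)
  next
    case (step2 i)
    have "translate i \<eta> = translate 1 (translate (i - 1) \<eta>)" by simp
    then show ?case using step2 by (simp only: 1)
  qed simp
qed

lemma sets_config_density:
  "{\<eta>. config_density v \<eta> r} \<in> sets config_space"
proof -
  have avg: "{\<eta> \<in> space config_space. averages_to (\<lambda>k. v (\<eta> (g k))) r} \<in> sets config_space" for g :: "nat \<Rightarrow> int"
  proof -
    have [measurable]: "(\<lambda>\<eta>. v (\<eta> i)) \<in> borel_measurable config_space" for i :: int
      by (rule measurable_compose[OF measurable_config_component]) simp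
    have "averages_to a r \<longleftrightarrow> (\<forall>k::nat. \<exists>M. \<forall>N\<ge>M. \<bar>(\<Sum>k<N. a k) / real N - r\<bar> < 1 / real (Suc k))" for a
      unfolding averages_to_def lim_sequentially dist_real_def
    proof safe
      fix e :: real assume *: "\<forall>k::nat. \<exists>M. \<forall>N\<ge>M. \<bar>(\<Sum>k<N. a k) / real N - r\<bar> < 1 / real (Suc k)" and "0 < e"
      then obtain k where "1 / real (Suc k) < e" using nat_approx_posE by blast
      with * show "\<exists>M. \<forall>N\<ge>M. \<bar>(\<Sum>k<N. a k) / real N - r\<bar> < e" by (meson less_trans)
    qed auto
    then have "{\<eta> \<in> space config_space. averages_to (\<lambda>k. v (\<eta> (g k))) r} =
        {\<eta> \<in> space config_space. \<forall>k::nat. \<exists>M. \<forall>N\<ge>M. \<bar>(\<Sum>k<N. v (\<eta> (g k))) / real N - r\<bar> < 1 / real (Suc k)}"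
      by (simp only:)
    also have "\<dots> \<in> sets config_space" by measurable
    finally show ?thesis .
  qed
  have "{\<eta> \<in> space config_space. config_density v \<eta> r} =
      {\<eta> \<in> space config_space. averages_to (\<lambda>k. v (\<eta> (1 + int k))) r} \<inter>
      {\<eta> \<in> space config_space. averages_to (\<lambda>k. v (\<eta> (- 1 - int k))) r}"
    by (auto simp: config_density_def)
  with avg[of "\<lambda>k. 1 + int k"] avg[of "\<lambda>k. - 1 - int k"] show ?thesis by simp
qed

text \<open>The sequence \<open>f\<close> is the concatenation of the words consisting of a zero and \<open>h k\<close> ones.\<close>

context
  fixes f :: "nat \<Rightarrow> bool" and h p :: "nat \<Rightarrow> nat"
  assumes p0: "p 0 = 0" and pSuc: "\<And>k. p (Suc k) = p k + h k + 1"
    and f: "\<And>j. f j \<longleftrightarrow> j \<notin> range p"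
begin

lemma strict_mono_word_position: "strict_mono p"
  by (simp add: strict_mono_Suc_iff pSuc)

lemma word_position_eq: "real (p k) = (\<Sum>i<k. real (h i)) + real k"
  by (induction k) (simp_all add: p0 pSuc)

text \<open>The number of zeros among the first \<open>x\<close> symbols, in the form that makes it
  adjoint to \<open>p\<close>: \<open>zero_count x \<le> k\<close> is equivalent to
  \<open>x \<le> p k\<close>.\<close>

definition zero_count :: "nat \<Rightarrow> nat" where
  "zero_count x = (LEAST k. x \<le> p k)"

lemma zero_count_le_iff: "zero_count x \<le> k \<longleftrightarrow> x \<le> p k"
proof
  assume le: "zero_count x \<le> k"
  have "x \<le> p (zero_count x)" unfolding zero_count_def
    by (rule LeastI[of _ x]) (rule strict_mono_imp_increasing[OF strict_mono_word_position])
  also have "\<dots> \<le> p k" using strict_mono_word_position le by (simp add: strict_mono_less_eq)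
  finally show "x \<le> p k" .
qed (simp add: zero_count_def Least_le)

lemma zero_count_p: "zero_count (p k) = k"
proof (rule antisym)
  show "k \<le> zero_count (p k)"
    using zero_count_le_iff[of "p k" "zero_count (p k)"] strict_mono_word_position by (simp add: strict_mono_less_eq)
qed (simp add: zero_count_le_iff)

lemma sum_ones: "(\<Sum>j<x. of_bool (f j)) = real x - real (zero_count x)"
proof -
  have "{j. j < x \<and> \<not> f j} = p ` {..<zero_count x}"
    using zero_count_le_iff by (auto simp: f image_iff not_le[symmetric])
  then have "card {j. j < x \<and> \<not> f j} = zero_count x"
    using strict_mono_imp_inj_on[OF strict_mono_word_position] by (simp add: card_image inj_on_subset)
  moreover have "(\<Sum>j<x. of_bool (\<not> f j) :: real) = real (card {j. j < x \<and> \<not> f j})"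
    by (simp add: sum.If_cases of_bool_def Int_def)
  moreover have "(\<Sum>j<x. of_bool (f j) :: real) = (\<Sum>j<x. 1 - of_bool (\<not> f j))"
    by (rule sum.cong) auto
  ultimately show ?thesis by (simp add: sum_subtractf)
qed

text \<open>Along the positions \<open>p k\<close> of the zeros the fraction of zeros is exactly
  \<open>k / p k\<close>, the reciprocal of one plus the mean of the first \<open>k\<close>
  heights.\<close>

lemma averages_heights_of_ones:
  assumes "averages_to (\<lambda>j. of_bool (f j)) r" "r < 1"
  shows "averages_to (\<lambda>k. real (h k)) (r / (1 - r))"
proof -
  have "(\<lambda>k. (\<Sum>j<p k. of_bool (f j)) / real (p k)) \<longlonglongrightarrow> r"
    using LIMSEQ_subseq_LIMSEQ[OF assms(1)[unfolded averages_to_def] strict_mono_word_position] by (simp add: comp_def)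
  then have *: "(\<lambda>k. inverse (1 - (\<Sum>j<p k. of_bool (f j)) / real (p k)) - 1) \<longlonglongrightarrow> inverse (1 - r) - 1"
    using assms(2) by (intro tendsto_intros) auto
  have "\<forall>\<^sub>F k in sequentially. inverse (1 - (\<Sum>j<p k. of_bool (f j)) / real (p k)) - 1 = (\<Sum>i<k. real (h i)) / real k"
    using eventually_gt_at_top[of 0]
  proof eventually_elim
    case (elim k)
    then have "0 < p k" using strict_monoD[OF strict_mono_word_position elim] by (simp add: p0)
    then have "1 - (\<Sum>j<p k. of_bool (f j)) / real (p k) = real k / real (p k)"
      by (simp add: sum_ones zero_count_p field_simps)
    then have "inverse (1 - (\<Sum>j<p k. of_bool (f j)) / real (p k)) - 1 = real (p k) / real k - 1"
      by simp
    also have "\<dots> = (\<Sum>i<k. real (h i)) / real k" using elim by (simp add: word_position_eq field_simps)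
    finally show ?case .
  qed
  moreover have "inverse (1 - r) - 1 = r / (1 - r)" using assms(2) by (simp add: field_simps)
  ultimately show ?thesis using * unfolding averages_to_def by (subst (asm) tendsto_cong) auto
qed

text \<open>Eventually \<open>p (zero_count x - 1) < x\<close> and
  \<open>x \<le> p (zero_count x)\<close>, so the fraction of zeros among the first \<open>x\<close>
  symbols is squeezed between two ratios with the same limit.\<close>

lemma averages_ones_of_heights:
  assumes "averages_to (\<lambda>k. real (h k)) r"
  shows "averages_to (\<lambda>j. of_bool (f j)) (r / (1 + r))"
proof -
  have r: "0 \<le> r"
    using assms unfolding averages_to_def by (rule LIMSEQ_le_const) (auto intro!: divide_nonneg_nonneg sum_nonneg)
  have q: "(\<lambda>k. real k / real (p k)) \<longlonglongrightarrow> inverse (1 + r)"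
  proof -
    have "(\<lambda>k. inverse (1 + (\<Sum>i<k. real (h i)) / real k)) \<longlonglongrightarrow> inverse (1 + r)"
      using assms r unfolding averages_to_def by (intro tendsto_intros) auto
    moreover have "\<forall>\<^sub>F k in sequentially. inverse (1 + (\<Sum>i<k. real (h i)) / real k) = real k / real (p k)"
      using eventually_gt_at_top[of 0]
    proof eventually_elim
      case (elim k)
      then have "1 + (\<Sum>i<k. real (h i)) / real k = real (p k) / real k" by (simp add: word_position_eq field_simps)
      then show ?case by simp
    qed
    ultimately show ?thesis by (subst (asm) tendsto_cong) auto
  qed
  have q': "(\<lambda>k. real k / real (p (k - 1))) \<longlonglongrightarrow> inverse (1 + r)"
  proof (rule LIMSEQ_imp_Suc)
    have "(\<lambda>k. real (Suc k) / real k * (real k / real (p k))) \<longlonglongrightarrow> 1 * inverse (1 + r)"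
      by (intro tendsto_mult q LIMSEQ_Suc_n_over_n)
    moreover have "\<forall>\<^sub>F k in sequentially. real (Suc k) / real k * (real k / real (p k)) = real (Suc k) / real (p (Suc k - 1))"
      using eventually_gt_at_top[of 0] by eventually_elim simp
    ultimately show "(\<lambda>k. real (Suc k) / real (p (Suc k - 1))) \<longlonglongrightarrow> inverse (1 + r)"
      by (subst (asm) tendsto_cong) auto
  qed
  have C: "filterlim zero_count at_top sequentially"
    unfolding filterlim_at_top
  proof
    fix K
    show "\<forall>\<^sub>F x in sequentially. K \<le> zero_count x"
      using eventually_gt_at_top[of "p K"]
    proof eventually_elim
      case (elim x)
      then have "\<not> zero_count x \<le> K" by (simp add: zero_count_le_iff)
      then show ?case by simp
    qed
  qed
  have "(\<lambda>x. real (zero_count x) / real x) \<longlonglongrightarrow> inverse (1 + r)"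
  proof (rule tendsto_sandwich)
    show "(\<lambda>x. real (zero_count x) / real (p (zero_count x))) \<longlonglongrightarrow> inverse (1 + r)"
      by (rule filterlim_compose[OF q C])
    show "(\<lambda>x. real (zero_count x) / real (p (zero_count x - 1))) \<longlonglongrightarrow> inverse (1 + r)"
      by (rule filterlim_compose[OF q' C])
    have big: "\<forall>\<^sub>F x in sequentially. 2 \<le> zero_count x" using C by (simp add: filterlim_at_top)
    show "\<forall>\<^sub>F x in sequentially. real (zero_count x) / real (p (zero_count x)) \<le> real (zero_count x) / real x"
      using eventually_gt_at_top[of 0]
    proof eventually_elim
      case (elim x)
      have "x \<le> p (zero_count x)" using zero_count_le_iff by blast
      then show ?case using elim by (intro divide_left_mono) auto
    qed
    show "\<forall>\<^sub>F x in sequentially. real (zero_count x) / real x \<le> real (zero_count x) / real (p (zero_count x - 1))"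
      using big
    proof eventually_elim
      case (elim x)
      then have "\<not> zero_count x \<le> zero_count x - 1" by simp
      then have "p (zero_count x - 1) < x" by (simp only: zero_count_le_iff not_le)
      moreover have "0 < p (zero_count x - 1)" using strict_monoD[OF strict_mono_word_position, of 0 "zero_count x - 1"] elim by (simp add: p0)
      ultimately show ?case by (intro divide_left_mono) auto
    qed
  qed
  then have *: "(\<lambda>x. 1 - real (zero_count x) / real x) \<longlonglongrightarrow> 1 - inverse (1 + r)"
    by (intro tendsto_intros)
  have "\<forall>\<^sub>F x in sequentially. 1 - real (zero_count x) / real x = (\<Sum>j<x. of_bool (f j)) / real x"
    using eventually_gt_at_top[of 0] by eventually_elim (simp add: sum_ones diff_divide_distrib)
  moreover have "1 - inverse (1 + r) = r / (1 + r)" using r by (simp add: field_simps)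
  ultimately show ?thesis using * unfolding averages_to_def by (subst (asm) tendsto_cong) auto
qed

end

text \<open>Both half lines are read outward from the zero at site 1. To the left each zero is
  followed by the ones of the word that ends just before it, so the stacks 0, -1, and so on appear
  in this order, and both directions fit the preceding context.\<close>

lemma subst_map_half_lines:
  fixes n :: "int \<Rightarrow> nat"
  defines "p \<equiv> \<lambda>k. nat (word_start n (1 + int k) - 1)" and "q \<equiv> \<lambda>k. nat (1 - word_start n (1 - int k))"
  shows "p 0 = 0" "p (Suc k) = p k + n (1 + int k) + 1" "subst_map n (1 + int j) \<longleftrightarrow> j \<notin> range p"
    and "q 0 = 0" "q (Suc k) = q k + n (- int k) + 1" "subst_map n (1 - int j) \<longleftrightarrow> j \<notin> range q"
proof -
  have pos: "1 \<le> word_start n (1 + int k)" "word_start n (1 - int k) \<le> 1" for k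
    using word_start_le_iff[of n 1 "1 + int k"] word_start_le_iff[of n "1 - int k" 1] by simp_all
  show "p 0 = 0" "q 0 = 0" by (simp_all add: p_def q_def)
  have "word_start n (1 + int (Suc k)) = word_start n (1 + int k) + int (n (1 + int k)) + 1" for k
    using word_start_add1[of n "1 + int k"] by (simp add: algebra_simps)
  then show "p (Suc k) = p k + n (1 + int k) + 1" for k
    using pos(1)[of k] by (simp add: p_def nat_eq_iff)
  have "word_start n (1 - int k) = word_start n (1 - int (Suc k)) + int (n (- int k)) + 1" for k
    using word_start_add1[of n "- int k"] by (simp add: algebra_simps)
  note step = this
  have q: "int (q k) = 1 - word_start n (1 - int k)" for k
    using pos(2)[of k] by (simp add: q_def)
  show "q (Suc k) = q k + n (- int k) + 1" for k
  proof -
    have "int (q (Suc k)) = int (q k + n (- int k) + 1)"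
      using step[of k] unfolding of_nat_add q by linarith
    then show ?thesis by (simp only: of_nat_eq_iff)
  qed
  show "subst_map n (1 + int j) \<longleftrightarrow> j \<notin> range p"
  proof -
    have "1 + int j \<in> range (word_start n) \<longleftrightarrow> j \<in> range p"
    proof
      assume "1 + int j \<in> range (word_start n)"
      then obtain i where i: "1 + int j = word_start n i" by auto
      then have "1 \<le> i" using word_start_le_iff[of n 1 i] by simp
      then have "j = p (nat (i - 1))" using i by (simp add: p_def nat_eq_iff)
      then show "j \<in> range p" by blast
    next
      assume "j \<in> range p"
      then obtain k where "j = p k" by auto
      then have "1 + int j = word_start n (1 + int k)" using pos(1)[of k] by (simp add: p_def)
      then show "1 + int j \<in> range (word_start n)" by simp
    qed
    then show ?thesis by (simp add: subst_map_def)
  qed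
  show "subst_map n (1 - int j) \<longleftrightarrow> j \<notin> range q"
  proof -
    have "1 - int j \<in> range (word_start n) \<longleftrightarrow> j \<in> range q"
    proof
      assume "1 - int j \<in> range (word_start n)"
      then obtain i where i: "1 - int j = word_start n i" by auto
      then have "i \<le> 1" using word_start_le_iff[of n i 1] by simp
      then have "j = q (nat (1 - i))" using i by (simp add: q_def nat_eq_iff)
      then show "j \<in> range q" by blast
    next
      assume "j \<in> range q"
      then obtain k where "j = q k" by auto
      then have "1 - int j = word_start n (1 - int k)" using pos(2)[of k] by (simp add: q_def)
      then show "1 - int j \<in> range (word_start n)" by simp
    qed
    then show ?thesis by (simp add: subst_map_def)
  qed
qed

lemma averages_to_left_shift:
  "averages_to (\<lambda>k. v (\<eta> (- 1 - int k))) r \<longleftrightarrow> averages_to (\<lambda>k. v (\<eta> (1 - int k))) r"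
  "averages_to (\<lambda>k. v (\<eta> (- 1 - int k))) r \<longleftrightarrow> averages_to (\<lambda>k. v (\<eta> (- int k))) r"
  using averages_to_Suc_iff[of "\<lambda>k. v (\<eta> (- int k))" r] averages_to_Suc_iff[of "\<lambda>k. v (\<eta> (1 - int k))" r]
  by (simp_all add: algebra_simps)

lemma config_density_subst_map:
  assumes "config_density real n r"
  shows "config_density of_bool (subst_map n) (r / (1 + r))"
proof -
  have "averages_to (\<lambda>j. of_bool (subst_map n (1 + int j))) (r / (1 + r))"
    by (rule averages_ones_of_heights[where f = "\<lambda>j. subst_map n (1 + int j)", OF subst_map_half_lines(1-3)])
       (use assms in \<open>simp add: config_density_def\<close>)
  moreover have "averages_to (\<lambda>j. of_bool (subst_map n (1 - int j))) (r / (1 + r))"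
    by (rule averages_ones_of_heights[where f = "\<lambda>j. subst_map n (1 - int j)", OF subst_map_half_lines(4-6)])
       (use assms averages_to_left_shift(2)[of real n r] in \<open>simp add: config_density_def\<close>)
  ultimately show ?thesis
    using averages_to_left_shift(1)[of of_bool "subst_map n"] by (simp add: config_density_def)
qed

lemma config_density_of_subst_map:
  assumes "config_density of_bool (subst_map n) r" "r < 1"
  shows "config_density real n (r / (1 - r))"
proof -
  have "averages_to (\<lambda>k. real (n (1 + int k))) (r / (1 - r))"
    by (rule averages_heights_of_ones[where f = "\<lambda>j. subst_map n (1 + int j)", OF subst_map_half_lines(1-3)])
       (use assms in \<open>simp_all add: config_density_def\<close>)
  moreover have "averages_to (\<lambda>k. real (n (- int k))) (r / (1 - r))"
    by (rule averages_heights_of_ones[where f = "\<lambda>j. subst_map n (1 - int j)", OF subst_map_half_lines(4-6)])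
       (use assms averages_to_left_shift(1)[of of_bool "subst_map n" r] in \<open>simp_all add: config_density_def\<close>)
  ultimately show ?thesis
    using averages_to_left_shift(2)[of real n] by (simp add: config_density_def)
qed

lemma AE_Phi:
  assumes \<nu>: "state \<nu>" and P: "{\<eta>. P \<eta>} \<in> sets config_space"
    and ae: "AE n in \<nu>. \<forall>j. P (translate (- int j) (subst_map n))"
  shows "AE \<eta> in Phi \<nu>. P \<eta>"
proof -
  have nP: "{\<eta>. \<not> P \<eta>} \<in> sets config_space"
    using sets.compl_sets[OF P] by (simp add: Compl_eq_Diff_UNIV[symmetric] Collect_neg_eq)
  have "(\<integral>\<^sup>+ n. word_sum (indicator {\<eta>. \<not> P \<eta>}) n \<partial>\<nu>) = (\<integral>\<^sup>+ n. 0 \<partial>\<nu>)"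
  proof (rule nn_integral_cong_AE)
    show "AE n in \<nu>. word_sum (indicator {\<eta>. \<not> P \<eta>}) n = 0"
      using ae by eventually_elim (simp add: word_sum_def)
  qed
  then have "emeasure (Phi \<nu>) {\<eta>. \<not> P \<eta>} = 0"
    using emeasure_Phi_word_sum[OF \<nu> nP] by simp
  then show ?thesis
    using nP by (intro AE_I[of _ _ "{\<eta>. \<not> P \<eta>}"]) auto
qed

lemma AE_palm:
  assumes \<mu>: "state \<mu>" and P: "{n. P n} \<in> sets config_space"
    and ae: "AE \<eta> in \<mu>. \<not> \<eta> 1 \<longrightarrow> P (stack_map \<eta>)"
  shows "AE n in palm \<mu>. P n"
proof -
  have nP: "{n. \<not> P n} \<in> sets config_space"
    using sets.compl_sets[OF P] by (simp add: Compl_eq_Diff_UNIV[symmetric] Collect_neg_eq)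
  have "stack_map -` {n. \<not> P n} \<in> sets config_space"
    using measurable_sets[OF measurable_stack_map nP] by simp
  from sets.Int[OF sets_zero_at this, of 1] have S: "{\<eta>. \<not> \<eta> 1 \<and> \<not> P (stack_map \<eta>)} \<in> sets \<mu>"
    by (simp add: sets_state[OF \<mu>] vimage_def Int_def)
  have "emeasure \<mu> {\<eta>. \<not> \<eta> 1 \<and> \<not> P (stack_map \<eta>)} = 0"
    using ae AE_iff_measurable[OF S, of "\<lambda>\<eta>. \<not> \<eta> 1 \<longrightarrow> P (stack_map \<eta>)"] by (simp add: space_state[OF \<mu>])
  then have "emeasure (palm \<mu>) {n. \<not> P n} = 0"
    by (simp add: emeasure_palm[OF \<mu> nP])
  then show ?thesis
    using nP by (intro AE_I[of _ _ "{n. \<not> P n}"]) (auto simp: palm_def)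
qed

lemma has_density_Phi:
  assumes "state \<nu>" "has_density real \<nu> r"
  shows "has_density of_bool (Phi \<nu>) (r / (1 + r))"
  unfolding has_density_iff
  by (rule AE_Phi[OF assms(1) sets_config_density])
     (use assms(2) in \<open>auto simp: has_density_iff config_density_translate intro: config_density_subst_map\<close>)

lemma has_density_palm:
  assumes \<mu>: "state \<mu>" and zeros: "AE \<eta> in \<mu>. zeros_unbounded \<eta>"
    and dens: "has_density of_bool \<mu> r" "r < 1"
  shows "has_density real (palm \<mu>) (r / (1 - r))"
  unfolding has_density_iff
proof (rule AE_palm[OF \<mu> sets_config_density])
  show "AE \<eta> in \<mu>. \<not> \<eta> 1 \<longrightarrow> config_density real (stack_map \<eta>) (r / (1 - r))"
    using zeros dens(1)[unfolded has_density_iff]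
  proof eventually_elim
    case (elim \<eta>)
    then show ?case
      using dens(2) by (auto intro!: config_density_of_subst_map simp: subst_map_stack_map)
  qed
qed

section \<open>Densities and means\<close>

lemma integral_translate:
  fixes f :: "(int \<Rightarrow> 'a) \<Rightarrow> real"
  assumes "state \<mu>" "translation_invariant \<mu>" "f \<in> borel_measurable config_space"
  shows "(\<integral>x. f (translate k x) \<partial>\<mu>) = (\<integral>x. f x \<partial>\<mu>)"
proof -
  have "(\<integral>x. f x \<partial>\<mu>) = (\<integral>x. f x \<partial>distr \<mu> config_space (translate k))"
    by (simp only: translation_invariant_translate[OF assms(1,2)])
  also have "\<dots> = (\<integral>x. f (translate k x) \<partial>\<mu>)"
    by (rule integral_distr) (use assms in \<open>auto simp: measurable_state\<close>)
  finally show ?thesis by simp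
qed

lemma integral_average:
  fixes v :: "'a \<Rightarrow> real"
  assumes \<mu>: "state \<mu>" "translation_invariant \<mu>" and v: "\<And>x. \<bar>v x\<bar> \<le> B" and N: "0 < N"
  shows "(\<integral>\<eta>. (\<Sum>k<N. v (\<eta> (1 + int k))) / real N \<partial>\<mu>) = (\<integral>\<eta>. v (\<eta> 1) \<partial>\<mu>)"
proof -
  interpret prob_space \<mu> by (rule state_prob_space[OF \<mu>(1)])
  have meas: "(\<lambda>\<eta>. v (\<eta> i)) \<in> borel_measurable config_space" for i :: int
    by (rule measurable_compose[OF measurable_config_component]) simp
  have int: "integrable \<mu> (\<lambda>\<eta>. v (\<eta> i))" for i
    by (rule integrable_const_bound[where B = B]) (use v meas in \<open>auto simp: measurable_state[OF \<mu>(1)]\<close>)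
  have "(\<integral>\<eta>. v (\<eta> (1 + int k)) \<partial>\<mu>) = (\<integral>\<eta>. v (\<eta> 1) \<partial>\<mu>)" for k
    using integral_translate[OF \<mu> meas[of 1], of "- int k"] by simp
  then show ?thesis using int N by (simp add: integral_sum)
qed

lemma integral_eq_density:
  fixes v :: "'a \<Rightarrow> real"
  assumes \<mu>: "state \<mu>" "translation_invariant \<mu>" and v: "\<And>x. \<bar>v x\<bar> \<le> B" and dens: "has_density v \<mu> r"
  shows "(\<integral>\<eta>. v (\<eta> 1) \<partial>\<mu>) = r"
proof -
  interpret prob_space \<mu> by (rule state_prob_space[OF \<mu>(1)])
  have [measurable]: "(\<lambda>\<eta>. v (\<eta> i)) \<in> borel_measurable \<mu>" for i :: int
    using measurable_compose[OF measurable_config_component, of v borel i] by (simp add: measurable_state[OF \<mu>(1)])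
  have B: "0 \<le> B" using v abs_ge_zero order_trans by blast
  have "(\<lambda>N. \<integral>\<eta>. (\<Sum>k<N. v (\<eta> (1 + int k))) / real N \<partial>\<mu>) \<longlonglongrightarrow> (\<integral>\<eta>. r \<partial>\<mu>)"
  proof (rule integral_dominated_convergence[where w = "\<lambda>_. B"])
    show "AE \<eta> in \<mu>. (\<lambda>N. (\<Sum>k<N. v (\<eta> (1 + int k))) / real N) \<longlonglongrightarrow> r"
      using dens by (simp add: has_density_iff config_density_def averages_to_def)
    show "AE \<eta> in \<mu>. norm ((\<Sum>k<N. v (\<eta> (1 + int k))) / real N) \<le> B" for N
    proof (rule AE_I2)
      fix \<eta> :: "int \<Rightarrow> 'a"
      have "\<bar>\<Sum>k<N. v (\<eta> (1 + int k))\<bar> \<le> (\<Sum>k<N. B)"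
        by (intro order_trans[OF sum_abs] sum_mono v)
      then show "norm ((\<Sum>k<N. v (\<eta> (1 + int k))) / real N) \<le> B"
        using B by (cases "N = 0") (auto simp: field_simps)
    qed
  qed auto
  moreover have "\<forall>\<^sub>F N in sequentially. (\<integral>\<eta>. (\<Sum>k<N. v (\<eta> (1 + int k))) / real N \<partial>\<mu>) = (\<integral>\<eta>. v (\<eta> 1) \<partial>\<mu>)"
    using eventually_gt_at_top[of 0] by eventually_elim (rule integral_average[OF \<mu> v])
  ultimately have "(\<lambda>N::nat. \<integral>\<eta>. v (\<eta> 1) \<partial>\<mu>) \<longlonglongrightarrow> (\<integral>\<eta>. r \<partial>\<mu>)"
    by (subst (asm) tendsto_cong) auto
  then show ?thesis by (simp add: LIMSEQ_const_iff prob_space)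
qed

text \<open>An almost sure density does not at once bound a mean. Heights truncated at
  \<open>M\<close> have averages with upper limit at most \<open>r\<close>, so the truncated mean is
  at most \<open>r\<close> by dominated convergence; monotone convergence then removes the
  truncation.\<close>

lemma Phi_Z_finite:
  assumes \<nu>: "state \<nu>" "translation_invariant \<nu>" and dens: "has_density real \<nu> r"
  shows "Phi_Z \<nu> < \<infinity>"
proof -
  interpret prob_space \<nu> by (rule state_prob_space[OF \<nu>(1)])
  have meas [measurable]: "(\<lambda>n. min (real (n i)) M) \<in> borel_measurable \<nu>" for i :: int and M :: real
    using measurable_compose[OF measurable_config_component, of "\<lambda>x. min (real x) M" borel i]
    by (simp add: measurable_state[OF \<nu>(1)])
  have int: "integrable \<nu> (\<lambda>n. min (real (n 1)) (real M))" for M :: nat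
    by (rule integrable_const_bound[where B = "real M"]) auto
  have le: "(\<integral>n. min (real (n 1)) (real M) \<partial>\<nu>) \<le> r" for M :: nat
  proof -
    let ?avg = "\<lambda>N n. (\<Sum>k<N. min (real (n (1 + int k))) (real M)) / real N"
    have bound: "0 \<le> ?avg N n" "?avg N n \<le> real M" for N n
    proof -
      show "0 \<le> ?avg N n" by (intro divide_nonneg_nonneg sum_nonneg) auto
      have "(\<Sum>k<N. min (real (n (1 + int k))) (real M)) \<le> (\<Sum>k<N. real M)" by (intro sum_mono) auto
      then show "?avg N n \<le> real M" by (cases "N = 0") (auto simp: field_simps)
    qed
    \<comment> \<open>The truncated averages are only known to be bounded by \<open>r\<close> in the
      limit, hence the positive part of their excess.\<close>
    have "(\<lambda>N. \<integral>n. max (?avg N n - r) 0 \<partial>\<nu>) \<longlonglongrightarrow> (\<integral>n. 0 \<partial>\<nu>)"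
    proof (rule integral_dominated_convergence[where w = "\<lambda>_. real M + \<bar>r\<bar>"])
      show "AE n in \<nu>. (\<lambda>N. max (?avg N n - r) 0) \<longlonglongrightarrow> 0"
        using dens[unfolded has_density_iff]
      proof eventually_elim
        case (elim n)
        then have "(\<lambda>N. max ((\<Sum>k<N. real (n (1 + int k))) / real N - r) 0) \<longlonglongrightarrow> max (r - r) 0"
          unfolding config_density_def averages_to_def by (intro tendsto_max tendsto_diff tendsto_const) auto
        then have lim: "(\<lambda>N. max ((\<Sum>k<N. real (n (1 + int k))) / real N - r) 0) \<longlonglongrightarrow> 0" by simp
        have ub: "max (?avg N n - r) 0 \<le> max ((\<Sum>k<N. real (n (1 + int k))) / real N - r) 0" for N
          by (intro max.mono diff_right_mono divide_right_mono sum_mono) auto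
        show ?case
        proof (rule tendsto_sandwich[OF _ _ tendsto_const lim])
          show "\<forall>\<^sub>F N in sequentially. max (?avg N n - r) 0 \<le> max ((\<Sum>k<N. real (n (1 + int k))) / real N - r) 0"
            by (intro always_eventually allI ub)
        qed simp
      qed
      show "AE n in \<nu>. norm (max (?avg N n - r) 0) \<le> real M + \<bar>r\<bar>" for N
      proof (rule AE_I2)
        fix n
        show "norm (max (?avg N n - r) 0) \<le> real M + \<bar>r\<bar>"
          using bound(2)[of n N] unfolding real_norm_def by linarith
      qed
    qed auto
    moreover have "\<forall>\<^sub>F N in sequentially. (\<integral>n. min (real (n 1)) (real M) \<partial>\<nu>) - r \<le> (\<integral>n. max (?avg N n - r) 0 \<partial>\<nu>)"
      using eventually_gt_at_top[of 0]
    proof eventually_elim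
      case (elim N)
      have int': "integrable \<nu> (?avg N)"
      proof (rule integrable_const_bound[where B = "real M"])
        show "AE n in \<nu>. norm (?avg N n) \<le> real M"
          using bound by (intro AE_I2) (simp only: real_norm_def abs_of_nonneg)
      qed auto
      have "(\<integral>n. min (real (n 1)) (real M) \<partial>\<nu>) - r = (\<integral>n. ?avg N n \<partial>\<nu>) - r"
        by (subst integral_average[OF \<nu>, where B = "real M"]) (use elim in auto)
      also have "\<dots> = (\<integral>n. ?avg N n - r \<partial>\<nu>)" using int' by (simp add: prob_space)
      also have "\<dots> \<le> (\<integral>n. max (?avg N n - r) 0 \<partial>\<nu>)"
        using int' by (intro integral_mono integrable_max) auto
      finally show ?case .
    qed
    ultimately have "(\<integral>n. min (real (n 1)) (real M) \<partial>\<nu>) - r \<le> 0"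
      by (intro tendsto_lowerbound[of _ _ sequentially]) auto
    then show ?thesis by simp
  qed
  have "Phi_Z \<nu> = (\<integral>\<^sup>+ n. (SUP M::nat. ennreal (min (real (n 1)) (real M) + 1)) \<partial>\<nu>)"
    unfolding Phi_Z_eq[OF \<nu>(1)]
  proof (rule nn_integral_cong)
    fix n :: "int \<Rightarrow> nat"
    show "of_nat (n 1 + 1) = (SUP M::nat. ennreal (min (real (n 1)) (real M) + 1))"
    proof (rule antisym)
      have "of_nat (n 1 + 1) = ennreal (min (real (n 1)) (real (n 1)) + 1)"
        by (metis ennreal_of_nat_eq_real_of_nat min.idem of_nat_1 of_nat_add)
      also have "\<dots> \<le> (SUP M::nat. ennreal (min (real (n 1)) (real M) + 1))"
        by (rule SUP_upper) simp
      finally show "of_nat (n 1 + 1) \<le> (SUP M::nat. ennreal (min (real (n 1)) (real M) + 1))" .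
      show "(SUP M::nat. ennreal (min (real (n 1)) (real M) + 1)) \<le> of_nat (n 1 + 1)"
        by (rule SUP_least) (simp add: ennreal_of_nat_eq_real_of_nat ennreal_leI)
    qed
  qed
  also have "\<dots> = (SUP M::nat. \<integral>\<^sup>+ n. ennreal (min (real (n 1)) (real M) + 1) \<partial>\<nu>)"
    by (rule nn_integral_monotone_convergence_SUP)
       (auto simp: incseq_def le_fun_def intro!: ennreal_leI add_right_mono min.mono)
  also have "\<dots> \<le> ennreal (r + 1)"
  proof (rule SUP_least)
    fix M :: nat
    have "(\<integral>\<^sup>+ n. ennreal (min (real (n 1)) (real M) + 1) \<partial>\<nu>) = ennreal (\<integral>n. min (real (n 1)) (real M) + 1 \<partial>\<nu>)"
      by (rule nn_integral_eq_integral) (use int in auto)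
    also have "\<dots> \<le> ennreal (r + 1)"
      using int le[of M] by (intro ennreal_leI) (simp add: prob_space)
    finally show "(\<integral>\<^sup>+ n. ennreal (min (real (n 1)) (real M) + 1) \<partial>\<nu>) \<le> ennreal (r + 1)" .
  qed
  also have "\<dots> < \<infinity>" by simp
  finally show ?thesis .
qed

section \<open>Stack configurations of density greater than 1\<close>

lemma TIS_state: "TIS K \<nu> \<Longrightarrow> state \<nu>"
  and TIS_translation_invariant: "TIS K \<nu> \<Longrightarrow> translation_invariant \<nu>"
  by (auto simp: TIS_def)

lemma measurable_joint_step [measurable]:
  "(\<lambda>x. ssm_step (snd x) (fst x) i) \<in> measurable (config_space \<Otimes>\<^sub>M coins) (count_space UNIV)"
  using measurable_compose[OF measurable_ssm_step measurable_config_component] by (simp add: case_prod_beta')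

lemma AE_stationary_step:
  assumes \<nu>: "TIS ssm \<nu>" and P: "AE n in \<nu>. P n"
  shows "AE x in \<nu> \<Otimes>\<^sub>M coins. P (ssm_step (snd x) (fst x))"
proof -
  have S: "state \<nu>" using \<nu> by (simp add: TIS_def)
  have eq: "distr (\<nu> \<Otimes>\<^sub>M coins) config_space (\<lambda>(n, \<omega>). ssm_step \<omega> n) = \<nu>"
    using \<nu> bind_ssm[OF S] by (simp add: TIS_def stationary_def)
  have "AE n in distr (\<nu> \<Otimes>\<^sub>M coins) config_space (\<lambda>(n, \<omega>). ssm_step \<omega> n). P n"
    by (simp only: eq P)
  from AE_distrD[OF _ this] show ?thesis
    by (simp add: measurable_joint[OF S] case_prod_beta')
qed

lemma prob_stationary_step:
  assumes \<nu>: "TIS ssm \<nu>" and P: "{n. P n} \<in> sets config_space"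
  shows "measure (\<nu> \<Otimes>\<^sub>M coins) {x. P (ssm_step (snd x) (fst x))} = measure (\<nu> \<Otimes>\<^sub>M coins) {x. P (fst x)}"
proof -
  have S: "state \<nu>" using \<nu> by (simp add: TIS_def)
  interpret C: prob_space coins by (rule prob_space_coins)
  have "measure \<nu> {n. P n} = measure (distr (\<nu> \<Otimes>\<^sub>M coins) config_space (\<lambda>(n, \<omega>). ssm_step \<omega> n)) {n. P n}"
    using \<nu> bind_ssm[OF S] by (simp add: TIS_def stationary_def)
  also have "\<dots> = measure (\<nu> \<Otimes>\<^sub>M coins) {x. P (ssm_step (snd x) (fst x))}"
    using P by (subst measure_distr) (auto simp: measurable_joint[OF S] space_joint[OF S] vimage_def case_prod_beta')
  also have "{x. P (fst x)} = {n. P n} \<times> space coins"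
    using space_state[OF state_coins] by auto
  moreover have "measure (\<nu> \<Otimes>\<^sub>M coins) ({n. P n} \<times> space coins) = measure \<nu> {n. P n}"
    using P C.emeasure_pair_measure_Times[of "{n. P n}" \<nu> "space coins"]
    by (simp add: measure_def sets_state[OF S] C.emeasure_space_1)
  ultimately show ?thesis by simp
qed

text \<open>Agreement with \<open>u\<close> on the finite set \<open>F\<close> has positive
  probability, and by \<open>local\<close> such an agreement is all that matters; so what holds for
  almost all coins holds for \<open>u\<close>.\<close>

lemma AE_joint_specific_coins:
  assumes \<nu>: "state \<nu>" and P: "AE x in \<nu> \<Otimes>\<^sub>M coins. P (fst x) (snd x)"
    and F: "finite F" and local: "\<And>n \<omega>. (\<And>k. k \<in> F \<Longrightarrow> \<omega> k = u k) \<Longrightarrow> P n \<omega> \<Longrightarrow> P n u"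
  shows "AE n in \<nu>. P n u"
proof -
  interpret C: prob_space coins by (rule prob_space_coins)
  interpret N: prob_space \<nu> by (rule state_prob_space[OF \<nu>])
  interpret pair_prob_space \<nu> coins ..
  have "AE n in \<nu>. AE \<omega> in coins. P n \<omega>"
    using AE_pair[OF P] by simp
  then show ?thesis
  proof eventually_elim
    case (elim n)
    have "\<not> (AE \<omega> in coins. \<not> (\<forall>j\<in>F. \<omega> j = u j))"
    proof
      assume *: "AE \<omega> in coins. \<not> (\<forall>j\<in>F. \<omega> j = u j)"
      have "{\<omega>. \<forall>j\<in>F. \<omega> j = u j} \<in> sets coins"
        using emeasure_coins_pos[OF F, of u] emeasure_notin_sets by fastforce
      then have "emeasure coins {\<omega>. \<forall>j\<in>F. \<omega> j = u j} = 0"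
        using * AE_iff_measurable[of "{\<omega>. \<forall>j\<in>F. \<omega> j = u j}" coins "\<lambda>\<omega>. \<not> (\<forall>j\<in>F. \<omega> j = u j)"]
        by (simp add: space_state[OF state_coins])
      then show False using emeasure_coins_pos[OF F, of u] by simp
    qed
    moreover have "AE \<omega> in coins. \<not> (\<forall>j\<in>F. \<omega> j = u j)" if "\<not> P n u"
      using elim by eventually_elim (use local that in blast)
    ultimately show ?case by blast
  qed
qed

lemma ssm_step_local:
  assumes "\<And>k. a - 1 \<le> k \<Longrightarrow> k \<le> b + 1 \<Longrightarrow> n k = m k" "\<And>k. a - 1 \<le> k \<Longrightarrow> k \<le> b \<Longrightarrow> \<omega> k = u k"
    and k: "a \<le> k" "k \<le> b"
  shows "ssm_step \<omega> n k = ssm_step u m k"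
proof -
  have "ssm_current \<omega> n j = ssm_current u m j" if "j = k - 1 \<or> j = k" for j
    using assms(1)[of j] assms(1)[of "j + 1"] assms(2)[of j] that k by (auto simp: ssm_current_def)
  then show ?thesis using assms(1)[of k] k by (simp add: ssm_step_def)
qed

lemma ssm_current_short:
  "short (n k) \<Longrightarrow> short (n (k + 1)) \<Longrightarrow> ssm_current \<omega> n k = 0"
  "\<not> short (n k) \<Longrightarrow> short (n (k + 1)) \<Longrightarrow> ssm_current \<omega> n k = 1"
  "short (n k) \<Longrightarrow> \<not> short (n (k + 1)) \<Longrightarrow> ssm_current \<omega> n k = - 1"
  "\<not> short (n k) \<Longrightarrow> \<not> short (n (k + 1)) \<Longrightarrow> ssm_current \<omega> n k = (if \<omega> k then 1 else - 1)"
  by (simp_all add: ssm_current_def)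

section \<open>Ends of runs of short stacks that are zeros\<close>

definition right_front :: "(int \<Rightarrow> nat) \<Rightarrow> int \<Rightarrow> bool" where
  "right_front n i \<longleftrightarrow> short (n (i - 1)) \<and> n i = 0 \<and> \<not> short (n (i + 1))"

definition left_front :: "(int \<Rightarrow> nat) \<Rightarrow> int \<Rightarrow> bool" where
  "left_front n i \<longleftrightarrow> \<not> short (n (i - 1)) \<and> n i = 0 \<and> short (n (i + 1))"

definition inner_zero :: "(int \<Rightarrow> nat) \<Rightarrow> int \<Rightarrow> bool" where
  "inner_zero n i \<longleftrightarrow> short (n (i - 1)) \<and> n i = 0 \<and> short (n (i + 1))"

definition cluster_zero :: "(int \<Rightarrow> nat) \<Rightarrow> int \<Rightarrow> bool" where
  "cluster_zero n i \<longleftrightarrow> n i = 0 \<and> (short (n (i - 1)) \<or> short (n (i + 1)))"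

lemma cluster_zero_iff: "cluster_zero n i \<longleftrightarrow> inner_zero n i \<or> right_front n i \<or> left_front n i"
  by (auto simp: cluster_zero_def inner_zero_def right_front_def left_front_def)

text \<open>Zeros with a short neighbor are never created: a new one can be traced back to one that was
  at the same site or, as the end of a run of short stacks, at an adjacent site.\<close>

lemma cluster_zero_step:
  assumes "cluster_zero (ssm_step \<omega> n) i"
  shows "inner_zero n i \<or> right_front n (i - 1) \<or> left_front n (i + 1)"
proof -
  let ?n' = "ssm_step \<omega> n" and ?c = "ssm_current \<omega> n"
  have h: "int (?n' k) = int (n k) + ?c (k - 1) - ?c k" for k by (rule ssm_step_height)
  have cr: "- 1 \<le> ?c k" "?c k \<le> 1" for k using ssm_current_cases[of \<omega> n k] by auto
  have sh: "0 \<le> ?c (k - 1)" "?c k \<le> 0" "?c (k - 1) = 0 \<longleftrightarrow> short (n (k - 1))" "?c k = 0 \<longleftrightarrow> short (n (k + 1))"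
    if "short (n k)" for k
    using that by (auto simp: ssm_current_def)
  have z: "?n' i = 0" and nb: "short (?n' (i - 1)) \<or> short (?n' (i + 1))"
    using assms by (auto simp: cluster_zero_def)
  show ?thesis
  proof (cases "short (n i)")
    case True
    then have "n i = 0" "?c (i - 1) = 0" "?c i = 0" using sh[OF True] h[of i] z by auto
    then show ?thesis using sh[OF True] by (simp add: inner_zero_def)
  next
    case False
    then have c: "?c (i - 1) = - 1" "?c i = 1" using h[of i] z cr[of i] cr[of "i - 1"] by (auto simp: short_def)
    from nb show ?thesis
    proof
      assume s: "short (?n' (i - 1))"
      have short: "short (n (i - 1))"
        using h[of "i - 1"] s c cr[of "i - 1 - 1"] by (auto simp: short_def)
      then have "n (i - 1) = 0" "?c (i - 1 - 1) = 0"
        using h[of "i - 1"] s c sh[OF short] by (auto simp: short_def)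
      then show ?thesis using sh[OF short] False by (simp add: right_front_def)
    next
      assume s: "short (?n' (i + 1))"
      have short: "short (n (i + 1))"
        using h[of "i + 1"] s c cr[of "i + 1"] by (auto simp: short_def)
      then have "n (i + 1) = 0" "?c (i + 1) = 0"
        using h[of "i + 1"] s c sh[OF short] by (auto simp: short_def)
      then show ?thesis using sh[OF short] False by (simp add: left_front_def)
    qed
  qed
qed

lemma measurable_pred_short [measurable (raw)]:
  "f \<in> measurable M (count_space UNIV) \<Longrightarrow> Measurable.pred M (\<lambda>x. short (f x))"
  by (erule measurable_compose) simp

lemma measurable_fronts [measurable (raw)]:
  assumes [measurable]: "\<And>i. (\<lambda>x. f x i) \<in> measurable M (count_space UNIV)"
  shows "Measurable.pred M (\<lambda>x. right_front (f x) i)" "Measurable.pred M (\<lambda>x. left_front (f x) i)"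
    "Measurable.pred M (\<lambda>x. inner_zero (f x) i)" "Measurable.pred M (\<lambda>x. cluster_zero (f x) i)"
  unfolding right_front_def left_front_def inner_zero_def cluster_zero_def by measurable

lemma sets_joint_pred:
  assumes "state \<nu>" "Measurable.pred (config_space \<Otimes>\<^sub>M coins) P"
  shows "{x. P x} \<in> sets (\<nu> \<Otimes>\<^sub>M coins)"
  using assms(2) unfolding sets_joint[OF assms(1)] pred_def
  using space_state[OF state_coins] by (simp add: space_pair_measure)

lemma AE_joint_shift:
  assumes S: "state \<nu>" and TI: "translation_invariant \<nu>" and P: "AE x in \<nu> \<Otimes>\<^sub>M coins. P x"
  shows "AE x in \<nu> \<Otimes>\<^sub>M coins. \<forall>i. P (shift2 i x)"
proof (subst AE_all_countable, rule allI)
  fix i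
  have "AE x in distr (\<nu> \<Otimes>\<^sub>M coins) (config_space \<Otimes>\<^sub>M coins) (shift2 i). P x"
    by (simp only: joint_shift[OF S TI] P)
  from AE_distrD[OF _ this] show "AE x in \<nu> \<Otimes>\<^sub>M coins. P (shift2 i x)"
    by (simp add: measurable_joint[OF S])
qed

text \<open>What persistence of a right front demands when the nearby coins show
  \<open>False\<close>: stack \<open>i + 1\<close> must lose a particle on both sides to become
  empty. The last clause excludes a left front at \<open>i + 2\<close>, with which the right front
  would merge.\<close>

definition front_rule :: "(int \<Rightarrow> nat) \<Rightarrow> int \<Rightarrow> bool" where
  "front_rule n i \<longleftrightarrow> (right_front n i \<longrightarrow>
     n (i + 1) = 2 \<and> short (n (i + 2)) \<and> (n (i + 2) = 0 \<longrightarrow> \<not> short (n (i + 3))))"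

abbreviation (input) left_step :: "(int \<Rightarrow> nat) \<Rightarrow> int \<Rightarrow> nat" where
  "left_step \<equiv> ssm_step (\<lambda>_. False)"

lemma left_step_funpow_local:
  assumes "\<And>k. a - int t \<le> k \<Longrightarrow> k \<le> b + int t \<Longrightarrow> n k = m k" "a \<le> k" "k \<le> b"
  shows "(left_step ^^ t) n k = (left_step ^^ t) m k"
  using assms
proof (induction t arbitrary: a b k)
  case (Suc t)
  have "left_step ((left_step ^^ t) n) k = left_step ((left_step ^^ t) m) k"
  proof (rule ssm_step_local[where a = a and b = b])
    fix j assume "a - 1 \<le> j" "j \<le> b + 1"
    then show "(left_step ^^ t) n j = (left_step ^^ t) m j"
      by (intro Suc.IH[of "a - 1" "b + 1"] Suc.prems(1)) auto
  qed (use Suc.prems in auto)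
  then show ?case by simp
qed simp

lemma front_rule_local:
  assumes "\<And>k. i - 1 \<le> k \<Longrightarrow> k \<le> i + 3 \<Longrightarrow> n k = m k"
  shows "front_rule n i \<longleftrightarrow> front_rule m i"
  unfolding front_rule_def right_front_def using assms by simp

lemma right_front_step:
  assumes "right_front n i" "front_rule n i"
  shows "right_front (left_step n) (i + 1)"
proof -
  let ?c = "ssm_current (\<lambda>_. False) n"
  have n: "short (n (i - 1))" "n i = 0" "n (i + 1) = 2" "short (n (i + 2))" "n (i + 2) = 0 \<longrightarrow> \<not> short (n (i + 3))"
    using assms by (auto simp: right_front_def front_rule_def)
  have c: "?c (i - 1) = 0" "?c i = - 1" "?c (i + 1) = 1"
    using n ssm_current_short(1)[of n "i - 1"] ssm_current_short(2)[of n "i + 1"] ssm_current_short(3)[of n i]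
    by (simp_all add: short_def add.commute)
  have c2: "?c (i + 2) = (if short (n (i + 3)) then 0 else - 1)"
    using n ssm_current_short(1)[of n "i + 2"] ssm_current_short(3)[of n "i + 2"] by (simp add: add.commute)
  have "int (left_step n i) = 1" "int (left_step n (i + 1)) = 0" "int (left_step n (i + 2)) = int (n (i + 2)) + 1 - ?c (i + 2)"
    using ssm_step_height[of "\<lambda>_. False" n i] ssm_step_height[of "\<lambda>_. False" n "i + 1"]
      ssm_step_height[of "\<lambda>_. False" n "i + 2"] n c c(3)[unfolded add.commute[of i]] by simp_all
  then have "left_step n i = 1" "left_step n (i + 1) = 0" "2 \<le> left_step n (i + 2)"
    using c2 n(5) by (cases "n (i + 2) = 0"; simp split: if_splits)+
  then show ?thesis by (simp add: right_front_def short_def add.commute)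
qed

text \<open>With all coins showing \<open>False\<close>, the height function \<open>A t L\<close>, whose increments are the stack
  heights minus 1, stays positive far to the right, whereas a front advancing at unit speed carries
  the constant height 0.\<close>

lemma no_persistent_front:
  assumes front: "right_front n i" and rule: "\<And>t j. front_rule ((left_step ^^ t) n) j"
    and n: "config_density real n r" and r: "1 < r"
  shows False
proof -
  define N where "N t = (left_step ^^ t) n" for t
  have N0: "N 0 = n" and NSuc: "N (Suc t) = left_step (N t)" for t by (simp_all add: N_def)
  define c where "c t k = ssm_current (\<lambda>_. False) (N t) k" for t k
  have step: "int (N (Suc t) k) = int (N t k) + c t (k - 1) - c t k" for t k
    unfolding NSuc c_def by (rule ssm_step_height)
  have fronts: "right_front (N t) (i + int t)" for t
  proof (induction t)
    case (Suc t)
    then have "right_front (N (Suc t)) (i + int t + 1)"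
      unfolding NSuc by (rule right_front_step) (simp add: N_def rule)
    then show ?case by (simp add: algebra_simps)
  qed (simp add: N0 front)
  \<comment> \<open>The flow is taken across the bond at the right end \<open>L\<close>. This keeps
    the increments in \<open>L\<close> equal to the heights at time \<open>t\<close> minus 1 and
    lets \<open>A\<close> be followed at a moving site.\<close>
  define A where "A t L = (\<Sum>j\<in>{i + 1..L}. int (n j) - 1) - (\<Sum>s<t. c s L)" for t L
  have incr: "A t L = A t (L - 1) + int (N t L) - 1" if "i < L" for t L
  proof (induction t)
    case 0
    have "{i + 1..L} = insert L {i + 1..L - 1}" using that by auto
    then show ?case by (simp add: A_def N0)
  next
    case (Suc t)
    then show ?case by (simp add: A_def step)
  qed
  have A_Suc: "A (Suc t) L = A t L - c t L" for t L by (simp add: A_def)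
  have front_height: "A t (i + int t) = 0" for t
  proof (induction t)
    case (Suc t)
    have f: "right_front (N (Suc t)) (i + int t + 1)" using fronts[of "Suc t"] by (simp add: algebra_simps)
    \<comment> \<open>At the old site of the front \<open>A\<close> gains 1 from the particle moving
      left, and the empty stack that becomes the new front takes 1 off again.\<close>
    have "c t (i + int t) = - 1"
      using fronts[of t] unfolding c_def by (intro ssm_current_short) (auto simp: right_front_def short_def)
    moreover have "N (Suc t) (i + int t + 1) = 0" using f by (simp add: right_front_def)
    ultimately have "A (Suc t) (i + int t + 1) = 0"
      using incr[of "i + int t + 1" "Suc t"] Suc by (simp add: A_Suc)
    then show ?case by (simp add: algebra_simps)
  qed (simp add: A_def)
  obtain K where K: "\<And>k. K \<le> k \<Longrightarrow> 2 \<le> A 0 (i + int k)"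
  proof -
    have A0: "real_of_int (A 0 (i + int k)) = (\<Sum>j<k. real (n (i + 1 + int j))) - real k" for k
    proof -
      have "(\<Sum>j\<in>{i + 1..i + int k}. int (n j) - 1) = (\<Sum>j<k. int (n (i + 1 + int j)) - 1)"
        by (rule sum.reindex_bij_witness[where i = "\<lambda>j. i + 1 + int j" and j = "\<lambda>j. nat (j - i - 1)"]) auto
      then show ?thesis by (simp add: A_def sum_subtractf)
    qed
    have "config_density real (translate (- i) n) r" using n by (simp add: config_density_translate)
    then have "(\<lambda>k. (\<Sum>j<k. real (n (i + 1 + int j))) / real k) \<longlonglongrightarrow> r"
      by (simp add: config_density_def averages_to_def algebra_simps)
    then have "\<forall>\<^sub>F k in sequentially. (1 + r) / 2 < (\<Sum>j<k. real (n (i + 1 + int j))) / real k"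
      by (rule order_tendstoD) (use r in simp)
    \<comment> \<open>The averages eventually exceed 1 by more than \<open>(r - 1) / 2\<close>, so
      \<open>4 / (r - 1)\<close> sites suffice for a total excess of 2.\<close>
    moreover have "\<forall>\<^sub>F k in sequentially. 4 / (r - 1) \<le> real k"
      using filterlim_real_sequentially by (simp add: filterlim_at_top)
    ultimately have "\<forall>\<^sub>F k in sequentially. 2 \<le> A 0 (i + int k)"
      using eventually_gt_at_top[of 0]
    proof eventually_elim
      case (elim k)
      from elim(1,3) have "(1 + r) / 2 * real k < (\<Sum>j<k. real (n (i + 1 + int j)))" by (simp add: field_simps)
      moreover have "2 \<le> (r - 1) / 2 * real k" using elim(2) r by (simp add: field_simps)
      ultimately have "2 \<le> real_of_int (A 0 (i + int k))" unfolding A0 by (simp add: field_simps)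
      then show ?case by simp
    qed
    then show ?thesis using that by (auto simp: eventually_sequentially)
  qed
  \<comment> \<open>The second clause closes the induction: \<open>A\<close> drops at
    \<open>L\<close> only when stack \<open>L + 1\<close> is short, hence only from a value of at
    least 2, and if it drops to 1 then stack \<open>L + 1\<close> must be tall afterwards.\<close>
  have inv: "1 \<le> A t L \<and> (A t L = 1 \<longrightarrow> \<not> short (N t (L + 1)))" if "i + int K \<le> L" for t L
    using that
  proof (induction t arbitrary: L)
    case 0
    then have "K \<le> nat (L - i)" by linarith
    then show ?case using K[of "nat (L - i)"] 0 by simp
  next
    case (Suc t)
    note here = Suc.IH[OF Suc.prems]
    have nxt: "1 \<le> A t (L + 1) \<and> (A t (L + 1) = 1 \<longrightarrow> \<not> short (N t (L + 2)))"
      using Suc.IH[of "L + 1"] Suc.prems by (simp add: add.commute)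
    have AL: "A t (L + 1) = A t L + int (N t (L + 1)) - 1" using incr[of "L + 1" t] Suc.prems by simp
    consider "c t L = 1" | "c t L = 0" | "c t L = - 1"
      using ssm_current_cases[of "\<lambda>_. False" "N t" L] by (auto simp: c_def)
    then show ?case
    proof cases
      case 1
      then have s: "short (N t (L + 1))" by (auto simp: c_def ssm_current_def split: if_splits)
      have A2: "2 \<le> A t L" using here s by (cases "A t L = 1") auto
      have c1: "c t (L + 1) = (if short (N t (L + 2)) then 0 else - 1)"
        using s ssm_current_short(1,3)[of "N t" "L + 1"] by (simp add: c_def add.commute)
      have "\<not> short (N (Suc t) (L + 1))" if "A t L = 2"
      \<comment> \<open>If stack \<open>L + 1\<close> is empty, then \<open>A t (L + 1) = 1\<close>,
        so stack \<open>L + 2\<close> is tall by the invariant there and the empty stack is fed from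
        both sides. A stack of height 1 is made tall by the particle from the left alone.\<close>
      proof (cases "N t (L + 1) = 0")
        case True
        then have "\<not> short (N t (L + 2))" using nxt AL that by simp
        then show ?thesis using step[of t "L + 1"] c1 1 by (auto simp: short_def)
      next
        case False
        then show ?thesis using step[of t "L + 1"] c1 1 by (auto simp: short_def split: if_splits)
      qed
      then show ?thesis using A2 1 by (auto simp: A_Suc)
    next
      case 2
      then have "short (N t (L + 1))" by (auto simp: c_def ssm_current_def split: if_splits)
      then show ?thesis using here 2 by (auto simp: A_Suc)
    next
      case 3
      then show ?thesis using here by (simp add: A_Suc)
    qed
  qed
  \<comment> \<open>At time \<open>K\<close> the front stands at \<open>i + int K\<close>, in the
    region where \<open>A\<close> is at least 1.\<close>
  show False using inv[of "i + int K" K] front_height[of K] by simp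
qed

text \<open>Inner zeros, right fronts and left fronts partition the cluster zeros. After a step, a
  cluster zero at 0 comes from an inner zero at 0 or from a front arriving from a neighboring site.
  Stationarity makes the probabilities before and after equal, so neither a right front that fails
  to advance nor two fronts that arrive at one site can have positive probability.\<close>

lemma AE_front_persists:
  assumes \<nu>: "TIS ssm \<nu>"
  shows "AE x in \<nu> \<Otimes>\<^sub>M coins. (right_front (fst x) 0 \<longrightarrow> ssm_step (snd x) (fst x) 1 = 0) \<and>
     \<not> (right_front (fst x) (- 1) \<and> ssm_step (snd x) (fst x) 0 = 0 \<and> left_front (fst x) 1)"
proof -
  let ?J = "\<nu> \<Otimes>\<^sub>M coins"
  note S = TIS_state[OF \<nu>] and TI = TIS_translation_invariant[OF \<nu>]
  interpret J: prob_space ?J by (rule prob_space_joint[OF S])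
  note [measurable] = measurable_fst_component
  define Z where "Z = {x :: (int \<Rightarrow> nat) \<times> (int \<Rightarrow> bool). cluster_zero (fst x) 0}"
  define Z' where "Z' = {x :: (int \<Rightarrow> nat) \<times> (int \<Rightarrow> bool). cluster_zero (ssm_step (snd x) (fst x)) 0}"
  define I where "I = {x :: (int \<Rightarrow> nat) \<times> (int \<Rightarrow> bool). inner_zero (fst x) 0}"
  define U where "U = {x :: (int \<Rightarrow> nat) \<times> (int \<Rightarrow> bool). right_front (fst x) 0}"
  define V where "V = {x :: (int \<Rightarrow> nat) \<times> (int \<Rightarrow> bool). left_front (fst x) 0}"
  define U' where "U' = {x. right_front (fst x) 0 \<and> ssm_step (snd x) (fst x) 1 = 0}"
  define V' where "V' = {x. left_front (fst x) 0 \<and> ssm_step (snd x) (fst x) (- 1) = 0}"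
  define R where "R = {x. right_front (fst x) (- 1) \<and> ssm_step (snd x) (fst x) 0 = 0}"
  define L where "L = {x. left_front (fst x) 1 \<and> ssm_step (snd x) (fst x) 0 = 0}"
  have meas: "Z \<in> sets ?J" "Z' \<in> sets ?J" "I \<in> sets ?J" "U \<in> sets ?J" "V \<in> sets ?J" "U' \<in> sets ?J" "V' \<in> sets ?J" "R \<in> sets ?J" "L \<in> sets ?J"
    unfolding Z_def Z'_def I_def U_def V_def U'_def V'_def R_def L_def
    by (intro sets_joint_pred[OF S]; measurable)+
  have "J.prob Z' = J.prob Z"
    unfolding Z_def Z'_def
  proof (rule prob_stationary_step[OF \<nu>])
    have "{n \<in> space config_space. cluster_zero n 0} \<in> sets config_space" by measurable
    then show "{n. cluster_zero n 0} \<in> sets config_space" by simp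
  qed
  moreover have "J.prob Z = J.prob I + J.prob U + J.prob V"
  proof -
    have "Z = (I \<union> U) \<union> V" by (auto simp: Z_def I_def U_def V_def cluster_zero_iff)
    moreover have "(I \<union> U) \<inter> V = {}" "I \<inter> U = {}"
      by (auto simp: I_def U_def V_def inner_zero_def right_front_def left_front_def)
    ultimately show ?thesis using meas by (simp add: J.finite_measure_Union)
  qed
  moreover have "J.prob Z' \<le> J.prob I + J.prob (R \<union> L)"
  proof -
    have "Z' \<subseteq> I \<union> (R \<union> L)"
      using cluster_zero_step[where i = 0]
      by (auto simp: Z'_def I_def R_def L_def) (auto simp: cluster_zero_def)
    then have "J.prob Z' \<le> J.prob (I \<union> (R \<union> L))" using meas by (intro J.finite_measure_mono) auto
    also have "\<dots> \<le> J.prob I + J.prob (R \<union> L)" using meas by (intro measure_Un_le) auto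
    finally show ?thesis .
  qed
  moreover have "J.prob (R \<union> L) = J.prob R + J.prob L - J.prob (R \<inter> L)"
    using meas by (simp add: J.finite_measure_Union' J.finite_measure_Diff' Int_commute)
  \<comment> \<open>An arrival at 0 is the translate of a successful departure from 0, and the joint
    law is translation invariant.\<close>
  moreover have "J.prob R = J.prob U'" "J.prob L = J.prob V'"
  proof -
    have "J.prob {x. x \<in> U'} = J.prob {x. shift2 1 x \<in> U'}" "J.prob {x. x \<in> V'} = J.prob {x. shift2 (- 1) x \<in> V'}"
      using emeasure_joint_shift[OF S TI, of "\<lambda>x. x \<in> U'" 1] emeasure_joint_shift[OF S TI, of "\<lambda>x. x \<in> V'" "- 1"] meas
      by (simp_all add: measure_def sets_joint[OF S])
    moreover have "{x. shift2 1 x \<in> U'} = R" "{x. shift2 (- 1) x \<in> V'} = L"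
      by (auto simp: U'_def V'_def R_def L_def shift2_def right_front_def left_front_def ssm_step_translate)
    ultimately show "J.prob R = J.prob U'" "J.prob L = J.prob V'" by simp_all
  qed
  moreover have "J.prob U' = J.prob U - J.prob (U - U')" "J.prob V' = J.prob V - J.prob (V - V')"
  proof -
    have "U' \<subseteq> U" "V' \<subseteq> V" by (auto simp: U_def U'_def V_def V'_def)
    then show "J.prob U' = J.prob U - J.prob (U - U')" "J.prob V' = J.prob V - J.prob (V - V')"
      using meas by (simp_all add: J.finite_measure_Diff)
  qed
  ultimately have "J.prob (U - U') = 0" "J.prob (R \<inter> L) = 0"
    using measure_nonneg[of ?J "U - U'"] measure_nonneg[of ?J "V - V'"] measure_nonneg[of ?J "R \<inter> L"] by linarith+
  then have "AE x in ?J. x \<notin> U - U'" "AE x in ?J. x \<notin> R \<inter> L"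
    using meas by (auto simp: J.prob_eq_0)
  then show ?thesis
    by eventually_elim (auto simp: U_def U'_def R_def L_def)
qed

lemma AE_front_rule:
  assumes \<nu>: "TIS ssm \<nu>"
  shows "AE n in \<nu>. front_rule n i"
proof -
  note S = TIS_state[OF \<nu>] and TI = TIS_translation_invariant[OF \<nu>]
  let ?P = "\<lambda>n \<omega>. (right_front n i \<longrightarrow> ssm_step \<omega> n (i + 1) = 0) \<and>
     \<not> (right_front n i \<and> ssm_step \<omega> n (i + 1) = 0 \<and> left_front n (i + 2))"
  have "AE x in \<nu> \<Otimes>\<^sub>M coins. ?P (fst x) (snd x)"
    using AE_joint_shift[OF S TI AE_front_persists[OF \<nu>]]
  proof eventually_elim
    case (elim x)
    show ?case
      using elim[rule_format, of "- i"] elim[rule_format, of "- i - 1"]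
      by (simp add: shift2_def right_front_def left_front_def ssm_step_translate algebra_simps)
  qed
  then have "AE n in \<nu>. ?P n (\<lambda>_. False)"
  proof (rule AE_joint_specific_coins[OF S, where F = "{i..i + 1}"])
    fix n \<omega> assume *: "\<And>k. k \<in> {i..i + 1} \<Longrightarrow> \<omega> k = False"
    have "ssm_step \<omega> n (i + 1) = left_step n (i + 1)"
      by (rule ssm_step_local[where a = "i + 1" and b = "i + 1"]) (use * in auto)
    then show "?P n \<omega> \<Longrightarrow> ?P n (\<lambda>_. False)" by metis
  qed simp
  then show ?thesis
  proof eventually_elim
    case (elim n)
    show ?case unfolding front_rule_def
    proof
      assume front: "right_front n i"
      then have z: "left_step n (i + 1) = 0" and nl: "\<not> left_front n (i + 2)" using elim by auto
      have f: "n i = 0" "\<not> short (n (i + 1))" using front by (auto simp: right_front_def)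
      let ?c = "ssm_current (\<lambda>_. False) n"
      have c0: "?c i = - 1" using f by (intro ssm_current_short) (auto simp: short_def)
      have h: "int (left_step n (i + 1)) = int (n (i + 1)) + ?c i - ?c (i + 1)"
        using ssm_step_height[of "\<lambda>_. False" n "i + 1"] by simp
      \<comment> \<open>If stack \<open>i + 2\<close> were tall, the coin \<open>False\<close> would
        send a particle from it to stack \<open>i + 1\<close>, which could then not become
        empty.\<close>
      have s2: "short (n (i + 2))"
      proof (rule ccontr)
        assume "\<not> short (n (i + 2))"
        then have "?c (i + 1) = - 1" using f ssm_current_short(4)[of n "i + 1"] by (simp add: add.commute)
        then show False using h z c0 f by (simp add: short_def)
      qed
      then have "?c (i + 1) = 1" using f ssm_current_short(2)[of n "i + 1"] by (simp add: add.commute)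
      then have "n (i + 1) = 2" using h z c0 by simp
      then show "n (i + 1) = 2 \<and> short (n (i + 2)) \<and> (n (i + 2) = 0 \<longrightarrow> \<not> short (n (i + 3)))"
        using s2 nl f by (auto simp: left_front_def add.commute)
    qed
  qed
qed

text \<open>Stationarity carries the rule to the configuration after a random step. Finitely many
  coins decide the rule after the further \<open>t\<close> steps, so the random step can be replaced
  by \<open>left_step\<close>, one iteration at a time.\<close>

lemma AE_front_rule_left_step:
  assumes \<nu>: "TIS ssm \<nu>"
  shows "AE n in \<nu>. front_rule ((left_step ^^ t) n) i"
proof (induction t)
  case 0
  then show ?case using AE_front_rule[OF \<nu>] by simp
next
  case (Suc t)
  from AE_stationary_step[OF \<nu> Suc]
  have "AE n in \<nu>. front_rule ((left_step ^^ t) (left_step n)) i"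
  proof (rule AE_joint_specific_coins[OF TIS_state[OF \<nu>], where F = "{i - 2 - int t..i + 3 + int t}" and
        P = "\<lambda>n \<omega>. front_rule ((left_step ^^ t) (ssm_step \<omega> n)) i"])
    fix n \<omega> assume *: "\<And>k. k \<in> {i - 2 - int t..i + 3 + int t} \<Longrightarrow> \<omega> k = False"
    have "(left_step ^^ t) (ssm_step \<omega> n) k = (left_step ^^ t) (left_step n) k" if "i - 1 \<le> k" "k \<le> i + 3" for k
    proof (rule left_step_funpow_local[where a = "i - 1" and b = "i + 3"])
      fix j assume j: "i - 1 - int t \<le> j" "j \<le> i + 3 + int t"
      show "ssm_step \<omega> n j = left_step n j"
        by (rule ssm_step_local[where a = "i - 1 - int t" and b = "i + 3 + int t"]) (use * j in auto)
    qed (use that in auto)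
    then show "front_rule ((left_step ^^ t) (ssm_step \<omega> n)) i \<Longrightarrow> front_rule ((left_step ^^ t) (left_step n)) i"
      using front_rule_local by blast
  qed simp
  then show ?case by (simp add: funpow_swap1)
qed

lemma AE_no_right_front:
  assumes \<nu>: "TIS ssm \<nu>" and dens: "has_density real \<nu> r" and r: "1 < r"
  shows "AE n in \<nu>. \<forall>i. \<not> right_front n i"
proof -
  have "AE n in \<nu>. \<forall>t. \<forall>j. front_rule ((left_step ^^ t) n) j"
    by (simp only: AE_all_countable) (intro allI AE_front_rule_left_step[OF \<nu>])
  with dens[unfolded has_density_iff] show ?thesis
    by eventually_elim (use no_persistent_front r in blast)
qed

section \<open>Left fronts by reflection\<close>

definition reflect :: "(int \<Rightarrow> 'a) \<Rightarrow> int \<Rightarrow> 'a" where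
  "reflect n = (\<lambda>i. n (- i))"

lemma measurable_reflect [measurable]: "reflect \<in> measurable config_space config_space"
  unfolding reflect_def by (rule measurable_into_config_space) measurable

text \<open>The bond from \<open>k\<close> to \<open>k + 1\<close> is mirrored to the one from
  \<open>- k - 1\<close> to \<open>- k\<close>, indexed by its left end. The direction of the
  particle is reversed as well, so the coin is negated.\<close>

lemma ssm_step_reflect: "ssm_step (\<lambda>k. \<not> \<omega> (- k - 1)) (reflect n) = reflect (ssm_step \<omega> n)"
proof -
  have "ssm_current (\<lambda>k. \<not> \<omega> (- k - 1)) (reflect n) k = - ssm_current \<omega> n (- k - 1)" for k
    by (simp add: ssm_current_def reflect_def)
  then show ?thesis by (simp add: ssm_step_def reflect_def fun_eq_iff algebra_simps)
qed

lemma coins_flip_reflect: "distr coins config_space (\<lambda>\<omega> k. \<not> \<omega> (- k - 1)) = coins"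
proof -
  have m1: "(\<lambda>\<omega> k. \<omega> (- k - 1)) \<in> measurable coins config_space"
    and m2: "(\<lambda>\<omega> k. \<not> \<omega> k) \<in> measurable coins config_space"
    by (rule measurable_into_config_space, simp add: measurable_cong_sets[OF sets_coins refl])+
  have "distr coins config_space (\<lambda>\<omega> k. \<not> \<omega> (- k - 1)) =
      distr (distr coins config_space (\<lambda>\<omega> k. \<omega> (- k - 1))) config_space (\<lambda>\<omega> k. \<not> \<omega> k)"
    using m1 m2 by (subst distr_distr) (auto simp: comp_def measurable_cong_sets[OF sets_coins refl])
  also have "distr coins config_space (\<lambda>\<omega> k. \<omega> (- k - 1)) = coins"
    by (rule coins_reindex) (auto simp: inj_def)
  finally show ?thesis by (simp only: coins_flip)
qed

lemma distr_joint:
  assumes \<mu>: "state \<mu>" and f: "f \<in> measurable config_space config_space"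
    and g: "g \<in> measurable coins config_space" and inv: "distr coins config_space g = coins"
  shows "distr (\<mu> \<Otimes>\<^sub>M coins) (config_space \<Otimes>\<^sub>M coins) (map_prod f g) = distr \<mu> config_space f \<Otimes>\<^sub>M coins"
proof -
  have "distr \<mu> config_space f \<Otimes>\<^sub>M distr coins config_space g =
      distr (\<mu> \<Otimes>\<^sub>M coins) (config_space \<Otimes>\<^sub>M config_space) (\<lambda>(x, y). (f x, g y))"
    by (rule pair_measure_distr)
       (use f g inv \<mu> in \<open>auto simp: measurable_state prob_space_coins prob_space_imp_sigma_finite\<close>)
  also have "\<dots> = distr (\<mu> \<Otimes>\<^sub>M coins) (config_space \<Otimes>\<^sub>M coins) (map_prod f g)"
    by (rule distr_cong) (auto simp: sets_coins intro: sets_pair_measure_cong)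
  finally show ?thesis by (simp only: inv)
qed

lemma TIS_reflect:
  assumes \<nu>: "TIS ssm \<nu>"
  shows "TIS ssm (distr \<nu> config_space reflect)"
proof -
  let ?\<nu> = "distr \<nu> config_space reflect" and ?g = "\<lambda>\<omega> k. \<not> \<omega> (- k - 1 :: int)"
  have S: "state \<nu>" and TI: "translation_invariant \<nu>" and st: "\<nu> \<bind> ssm = \<nu>"
    using \<nu> by (auto simp: TIS_def stationary_def)
  have S': "state ?\<nu>" by (rule state_distr_state[OF S]) measurable
  have g: "?g \<in> measurable coins config_space"
    by (rule measurable_into_config_space) (simp add: measurable_cong_sets[OF sets_coins refl])
  have g': "?g \<in> measurable coins coins"
    using g by (simp add: measurable_cong_sets[OF refl sets_coins])
  have TI': "translation_invariant ?\<nu>"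
  proof -
    have "distr ?\<nu> config_space (translate 1) = distr \<nu> config_space (\<lambda>n. reflect (translate (- 1) n))"
      using S by (subst distr_distr) (auto simp: measurable_state comp_def reflect_def fun_eq_iff intro!: distr_cong)
    also have "\<dots> = distr (distr \<nu> config_space (translate (- 1))) config_space reflect"
      using S by (subst distr_distr) (auto simp: measurable_state comp_def)
    finally show ?thesis
      by (simp only: translation_invariant_def translation_invariant_translate[OF S TI])
  qed
  have mp: "map_prod reflect ?g \<in> measurable (config_space \<Otimes>\<^sub>M coins) (config_space \<Otimes>\<^sub>M coins)"
    unfolding map_prod_def using g' by measurable
  have "?\<nu> \<bind> ssm = distr (distr (\<nu> \<Otimes>\<^sub>M coins) (config_space \<Otimes>\<^sub>M coins) (map_prod reflect ?g)) config_space (\<lambda>(n, \<omega>). ssm_step \<omega> n)"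
    by (simp only: bind_ssm[OF S'] distr_joint[OF S measurable_reflect g coins_flip_reflect])
  also have "\<dots> = distr (\<nu> \<Otimes>\<^sub>M coins) config_space (\<lambda>(n, \<omega>). reflect (ssm_step \<omega> n))"
    using mp S by (subst distr_distr) (auto simp: measurable_joint comp_def ssm_step_reflect map_prod_def split_beta intro!: distr_cong)
  also have "\<dots> = distr (distr (\<nu> \<Otimes>\<^sub>M coins) config_space (\<lambda>(n, \<omega>). ssm_step \<omega> n)) config_space reflect"
    using S by (subst distr_distr) (auto simp: measurable_joint comp_def case_prod_beta' intro!: distr_cong)
  also have "\<dots> = ?\<nu>" using st by (simp only: bind_ssm[OF S, symmetric])
  finally show ?thesis using S' TI' by (simp add: TIS_def stationary_def)
qed

lemma config_density_reflect: "config_density v (reflect n) r \<longleftrightarrow> config_density v n r"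
  by (auto simp: config_density_def reflect_def algebra_simps)

lemma AE_no_left_front:
  assumes \<nu>: "TIS ssm \<nu>" and dens: "has_density real \<nu> r" and r: "1 < r"
  shows "AE n in \<nu>. \<forall>i. \<not> left_front n i"
proof -
  have S: "state \<nu>" using \<nu> by (simp add: TIS_def)
  have refl: "reflect \<in> measurable \<nu> config_space" using S by (simp add: measurable_state)
  have "has_density real (distr \<nu> config_space reflect) r"
    unfolding has_density_iff using dens sets_config_density[of real r]
    by (subst AE_distr_iff[OF refl]) (auto simp: has_density_iff config_density_reflect)
  from AE_no_right_front[OF TIS_reflect[OF \<nu>] this r]
  have "AE n in \<nu>. \<forall>i. \<not> right_front (reflect n) i"
    by (rule AE_distrD[OF refl])
  then show ?thesis
  proof eventually_elim
    case (elim n)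
    show ?case
    proof
      fix i show "\<not> left_front n i"
        using elim[rule_format, of "- i"] by (auto simp: right_front_def left_front_def reflect_def add.commute)
    qed
  qed
qed

section \<open>From the absence of fronts to \<open>X_star\<close>\<close>

definition short_pair :: "(int \<Rightarrow> nat) \<Rightarrow> int \<Rightarrow> bool" where
  "short_pair n k \<longleftrightarrow> short (n k) \<and> short (n (k + 1))"

text \<open>Suppose a pair is new. If both stacks were tall, the one that receives the particle
  stays tall. If just one was, the short one receives a particle from it and stays short only if it
  was empty with its other neighbor short too, that is, if it was a front.\<close>

lemma short_pair_step:
  assumes pair: "short_pair (ssm_step \<omega> n) k" and no: "\<not> right_front n k" "\<not> left_front n (k + 1)"
  shows "short_pair n k"
proof -
  let ?n' = "ssm_step \<omega> n" and ?c = "ssm_current \<omega> n"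
  have h: "int (?n' j) = int (n j) + ?c (j - 1) - ?c j" for j by (rule ssm_step_height)
  have cr: "- 1 \<le> ?c j" "?c j \<le> 1" for j using ssm_current_cases[of \<omega> n j] by auto
  have s': "?n' k \<le> 1" "?n' (k + 1) \<le> 1" using pair by (auto simp: short_pair_def short_def)
  have h1: "int (?n' (k + 1)) = int (n (k + 1)) + ?c k - ?c (k + 1)" using h[of "k + 1"] by simp
  consider "short_pair n k" | "\<not> short (n k)" "\<not> short (n (k + 1))"
    | "short (n k)" "\<not> short (n (k + 1))" | "\<not> short (n k)" "short (n (k + 1))"
    by (auto simp: short_pair_def)
  then show ?thesis
  proof cases
    case 2
    then have "?c k = 1 \<or> ?c k = - 1" by (simp add: ssm_current_def)
    then show ?thesis using 2 s' h[of k] h1 cr[of "k - 1"] cr[of "k + 1"] by (auto simp: short_def)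
  next
    case 3
    then have "?c k = - 1" by (simp add: ssm_current_def)
    moreover have "0 \<le> ?c (k - 1)" "?c (k - 1) = 0 \<longleftrightarrow> short (n (k - 1))"
      using 3 by (auto simp: ssm_current_def)
    ultimately have "n k = 0" "short (n (k - 1))" using s' h[of k] by auto
    then show ?thesis using 3 no by (simp add: right_front_def)
  next
    case 4
    then have "?c k = 1" by (simp add: ssm_current_def)
    moreover have "?c (k + 1) \<le> 0" "?c (k + 1) = 0 \<longleftrightarrow> short (n (k + 1 + 1))"
      using 4 by (auto simp: ssm_current_def)
    ultimately have "n (k + 1) = 0" "short (n (k + 1 + 1))" using s' h1 by auto
    then show ?thesis using 4 no by (simp add: left_front_def)
  qed
qed

lemma AE_X_star:
  assumes \<nu>: "TIS ssm \<nu>" and dens: "has_density real \<nu> r" and r: "1 < r"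
  shows "AE n in \<nu>. n \<in> X_star"
proof -
  let ?J = "\<nu> \<Otimes>\<^sub>M coins"
  have S: "state \<nu>" using \<nu> by (simp add: TIS_def)
  interpret J: prob_space ?J by (rule prob_space_joint[OF S])
  note [measurable] = measurable_fst_component
  have fst_AE: "AE x in ?J. P (fst x)" if "AE n in \<nu>. P n" for P
  proof -
    have fst: "distr ?J \<nu> fst = \<nu>"
    proof (rule measure_eqI)
      fix A assume A: "A \<in> sets (distr ?J \<nu> fst)"
      interpret C: prob_space coins by (rule prob_space_coins)
      have "fst -` A \<inter> space ?J = A \<times> space coins"
        using A sets.sets_into_space[of A \<nu>] by (auto simp: space_pair_measure)
      then show "emeasure (distr ?J \<nu> fst) A = emeasure \<nu> A"
        using A by (simp add: emeasure_distr C.emeasure_pair_measure_Times C.emeasure_space_1)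
    qed simp
    have "AE n in distr ?J \<nu> fst. P n" by (simp only: fst that)
    from AE_distrD[OF _ this] show ?thesis by simp
  qed
  have fronts: "AE x in ?J. (\<forall>i. \<not> right_front (fst x) i) \<and> (\<forall>i. \<not> left_front (fst x) i)"
    using fst_AE[OF AE_no_right_front[OF \<nu> dens r]] fst_AE[OF AE_no_left_front[OF \<nu> dens r]]
    by eventually_elim simp
  \<comment> \<open>Short pairs are not created, so by stationarity none is lost. If a pair at
    \<open>k\<close> had a tall stack to its right, stack \<open>k + 1\<close>, not being a right
    front, would have height 1 and be raised to 2, which destroys the pair.\<close>
  have grow: "AE n in \<nu>. short_pair n k \<longrightarrow> short_pair n (k + 1)" for k
  proof -
    define P where "P = {x :: (int \<Rightarrow> nat) \<times> (int \<Rightarrow> bool). short_pair (fst x) k}"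
    define P' where "P' = {x :: (int \<Rightarrow> nat) \<times> (int \<Rightarrow> bool). short_pair (ssm_step (snd x) (fst x)) k}"
    have meas [measurable]: "P \<in> sets ?J" "P' \<in> sets ?J"
      unfolding P_def P'_def short_pair_def by (intro sets_joint_pred[OF S]; measurable)+
    have "{n \<in> space config_space. short_pair n k} \<in> sets config_space"
      unfolding short_pair_def by measurable
    then have eq: "J.prob P' = J.prob P"
      unfolding P_def P'_def by (intro prob_stationary_step[OF \<nu>]) simp
    have sub: "AE x in ?J. x \<in> P' \<longrightarrow> x \<in> P"
      using fronts by eventually_elim (auto simp: P_def P'_def intro: short_pair_step)
    have "J.prob P = J.prob (P \<inter> P') + J.prob (P - P')"
      using meas by (metis J.finite_measure_Diff' add.commute diff_add_cancel)
    moreover have "J.prob (P \<inter> P') = J.prob P'"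
      using sub meas by (intro J.finite_measure_eq_AE) auto
    ultimately have "J.prob (P - P') = 0" using eq by simp
    then have "AE x in ?J. x \<notin> P - P'" using meas by (simp add: J.prob_eq_0)
    with fronts have "AE x in ?J. short_pair (fst x) k \<longrightarrow> short_pair (fst x) (k + 1)"
    proof eventually_elim
      case (elim x)
      show ?case
      proof
        let ?n = "fst x" and ?c = "ssm_current (snd x) (fst x)"
        assume pair: "short_pair ?n k"
        then have pair': "short_pair (ssm_step (snd x) ?n) k" using elim(2) by (auto simp: P_def P'_def)
        show "short_pair ?n (k + 1)"
        proof (rule ccontr)
          assume "\<not> short_pair ?n (k + 1)"
          then have tall: "\<not> short (?n (k + 1 + 1))" using pair by (auto simp: short_pair_def)
          have n1: "?n (k + 1) \<noteq> 0"
            using elim(1) pair tall by (auto simp: right_front_def short_pair_def dest: spec[of _ "k + 1"])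
          have "?c k = 0" "?c (k + 1) = - 1"
            using pair tall by (auto simp: ssm_current_def short_pair_def)
          then have "int (ssm_step (snd x) ?n (k + 1)) = int (?n (k + 1)) + 1"
            using ssm_step_height[of "snd x" ?n "k + 1"] by simp
          then show False using n1 pair' by (auto simp: short_pair_def short_def)
        qed
      qed
    qed
    then show ?thesis
      by (rule AE_joint_specific_coins[OF S, where P = "\<lambda>n _. short_pair n k \<longrightarrow> short_pair n (k + 1)" and F = "{}"]) auto
  qed
  have "AE n in \<nu>. \<forall>k. short_pair n k \<longrightarrow> short_pair n (k + 1)"
    by (simp only: AE_all_countable) (intro allI grow)
  with dens[unfolded has_density_iff] show ?thesis
  proof eventually_elim
    case (elim n)
    \<comment> \<open>A single pair would spread to the right forever, so that all heights from
      \<open>k\<close> on are at most 1, contrary to a density above 1.\<close>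
    have "\<not> short_pair n k" for k
    proof
      assume "short_pair n k"
      then have "short_pair n (k + int j)" for j
      proof (induction j)
        case (Suc j)
        then show ?case using elim(2)[rule_format, of "k + int j"] by (simp add: algebra_simps)
      qed simp
      then have small: "n (k + int j) \<le> 1" for j by (simp add: short_pair_def short_def)
      have "config_density real (translate (1 - k) n) r" using elim(1) by (simp add: config_density_translate)
      then have "(\<lambda>N. (\<Sum>j<N. real (n (k + int j))) / real N) \<longlonglongrightarrow> r"
        by (simp add: config_density_def averages_to_def algebra_simps)
      then have "r \<le> 1"
      proof (rule LIMSEQ_le_const2)
        have "(\<Sum>j<N. real (n (k + int j))) / real N \<le> 1" for N
        proof -
          have "(\<Sum>j<N. real (n (k + int j))) \<le> (\<Sum>j<N. 1)" by (intro sum_mono) (use small in simp)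
          then show ?thesis by (cases "N = 0") (auto simp: field_simps)
        qed
        then show "\<exists>M. \<forall>N\<ge>M. (\<Sum>j<N. real (n (k + int j))) / real N \<le> 1" by blast
      qed
      then show False using r by simp
    qed
    then show ?case by (auto simp: X_star_def short_pair_def)
  qed
qed

section \<open>Ergodic states\<close>

lemma funpow_translate: "(translate s ^^ k) \<eta> = translate (s * int k) \<eta>"
  by (induction k) (simp_all add: algebra_simps)

lemma ergodic_averages:
  fixes f :: "(int \<Rightarrow> 'a) \<Rightarrow> real"
  assumes erg: "ergodic_TI \<mu>" and s: "s = 1 \<or> s = - 1"
    and f: "f \<in> borel_measurable config_space" and B: "\<And>x. \<bar>f x\<bar> \<le> B"
  shows "AE x in \<mu>. averages_to (\<lambda>k. f (translate (s * int k) x)) (\<integral>x. f x \<partial>\<mu>)"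
proof -
  have S: "state \<mu>" and TI: "translation_invariant \<mu>" using erg by (auto simp: ergodic_TI_def)
  interpret prob_space \<mu> by (rule state_prob_space[OF S])
  have "AE x in \<mu>. (\<lambda>N. (\<Sum>k<N. f ((translate s ^^ k) x)) / real N) \<longlonglongrightarrow> expectation f"
  proof (rule birkhoff)
    show T: "translate s \<in> measurable \<mu> \<mu>"
      by (simp add: measurable_state[OF S] measurable_cong_sets[OF refl sets_state[OF S]])
    show "distr \<mu> \<mu> (translate s) = \<mu>"
      using translation_invariant_translate[OF S TI] distr_cong[OF refl sets_state[OF S], of \<mu>] by metis
    show "prob A = 0 \<or> prob A = 1" if A: "A \<in> events" and inv: "translate s -` A \<inter> space \<mu> = A" for A
    proof -
      have "translate 1 -` A = A"
        using s
      proof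
        assume s: "s = - 1"
        have "translate 1 -` (translate (- 1) -` A) = A" by auto
        then show ?thesis using inv s by (simp add: space_state[OF S])
      qed (use inv in \<open>simp add: space_state[OF S]\<close>)
      then show ?thesis using erg A by (auto simp: ergodic_TI_def)
    qed
  qed (use f B in \<open>auto simp: measurable_state[OF S]\<close>)
  then show ?thesis by (simp add: averages_to_def funpow_translate)
qed

lemma ergodic_has_density:
  fixes v :: "'a \<Rightarrow> real"
  assumes erg: "ergodic_TI \<mu>" and v: "\<And>x. \<bar>v x\<bar> \<le> B"
  shows "\<exists>r. has_density v \<mu> r"
proof -
  have S: "state \<mu>" and TI: "translation_invariant \<mu>" using erg by (auto simp: ergodic_TI_def)
  have meas: "(\<lambda>\<eta>. v (\<eta> i)) \<in> borel_measurable config_space" for i :: int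
    by (rule measurable_compose[OF measurable_config_component]) simp
  have eq: "(\<integral>\<eta>. v (\<eta> (- 1)) \<partial>\<mu>) = (\<integral>\<eta>. v (\<eta> 1) \<partial>\<mu>)"
    using integral_translate[OF S TI meas[of 1], of 2] by simp
  have "AE \<eta> in \<mu>. config_density v \<eta> (\<integral>\<eta>. v (\<eta> 1) \<partial>\<mu>)"
    using ergodic_averages[OF erg _ meas[of 1] v, of "- 1"] ergodic_averages[OF erg _ meas[of "- 1"] v, of 1]
    by (auto simp: config_density_def eq algebra_simps)
  then show ?thesis by (auto simp: has_density_iff)
qed

text \<open>The averages of an indicator converge to its probability almost surely under \<mu>,
  hence under \<nu> by absolute continuity. Integrating them against the translation invariant \<nu>
  gives the probability under \<nu>, which must be the same limit.\<close>

lemma ergodic_unique: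
  assumes erg: "ergodic_TI \<mu>" and \<nu>: "state \<nu>" "translation_invariant \<nu>"
    and ac: "\<And>A. A \<in> sets config_space \<Longrightarrow> emeasure \<mu> A = 0 \<Longrightarrow> emeasure \<nu> A = 0"
  shows "\<nu> = \<mu>"
proof (rule state_eqI)
  have S: "state \<mu>" using erg by (auto simp: ergodic_TI_def)
  show "state \<nu>" "state \<mu>" by fact+
  interpret M: prob_space \<mu> by (rule state_prob_space[OF S])
  interpret N: prob_space \<nu> by (rule state_prob_space[OF \<nu>(1)])
  fix A :: "(int \<Rightarrow> 'a) set" assume A [measurable]: "A \<in> sets config_space"
  let ?f = "indicator A :: (int \<Rightarrow> 'a) \<Rightarrow> real"
  have ac': "absolutely_continuous \<mu> \<nu>"
    using ac by (auto simp: absolutely_continuous_def null_sets_def sets_state[OF S] sets_state[OF \<nu>(1)])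
  have "AE x in \<mu>. averages_to (\<lambda>k. ?f (translate (1 * int k) x)) (\<integral>x. ?f x \<partial>\<mu>)"
    by (rule ergodic_averages[OF erg, where B = 1]) (auto simp: indicator_def)
  then have ae: "AE x in \<nu>. averages_to (\<lambda>k. ?f (translate (int k) x)) (measure \<mu> A)"
    using absolutely_continuous_AE[OF _ ac'] A by (simp add: sets_state S \<nu>(1))
  have meas: "(\<lambda>x. ?f (translate (int k) x)) \<in> borel_measurable \<nu>" for k
    by (simp add: measurable_state[OF \<nu>(1)])
  have "(\<lambda>N. \<integral>x. (\<Sum>k<N. ?f (translate (int k) x)) / real N \<partial>\<nu>) \<longlonglongrightarrow> (\<integral>x. measure \<mu> A \<partial>\<nu>)"
  proof (rule integral_dominated_convergence[where w = "\<lambda>_. 1"])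
    show "AE x in \<nu>. norm ((\<Sum>k<N. ?f (translate (int k) x)) / real N) \<le> 1" for N
    proof (rule AE_I2)
      fix x
      have "(\<Sum>k<N. ?f (translate (int k) x)) \<le> (\<Sum>k<N. 1)" by (intro sum_mono) (simp add: indicator_def)
      moreover have "0 \<le> (\<Sum>k<N. ?f (translate (int k) x))" by (intro sum_nonneg) simp
      ultimately show "norm ((\<Sum>k<N. ?f (translate (int k) x)) / real N) \<le> 1"
        by (cases "N = 0") (auto simp: field_simps)
    qed
  qed (use ae meas in \<open>auto simp: averages_to_def\<close>)
  moreover have "\<forall>\<^sub>F N in sequentially. (\<integral>x. (\<Sum>k<N. ?f (translate (int k) x)) / real N \<partial>\<nu>) = measure \<nu> A"
    using eventually_gt_at_top[of 0]
  proof eventually_elim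
    case (elim N)
    have int: "integrable \<nu> (\<lambda>x. ?f (translate (int k) x))" for k
      by (rule N.integrable_const_bound[where B = 1]) (use meas in \<open>auto simp: indicator_def\<close>)
    have "(\<integral>x. ?f (translate (int k) x) \<partial>\<nu>) = measure \<nu> A" for k
      using integral_translate[OF \<nu>, of ?f "int k"] A by (simp add: sets_state[OF \<nu>(1)])
    then show ?case using int elim by (simp add: integral_sum)
  qed
  ultimately have "(\<lambda>N::nat. measure \<nu> A) \<longlonglongrightarrow> (\<integral>x. measure \<mu> A \<partial>\<nu>)"
    by (subst (asm) tendsto_cong) auto
  then have "measure \<nu> A = measure \<mu> A" by (simp add: LIMSEQ_const_iff N.prob_space)
  then show "emeasure \<nu> A = emeasure \<mu> A" by (simp add: M.emeasure_eq_measure N.emeasure_eq_measure)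
qed

section \<open>The parities of the stacks\<close>

definition parity :: "(int \<Rightarrow> nat) \<Rightarrow> int \<Rightarrow> bool" where
  "parity n = (\<lambda>i. odd (n i))"

definition even_part :: "(int \<Rightarrow> nat) \<Rightarrow> int \<Rightarrow> nat" where
  "even_part n = (\<lambda>i. n i - n i mod 2)"

lemma measurable_parity [measurable]: "parity \<in> measurable config_space config_space"
  unfolding parity_def
  by (rule measurable_into_config_space, rule measurable_compose[OF measurable_config_component]) simp

lemma measurable_even_part [measurable]: "even_part \<in> measurable config_space config_space"
  unfolding even_part_def
  by (rule measurable_into_config_space, rule measurable_compose[OF measurable_config_component]) simp

lemma measurable_gamma_map [measurable]:
  "gamma_map \<in> measurable (config_space \<Otimes>\<^sub>M config_space) config_space"
proof (rule measurable_into_config_space)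
  fix i
  have "(\<lambda>x :: (int \<Rightarrow> nat) \<times> (int \<Rightarrow> bool). fst x i + of_bool (snd x i)) \<in> measurable (config_space \<Otimes>\<^sub>M config_space) (count_space UNIV)"
    by (rule measurable_countable2[where h = "\<lambda>a b. a + of_bool b"];
        rule measurable_compose[OF _ measurable_config_component]; measurable)
  then show "(\<lambda>x. gamma_map x i) \<in> measurable (config_space \<Otimes>\<^sub>M config_space) (count_space UNIV)"
    by (simp add: gamma_map_def case_prod_beta')
qed

lemma gamma_map_parts: "gamma_map (even_part n, parity n) = n"
proof
  fix i show "gamma_map (even_part n, parity n) i = n i"
    by (cases "even (n i)") (auto simp: gamma_map_def even_part_def parity_def odd_iff_mod_2_eq_one even_iff_mod_2_eq_zero)
qed

lemma parts_gamma_map: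
  assumes "\<And>i. even (m i)"
  shows "even_part (gamma_map (m, \<sigma>)) = m" "parity (gamma_map (m, \<sigma>)) = \<sigma>"
proof -
  have "even_part (gamma_map (m, \<sigma>)) i = m i \<and> parity (gamma_map (m, \<sigma>)) i = \<sigma> i" for i
  proof -
    have "(m i + 1) mod 2 = 1" "m i mod 2 = 0" using assms[of i] by presburger+
    then show ?thesis
      using assms[of i] by (cases "\<sigma> i") (simp_all add: gamma_map_def even_part_def parity_def)
  qed
  then show "even_part (gamma_map (m, \<sigma>)) = m" "parity (gamma_map (m, \<sigma>)) = \<sigma>" by auto
qed

lemma even_even_part: "even (even_part n i)"
  by (simp add: even_part_def)

lemma short_gamma_map: "even (m i) \<Longrightarrow> short (gamma_map (m, \<sigma>) i) \<longleftrightarrow> short (m i)"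
  by (auto simp: gamma_map_def short_def elim!: evenE)

lemma even_part_X_star: "n \<in> X_star \<Longrightarrow> even_part n \<in> X_star_even"
proof -
  have "short (n i) \<longleftrightarrow> short (even_part n i)" for i
    using short_gamma_map[of "even_part n" i "parity n"] by (simp add: gamma_map_parts even_even_part)
  then show "n \<in> X_star \<Longrightarrow> even_part n \<in> X_star_even"
    by (simp add: X_star_even_def X_star_def even_even_part)
qed

text \<open>Adding 1 to an even height does not change whether the stack is short: 0 and 1 are both
  short, and every even height above 0 is tall. So all currents agree.\<close>

lemma ssm_step_gamma_map:
  assumes "\<And>i. even (m i)"
  shows "ssm_step \<omega> (gamma_map (m, \<sigma>)) = gamma_map (ssm_step \<omega> m, \<sigma>)"
proof
  fix i
  have "ssm_current \<omega> (gamma_map (m, \<sigma>)) k = ssm_current \<omega> m k" for k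
    using assms by (simp add: ssm_current_def short_gamma_map)
  then have "int (ssm_step \<omega> (gamma_map (m, \<sigma>)) i) = int (gamma_map (ssm_step \<omega> m, \<sigma>) i)"
    by (simp add: ssm_step_height gamma_map_def)
  then show "ssm_step \<omega> (gamma_map (m, \<sigma>)) i = gamma_map (ssm_step \<omega> m, \<sigma>) i" by simp
qed

lemma even_ssm_step:
  assumes "m \<in> X_star_even"
  shows "even (ssm_step \<omega> m i)"
proof -
  have c: "ssm_current \<omega> m k = 1 \<or> ssm_current \<omega> m k = - 1" for k
    using assms by (auto simp: X_star_even_def X_star_def ssm_current_def)
  have "even (int (ssm_step \<omega> m i))"
    using assms c[of i] c[of "i - 1"] by (auto simp: ssm_step_height X_star_even_def)
  then show ?thesis by simp
qed

text \<open>On \<^const>\<open>X_star\<close> every bond carries exactly one particle, so the parities do not change.\<close>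

lemma ssm_step_parts:
  assumes "n \<in> X_star"
  shows "even_part (ssm_step \<omega> n) = ssm_step \<omega> (even_part n)" "parity (ssm_step \<omega> n) = parity n"
proof -
  have "ssm_step \<omega> n = gamma_map (ssm_step \<omega> (even_part n), parity n)"
    using ssm_step_gamma_map[of "even_part n" \<omega> "parity n"] by (simp add: gamma_map_parts even_even_part)
  then show "even_part (ssm_step \<omega> n) = ssm_step \<omega> (even_part n)" "parity (ssm_step \<omega> n) = parity n"
    using parts_gamma_map[of "ssm_step \<omega> (even_part n)" "parity n"] even_ssm_step[OF even_part_X_star[OF assms]]
    by simp_all
qed

lemma emeasure_ssm:
  assumes "A \<in> sets config_space"
  shows "emeasure (ssm n) A = emeasure coins {\<omega>. ssm_step \<omega> n \<in> A}"
proof -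
  have "(\<lambda>\<omega>. ssm_step \<omega> n) \<in> measurable coins config_space"
    using measurable_compose[OF measurable_Pair1' measurable_ssm_step, of n] by simp
  then show ?thesis
    unfolding ssm_def using assms by (simp add: emeasure_distr space_state[OF state_coins] vimage_def)
qed

lemma measurable_emeasure_ssm:
  assumes "A \<in> sets config_space"
  shows "(\<lambda>n. emeasure (ssm n) A) \<in> borel_measurable config_space"
  using measurable_compose[OF measurable_ssm measurable_emeasure_subprob_algebra[OF assms]] .

lemma emeasure_bind_ssm:
  assumes "state \<nu>" "A \<in> sets config_space"
  shows "emeasure (\<nu> \<bind> ssm) A = (\<integral>\<^sup>+ n. emeasure (ssm n) A \<partial>\<nu>)"
  by (rule emeasure_bind) (use assms measurable_ssm in \<open>auto simp: space_state measurable_state\<close>)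

lemma stationaryI:
  assumes \<nu>: "state \<nu>" and eq: "\<And>A. A \<in> sets config_space \<Longrightarrow> (\<integral>\<^sup>+ n. emeasure (ssm n) A \<partial>\<nu>) = emeasure \<nu> A"
  shows "stationary ssm \<nu>"
  unfolding stationary_def
  by (rule state_eqI) (use \<nu> eq in \<open>auto simp: state_bind_ssm emeasure_bind_ssm\<close>)

lemma stationary_nn_integral:
  assumes "state \<nu>" "stationary ssm \<nu>" "A \<in> sets config_space"
  shows "(\<integral>\<^sup>+ n. emeasure (ssm n) A \<partial>\<nu>) = emeasure \<nu> A"
  using assms emeasure_bind_ssm[OF assms(1,3)] by (simp add: stationary_def)

lemma sets_parity_vimage: "B \<in> sets config_space \<Longrightarrow> parity -` B \<in> sets config_space"
  and sets_even_part_vimage: "A \<in> sets config_space \<Longrightarrow> even_part -` A \<in> sets config_space"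
  using measurable_sets[OF measurable_parity] measurable_sets[OF measurable_even_part] by auto

section \<open>Conditioning on the parities\<close>

context
  fixes \<nu> :: "(int \<Rightarrow> nat) measure" and B :: "(int \<Rightarrow> bool) set"
  assumes \<nu>: "state \<nu>" and st: "stationary ssm \<nu>" and X: "AE n in \<nu>. n \<in> X_star"
    and B: "B \<in> sets config_space" and pos: "emeasure \<nu> (parity -` B) \<noteq> 0"
begin

lemma sets_parity_event: "parity -` B \<in> sets \<nu>"
  using sets_parity_vimage[OF B] by (simp add: sets_state[OF \<nu>])

lemma parity_event_finite: "emeasure \<nu> (parity -` B) \<noteq> \<top>"
  using prob_space.emeasure_le_1[OF state_prob_space[OF \<nu>], of "parity -` B"] by (auto simp: top_unique)

lemma state_uniform: "state (uniform_measure \<nu> (parity -` B))"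
  using prob_space_uniform_measure[OF pos] parity_event_finite by (simp add: state_def sets_state[OF \<nu>])

text \<open>A step does not change parities on \<open>X_star\<close>, so conditioning on a parity
  event commutes with it. As \<open>B\<close> is arbitrary, translation invariance may be lost
  here.\<close>

lemma stationary_uniform: "stationary ssm (uniform_measure \<nu> (parity -` B))"
proof (rule stationaryI[OF state_uniform])
  fix A :: "(int \<Rightarrow> nat) set" assume A: "A \<in> sets config_space"
  have AC: "A \<inter> parity -` B \<in> sets config_space" using A sets_parity_vimage[OF B] by auto
  have "(\<integral>\<^sup>+ n. emeasure (ssm n) A \<partial>uniform_measure \<nu> (parity -` B)) =
      (\<integral>\<^sup>+ n. emeasure (ssm n) A * indicator (parity -` B) n \<partial>\<nu>) / emeasure \<nu> (parity -` B)"
    using measurable_emeasure_ssm[OF A] sets_parity_event by (intro nn_integral_uniform_measure) (auto simp: measurable_state[OF \<nu>])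
  also have "(\<integral>\<^sup>+ n. emeasure (ssm n) A * indicator (parity -` B) n \<partial>\<nu>) = (\<integral>\<^sup>+ n. emeasure (ssm n) (A \<inter> parity -` B) \<partial>\<nu>)"
  proof (rule nn_integral_cong_AE)
    show "AE n in \<nu>. emeasure (ssm n) A * indicator (parity -` B) n = emeasure (ssm n) (A \<inter> parity -` B)"
      using X by eventually_elim (simp add: emeasure_ssm A AC ssm_step_parts indicator_def)
  qed
  also have "\<dots> = emeasure \<nu> (A \<inter> parity -` B)" by (rule stationary_nn_integral[OF \<nu> st AC])
  also have "\<dots> / emeasure \<nu> (parity -` B) = emeasure (uniform_measure \<nu> (parity -` B)) A"
    using A sets_parity_event by (simp add: emeasure_uniform_measure sets_state[OF \<nu>] Int_commute)
  finally show "(\<integral>\<^sup>+ n. emeasure (ssm n) A \<partial>uniform_measure \<nu> (parity -` B)) = emeasure (uniform_measure \<nu> (parity -` B)) A" .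
qed

lemma AE_uniform: "AE n in \<nu>. P n \<Longrightarrow> AE n in uniform_measure \<nu> (parity -` B). P n"
  by (rule AE_uniform_measureI[OF sets_parity_event]) auto

end

lemma translation_invariant_parity:
  assumes \<nu>: "state \<nu>" and TI: "translation_invariant \<nu>"
  shows "translation_invariant (distr \<nu> config_space parity)"
proof (rule translation_invariantI)
  show "state (distr \<nu> config_space parity)" by (rule state_distr_state[OF \<nu>]) measurable
  fix B :: "(int \<Rightarrow> bool) set" assume B: "B \<in> sets config_space"
  have tB: "translate (- 1) -` B \<in> sets config_space" using measurable_sets[OF measurable_translate B] by simp
  have "parity -` (translate (- 1) -` B) = translate (- 1) -` (parity -` B)"
    by (auto simp: parity_def translate_def)
  then show "emeasure (distr \<nu> config_space parity) (translate (- 1) -` B) = emeasure (distr \<nu> config_space parity) B"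
    using emeasure_translate[OF \<nu> TI sets_parity_vimage[OF B], of "- 1"]
    by (simp only: emeasure_distr_state[OF \<nu> measurable_parity B] emeasure_distr_state[OF \<nu> measurable_parity tB])
qed

lemma AE_distr_state:
  assumes "state \<nu>" "f \<in> measurable config_space config_space" "{n. P n} \<in> sets config_space"
  shows "(AE n in distr \<nu> config_space f. P n) \<longleftrightarrow> (AE n in \<nu>. P (f n))"
  by (rule AE_distr_iff) (use assms in \<open>auto simp: measurable_state\<close>)

lemma stationary_even_part:
  assumes \<nu>: "state \<nu>" and st: "stationary ssm \<nu>" and X: "AE n in \<nu>. n \<in> X_star"
  shows "stationary ssm (distr \<nu> config_space even_part)"
proof (rule stationaryI)
  show "state (distr \<nu> config_space even_part)"
    by (rule state_distr_state[OF \<nu>]) measurable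
  fix A :: "(int \<Rightarrow> nat) set" assume A: "A \<in> sets config_space"
  have A': "even_part -` A \<in> sets config_space" by (rule sets_even_part_vimage[OF A])
  have "(\<integral>\<^sup>+ n. emeasure (ssm n) A \<partial>distr \<nu> config_space even_part) = (\<integral>\<^sup>+ n. emeasure (ssm (even_part n)) A \<partial>\<nu>)"
    by (rule nn_integral_distr) (use measurable_emeasure_ssm[OF A] \<nu> in \<open>auto simp: measurable_state\<close>)
  also have "\<dots> = (\<integral>\<^sup>+ n. emeasure (ssm n) (even_part -` A) \<partial>\<nu>)"
  proof (rule nn_integral_cong_AE)
    show "AE n in \<nu>. emeasure (ssm (even_part n)) A = emeasure (ssm n) (even_part -` A)"
      using X by eventually_elim (simp add: emeasure_ssm A A' ssm_step_parts)
  qed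
  also have "\<dots> = emeasure \<nu> (even_part -` A)" by (rule stationary_nn_integral[OF \<nu> st A'])
  also have "\<dots> = emeasure (distr \<nu> config_space even_part) A"
    by (rule emeasure_distr_state[OF \<nu> measurable_even_part A, symmetric])
  finally show "(\<integral>\<^sup>+ n. emeasure (ssm n) A \<partial>distr \<nu> config_space even_part) = emeasure (distr \<nu> config_space even_part) A" .
qed

text \<open>Of two adjacent stacks one is tall, so their heights add up to at least 2. This places
  the density of the even part in the range where uniqueness is assumed, and yields the bound
  \<open>\<kappa> \<le> r - 1\<close>.\<close>

lemma density_X_star_even:
  assumes m: "m \<in> X_star_even" and d: "config_density real m d"
  shows "1 \<le> d"
proof -
  have pair: "2 \<le> m i + m (i + 1)" for i
  proof -
    have "\<not> (m i \<le> 1 \<and> m (i + 1) \<le> 1)" using m by (auto simp: X_star_even_def X_star_def short_def)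
    then show ?thesis by linarith
  qed
  \<comment> \<open>Pairing leaves one site over when \<open>N\<close> is odd, hence the loss of
    1.\<close>
  have "real N - 1 \<le> (\<Sum>k<N. real (m (1 + int k)))" for N
  proof (induction N rule: nat_less_induct)
    case (1 N)
    show ?case
    proof (cases "N \<le> 1")
      case True
      have "0 \<le> (\<Sum>k<N. real (m (1 + int k)))" by (intro sum_nonneg) simp
      then show ?thesis using True by linarith
    next
      case False
      then obtain M where N: "N = Suc (Suc M)" by (metis One_nat_def not_less_eq_eq not0_implies_Suc le_0_eq le_SucE nat_le_linear)
      have "2 \<le> real (m (1 + int M)) + real (m (1 + int (Suc M)))"
        using pair[of "1 + int M"] by (simp add: algebra_simps)
      moreover have "real M - 1 \<le> (\<Sum>k<M. real (m (1 + int k)))" using 1 N by simp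
      ultimately show ?thesis unfolding N by simp
    qed
  qed
  then have low: "1 - 1 / real N \<le> (\<Sum>k<N. real (m (1 + int k))) / real N" if "0 < N" for N
  proof -
    have "(real N - 1) / real N \<le> (\<Sum>k<N. real (m (1 + int k))) / real N"
      using \<open>\<And>N. real N - 1 \<le> (\<Sum>k<N. real (m (1 + int k)))\<close> by (intro divide_right_mono) auto
    then show ?thesis using that by (simp add: diff_divide_distrib)
  qed
  have "(\<lambda>N. 1 - 1 / real N) \<longlonglongrightarrow> 1 - 0" by (intro tendsto_diff tendsto_const lim_1_over_n)
  then have lim: "(\<lambda>N. 1 - 1 / real N) \<longlonglongrightarrow> 1" by simp
  have "(\<lambda>N. (\<Sum>k<N. real (m (1 + int k))) / real N) \<longlonglongrightarrow> d"
    using d by (simp add: config_density_def averages_to_def)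
  from LIMSEQ_le[OF lim this] low show ?thesis by (metis less_le_trans zero_less_one)
qed

lemma config_density_even_part:
  assumes "config_density real n r" "config_density of_bool (parity n) \<kappa>"
  shows "config_density real (even_part n) (r - \<kappa>)"
proof -
  have "real (even_part n i) = real (n i) - of_bool (parity n i)" for i
    by (cases "even (n i)") (auto simp: even_part_def parity_def odd_iff_mod_2_eq_one even_iff_mod_2_eq_zero elim!: oddE)
  then show ?thesis
    using assms by (auto simp: config_density_def intro!: averages_to_diff)
qed

lemma config_density_gamma_map:
  assumes "config_density real m d" "config_density of_bool \<sigma> \<kappa>"
  shows "config_density real (gamma_map (m, \<sigma>)) (d + \<kappa>)"
  using assms by (auto simp: config_density_def gamma_map_def intro!: averages_to_add)

lemma stationary_translate:
  assumes \<nu>: "state \<nu>" and st: "stationary ssm \<nu>"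
  shows "stationary ssm (distr \<nu> config_space (translate 1))"
proof (rule stationaryI)
  show "state (distr \<nu> config_space (translate 1))"
    by (rule state_distr_state[OF \<nu>]) measurable
  fix A :: "(int \<Rightarrow> nat) set" assume A: "A \<in> sets config_space"
  have A': "translate 1 -` A \<in> sets config_space" using measurable_sets[OF measurable_translate A] by simp
  have "(\<integral>\<^sup>+ n. emeasure (ssm n) A \<partial>distr \<nu> config_space (translate 1)) = (\<integral>\<^sup>+ n. emeasure (ssm (translate 1 n)) A \<partial>\<nu>)"
    by (rule nn_integral_distr) (use measurable_emeasure_ssm[OF A] \<nu> in \<open>auto simp: measurable_state\<close>)
  also have "\<dots> = (\<integral>\<^sup>+ n. emeasure (ssm n) (translate 1 -` A) \<partial>\<nu>)"
  proof (rule nn_integral_cong)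
    fix n
    have "(\<lambda>\<omega>. ssm_step \<omega> (translate 1 n)) \<in> measurable coins config_space"
      using measurable_compose[OF measurable_Pair1' measurable_ssm_step, of "translate 1 n"] by simp
    then have "{\<omega>. ssm_step \<omega> (translate 1 n) \<in> A} \<in> sets coins"
      using measurable_sets[OF _ A, of _ coins] by (simp add: space_state[OF state_coins] vimage_def)
    then have "emeasure coins {\<omega>. ssm_step \<omega> (translate 1 n) \<in> A} =
        emeasure coins (translate 1 -` {\<omega>. ssm_step \<omega> (translate 1 n) \<in> A})"
      by (intro emeasure_translate[OF state_coins translation_invariant_coins, symmetric]) (simp add: sets_coins)
    then show "emeasure (ssm (translate 1 n)) A = emeasure (ssm n) (translate 1 -` A)"
      unfolding emeasure_ssm[OF A] emeasure_ssm[OF A'] by (simp add: vimage_def ssm_step_translate)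
  qed
  also have "\<dots> = emeasure \<nu> (translate 1 -` A)" by (rule stationary_nn_integral[OF \<nu> st A'])
  also have "\<dots> = emeasure (distr \<nu> config_space (translate 1)) A"
    by (rule emeasure_distr_state[OF \<nu> measurable_translate A, symmetric])
  finally show "(\<integral>\<^sup>+ n. emeasure (ssm n) A \<partial>distr \<nu> config_space (translate 1)) = emeasure (distr \<nu> config_space (translate 1)) A" .
qed

lemma sets_X_star: "X_star \<in> sets config_space" "X_star_even \<in> sets config_space"
proof -
  have "{n \<in> space config_space. \<forall>i. \<not> (short (n i) \<and> short (n (i + 1)))} \<in> sets config_space" by measurable
  then show X: "X_star \<in> sets config_space" by (simp add: X_star_def)
  have [measurable]: "Measurable.pred config_space (\<lambda>n. even (n (i::int) :: nat))" for i
    by (rule measurable_compose[OF measurable_config_component]) simp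
  have "{n \<in> space config_space. \<forall>i::int. even (n i :: nat)} \<in> sets config_space" by measurable
  from sets.Int[OF X this] show "X_star_even \<in> sets config_space" by (simp add: X_star_even_def Int_def)
qed

lemma X_star_even_translate: "translate 1 m \<in> X_star_even \<longleftrightarrow> m \<in> X_star_even"
  by (auto simp: X_star_even_def X_star_def) (metis add_diff_cancel diff_add_eq)+

section \<open>Consequences of the uniqueness of \<open>\<mu>\<^sub>e\<close>\<close>

lemma sets_pair_state: "state \<mu> \<Longrightarrow> state \<nu> \<Longrightarrow> sets (\<mu> \<Otimes>\<^sub>M \<nu>) = sets (config_space \<Otimes>\<^sub>M config_space)"
  by (intro sets_pair_measure_cong sets_state)

context
  assumes unique: "\<forall>\<rho>\<^sub>e \<ge> 1. \<forall>\<mu>.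
      state_on X_star_even \<mu> \<and> stationary ssm \<mu> \<and> has_density real \<mu> \<rho>\<^sub>e \<longleftrightarrow> \<mu> = mu_e \<rho>\<^sub>e"
begin

text \<open>Translation invariance comes out of uniqueness: the translate of \<open>mu_e d\<close>
  is again stationary on \<open>X_star_even\<close> with density \<open>d\<close>.\<close>

lemma mu_e_properties:
  assumes "1 \<le> d"
  shows "state (mu_e d)" "AE m in mu_e d. m \<in> X_star_even" "stationary ssm (mu_e d)" "has_density real (mu_e d) d"
    "translation_invariant (mu_e d)"
proof -
  have *: "state_on X_star_even (mu_e d) \<and> stationary ssm (mu_e d) \<and> has_density real (mu_e d) d"
    using unique assms by blast
  then show S: "state (mu_e d)" and X: "AE m in mu_e d. m \<in> X_star_even" and st: "stationary ssm (mu_e d)" and d: "has_density real (mu_e d) d"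
    by (auto simp: state_on_def)
  have "state_on X_star_even (distr (mu_e d) config_space (translate 1))"
    unfolding state_on_def
  proof
    show "state (distr (mu_e d) config_space (translate 1))"
      by (rule state_distr_state[OF S]) measurable
    show "AE n in distr (mu_e d) config_space (translate 1). n \<in> X_star_even"
      using X sets_X_star by (subst AE_distr_state[OF S]) (auto simp: X_star_even_translate)
  qed
  moreover have "has_density real (distr (mu_e d) config_space (translate 1)) d"
    unfolding has_density_iff using d sets_config_density[of real d]
    by (subst AE_distr_state[OF S]) (auto simp: has_density_iff config_density_translate)
  ultimately show "translation_invariant (mu_e d)"
    unfolding translation_invariant_def using unique assms stationary_translate[OF S st] by blast
qed

lemma eq_mu_hat:
  assumes \<nu>: "state \<nu>" and st: "stationary ssm \<nu>" and X: "AE n in \<nu>. n \<in> X_star"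
    and dens: "has_density real \<nu> r" and \<kappa>: "has_density of_bool (distr \<nu> config_space parity) \<kappa>"
  shows "\<kappa> \<le> r - 1 \<and> \<nu> = mu_hat r \<kappa> (distr \<nu> config_space parity)"
proof -
  let ?lam = "distr \<nu> config_space parity"
  interpret prob_space \<nu> by (rule state_prob_space[OF \<nu>])
  have lam: "state ?lam" by (rule state_distr_state[OF \<nu>]) measurable
  have lam_B: "emeasure ?lam B = emeasure \<nu> (parity -` B)" if "B \<in> sets config_space" for B
    by (rule emeasure_distr_state[OF \<nu> measurable_parity that])
  have "AE n in \<nu>. config_density of_bool (parity n) \<kappa>"
    using \<kappa> sets_config_density[of of_bool \<kappa>] unfolding has_density_iff by (subst (asm) AE_distr_state[OF \<nu>]) auto
  with dens[unfolded has_density_iff] have ev: "AE n in \<nu>. config_density real (even_part n) (r - \<kappa>)"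
    by eventually_elim (rule config_density_even_part)
  have d: "1 \<le> r - \<kappa>"
  proof -
    have "AE n in \<nu>. 1 \<le> r - \<kappa>"
      using ev X by eventually_elim (use density_X_star_even even_part_X_star in blast)
    then show ?thesis by simp
  qed
  \<comment> \<open>Independence on rectangles: the conditional law of the even part, given any
    parity event of positive probability, meets the three conditions that characterize
    \<open>mu_e (r - \<kappa>)\<close>.\<close>
  have prod: "emeasure (mu_e (r - \<kappa>)) A * emeasure ?lam B = emeasure \<nu> (even_part -` A \<inter> parity -` B)"
    if A: "A \<in> sets config_space" and B: "B \<in> sets config_space" for A B
  proof (cases "emeasure \<nu> (parity -` B) = 0")
    case True
    have "emeasure \<nu> (even_part -` A \<inter> parity -` B) \<le> emeasure \<nu> (parity -` B)"
      using sets_parity_vimage[OF B] by (intro emeasure_mono) (auto simp: sets_state[OF \<nu>])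
    then show ?thesis using True by (simp add: lam_B[OF B])
  next
    case False
    let ?C = "parity -` B"
    let ?u = "uniform_measure \<nu> ?C"
    note u = state_uniform[OF \<nu> st X B False] stationary_uniform[OF \<nu> st X B False] AE_uniform[OF \<nu> st X B False]
    let ?m = "distr ?u config_space even_part"
    have "state_on X_star_even ?m"
      unfolding state_on_def
    proof
      show "state ?m" by (rule state_distr_state[OF u(1)]) measurable
      show "AE n in ?m. n \<in> X_star_even"
        using u(3)[OF X] sets_X_star even_part_X_star by (subst AE_distr_state[OF u(1)]) auto
    qed
    moreover have "stationary ssm ?m" by (rule stationary_even_part[OF u(1,2) u(3)[OF X]])
    moreover have "has_density real ?m (r - \<kappa>)"
      unfolding has_density_iff using u(3)[OF ev] sets_config_density[of real "r - \<kappa>"]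
      by (subst AE_distr_state[OF u(1)]) auto
    ultimately have m: "?m = mu_e (r - \<kappa>)" using unique d by blast
    have "emeasure ?m A = emeasure ?u (even_part -` A)"
      using A u(1) by (subst emeasure_distr) (auto simp: measurable_state space_state[OF \<nu>])
    also have "\<dots> = emeasure \<nu> (?C \<inter> even_part -` A) / emeasure \<nu> ?C"
      using sets_parity_vimage[OF B] sets_even_part_vimage[OF A]
      by (intro emeasure_uniform_measure) (auto simp: sets_state[OF \<nu>])
    finally have "emeasure (mu_e (r - \<kappa>)) A = emeasure \<nu> (even_part -` A \<inter> ?C) / emeasure \<nu> ?C"
      by (simp add: m Int_commute)
    then show ?thesis
      using ennreal_times_divide_cancel[OF False parity_event_finite[OF \<nu> st X B False]] by (simp add: lam_B[OF B] mult.commute)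
  qed
  note [measurable_cong] = sets_state[OF \<nu>]
  have parts: "(\<lambda>n. (even_part n, parity n)) \<in> measurable \<nu> (config_space \<Otimes>\<^sub>M config_space)"
    by measurable
  note e = mu_e_properties[OF d]
  have pair: "mu_e (r - \<kappa>) \<Otimes>\<^sub>M ?lam = distr \<nu> (config_space \<Otimes>\<^sub>M config_space) (\<lambda>n. (even_part n, parity n))"
  proof (rule pair_measure_eqI)
    show "sigma_finite_measure (mu_e (r - \<kappa>))" "sigma_finite_measure ?lam"
      using e(1) lam by (auto intro!: prob_space_imp_sigma_finite state_prob_space)
    show "sets (mu_e (r - \<kappa>) \<Otimes>\<^sub>M ?lam) = sets (distr \<nu> (config_space \<Otimes>\<^sub>M config_space) (\<lambda>n. (even_part n, parity n)))"
      using sets_pair_state[OF e(1) lam] by simp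
    fix A B assume "A \<in> sets (mu_e (r - \<kappa>))" "B \<in> sets ?lam"
    then have AB: "A \<in> sets config_space" "B \<in> sets config_space" by (simp_all add: sets_state[OF e(1)])
    have "emeasure (distr \<nu> (config_space \<Otimes>\<^sub>M config_space) (\<lambda>n. (even_part n, parity n))) (A \<times> B) =
        emeasure \<nu> ((\<lambda>n. (even_part n, parity n)) -` (A \<times> B) \<inter> space \<nu>)"
      using AB by (intro emeasure_distr[OF parts]) auto
    also have "(\<lambda>n. (even_part n, parity n)) -` (A \<times> B) \<inter> space \<nu> = even_part -` A \<inter> parity -` B"
      by (auto simp: space_state[OF \<nu>])
    finally show "emeasure (mu_e (r - \<kappa>)) A * emeasure ?lam B =
        emeasure (distr \<nu> (config_space \<Otimes>\<^sub>M config_space) (\<lambda>n. (even_part n, parity n))) (A \<times> B)"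
      by (simp only: prod[OF AB])
  qed
  have "mu_hat r \<kappa> ?lam = distr \<nu> config_space (\<lambda>n. n)"
    unfolding mu_hat_def pair
    by (subst distr_distr[OF measurable_gamma_map parts]) (simp add: comp_def gamma_map_parts)
  also have "\<dots> = \<nu>" by (rule distr_id2[OF sets_state[OF \<nu>, symmetric]])
  finally show ?thesis using d by simp
qed

end

lemma has_density_uniform:
  assumes "C \<in> sets \<nu>" "has_density v \<nu> r"
  shows "has_density v (uniform_measure \<nu> C) r"
  using assms unfolding has_density_iff by (intro AE_uniform_measureI) auto

lemma TIS_uniform:
  assumes \<nu>: "TIS ssm \<nu>" and X: "AE n in \<nu>. n \<in> X_star" and B: "B \<in> sets config_space"
    and inv: "translate 1 -` B = B" and pos: "emeasure \<nu> (parity -` B) \<noteq> 0"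
  shows "TIS ssm (uniform_measure \<nu> (parity -` B))"
proof -
  let ?C = "parity -` B"
  have S: "state \<nu>" and TI: "translation_invariant \<nu>" and st: "stationary ssm \<nu>"
    using \<nu> by (auto simp: TIS_def)
  have C: "?C \<in> sets config_space" by (rule sets_parity_vimage[OF B])
  have "translate (- 1) -` (translate 1 -` B) = B" by auto
  then have inv': "translate (- 1) -` B = B" by (simp only: inv)
  have parity_translate: "parity (translate k n) = translate k (parity n)" for k n
    by (simp add: parity_def fun_eq_iff)
  have Cinv: "translate (- 1) n \<in> ?C \<longleftrightarrow> n \<in> ?C" for n
  proof -
    have "translate (- 1) n \<in> ?C \<longleftrightarrow> parity n \<in> translate (- 1) -` B" by (simp add: parity_translate)
    then show ?thesis by (simp only: inv' vimage_eq)
  qed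
  have "translation_invariant (uniform_measure \<nu> ?C)"
  proof (rule translation_invariantI[OF state_uniform[OF S st X B pos]])
    fix A :: "(int \<Rightarrow> nat) set" assume A: "A \<in> sets config_space"
    have tA: "translate (- 1) -` A \<in> sets config_space" using measurable_sets[OF measurable_translate A] by simp
    have "?C \<inter> translate (- 1) -` A = translate (- 1) -` (?C \<inter> A)" using Cinv by auto
    moreover have "emeasure \<nu> (translate (- 1) -` (?C \<inter> A)) = emeasure \<nu> (?C \<inter> A)"
      using A C by (intro emeasure_translate[OF S TI]) auto
    ultimately have "emeasure \<nu> (?C \<inter> translate (- 1) -` A) = emeasure \<nu> (?C \<inter> A)" by (simp only:)
    then show "emeasure (uniform_measure \<nu> ?C) (translate (- 1) -` A) = emeasure (uniform_measure \<nu> ?C) A"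
      using A tA C by (simp only: emeasure_uniform_measure sets_state[OF S])
  qed
  then show ?thesis
    using state_uniform[OF S st X B pos] stationary_uniform[OF S st X B pos] by (simp add: TIS_def)
qed

lemma regular_Phi:
  assumes "TIS ssm \<nu>" "Phi_Z \<nu> < \<infinity>"
  shows "regular (Phi \<nu>)"
proof -
  have S: "state \<nu>" using assms by (simp add: TIS_def)
  have P: "{\<eta> :: int \<Rightarrow> bool. \<not> (\<forall>i. \<eta> i)} \<in> sets config_space"
  proof -
    have "{\<eta> \<in> space config_space. \<not> (\<forall>i::int. \<eta> i)} \<in> sets config_space" by measurable
    then show ?thesis by simp
  qed
  have "AE \<eta> in Phi \<nu>. \<not> (\<forall>i. \<eta> i)"
  proof (rule AE_Phi[OF S P], rule AE_I2, rule allI)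
    fix n j
    have "\<not> translate (- int j) (subst_map n) (1 - int j)" by simp
    then show "\<not> (\<forall>i. translate (- int j) (subst_map n) i)" by blast
  qed
  then have "measure (Phi \<nu>) {\<eta>. \<forall>i. \<eta> i} = 0"
    using AE_iff_measurable[of "{\<eta>. \<forall>i. \<eta> i}" "Phi \<nu>" "\<lambda>\<eta>. \<not> (\<forall>i. \<eta> i)"]
      sets.compl_sets[OF P] space_state[OF state_Phi[OF S assms(2)]]
    by (simp add: measure_def Compl_eq_Diff_UNIV[symmetric] Collect_neg_eq[symmetric])
  moreover have "{\<eta> :: int \<Rightarrow> bool. \<forall>i. \<eta> i} = {\<lambda>_. True}" by (auto simp: fun_eq_iff)
  ultimately show ?thesis
    using TIS_Phi[OF assms] by (simp add: regular_def TIS_def)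
qed

text \<open>The bound \<open>\<rho> < 1\<close> holds because a zero at site 1 has probability
  \<open>1 - \<rho>\<close>, which is positive. The threshold 1/2 is the particle density at which
  the stack density \<open>\<rho> / (1 - \<rho>)\<close> equals 1.\<close>

lemma palm_dense:
  assumes \<mu>: "TIS fssep \<mu>" "regular \<mu>" and dens: "has_density of_bool \<mu> \<rho>" and \<rho>: "1 / 2 < \<rho>"
  shows "\<rho> < 1" "TIS ssm (palm \<mu>)" "has_density real (palm \<mu>) (\<rho> / (1 - \<rho>))" "1 < \<rho> / (1 - \<rho>)"
    "AE n in palm \<mu>. n \<in> X_star" "Phi (palm \<mu>) = \<mu>"
proof -
  have S: "state \<mu>" and TI: "translation_invariant \<mu>" and st: "stationary fssep \<mu>"
    using \<mu> by (auto simp: TIS_def)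
  note zeros = AE_zeros_unbounded[OF \<mu>(2)]
  interpret prob_space \<mu> by (rule state_prob_space[OF S])
  have Z: "{\<eta>. \<not> \<eta> (1::int)} \<in> sets \<mu>" using sets_zero_at by (simp add: sets_state[OF S])
  have "\<rho> = (\<integral>\<eta>. of_bool (\<eta> 1) \<partial>\<mu>)"
    by (rule integral_eq_density[OF S TI _ dens, symmetric, of 1]) auto
  also have "\<dots> = (\<integral>\<eta>. 1 - indicator {\<eta>. \<not> \<eta> 1} \<eta> \<partial>\<mu>)"
    by (intro Bochner_Integration.integral_cong) (auto simp: indicator_def)
  also have "\<dots> = 1 - prob {\<eta>. \<not> \<eta> 1}"
  proof -
    have "integrable \<mu> (indicator {\<eta>. \<not> \<eta> (1::int)} :: _ \<Rightarrow> real)"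
      by (rule integrable_const_bound[where B = 1]) (use Z in \<open>auto simp: indicator_def\<close>)
    then show ?thesis using Z by (simp add: prob_space)
  qed
  finally have "\<rho> = 1 - prob {\<eta>. \<not> \<eta> 1}" .
  moreover have "prob {\<eta>. \<not> \<eta> 1} \<noteq> 0" using emeasure_zero_pos[OF S TI zeros] by (simp add: emeasure_eq_measure)
  moreover have "0 \<le> prob {\<eta>. \<not> \<eta> 1}" by simp
  ultimately show \<rho>1: "\<rho> < 1" by linarith
  show "TIS ssm (palm \<mu>)" by (rule TIS_palm[OF S TI zeros st])
  moreover show "has_density real (palm \<mu>) (\<rho> / (1 - \<rho>))" by (rule has_density_palm[OF S zeros dens \<rho>1])
  moreover show "1 < \<rho> / (1 - \<rho>)" using \<rho> \<rho>1 by (simp add: field_simps)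
  ultimately show "AE n in palm \<mu>. n \<in> X_star" by (rule AE_X_star)
  show "Phi (palm \<mu>) = \<mu>" by (rule Phi_palm[OF S TI zeros])
qed

context
  assumes unique: "\<forall>\<rho>\<^sub>e \<ge> 1. \<forall>\<mu>.
      state_on X_star_even \<mu> \<and> stationary ssm \<mu> \<and> has_density real \<mu> \<rho>\<^sub>e \<longleftrightarrow> \<mu> = mu_e \<rho>\<^sub>e"
begin

section \<open>The states built from \<open>mu_hat\<close> are stationary and extremal\<close>

context
  fixes r \<kappa> :: real and lam :: "(int \<Rightarrow> bool) measure"
  assumes r: "1 < r" and erg: "ergodic_TI lam" and \<kappa>: "has_density of_bool lam \<kappa>" and le: "\<kappa> \<le> r - 1"
begin

lemma lam_state: "state lam" "translation_invariant lam"
  using erg by (auto simp: ergodic_TI_def)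

lemma one_le_diff: "1 \<le> r - \<kappa>"
  using le by simp

lemmas mu_e_diff = mu_e_properties[OF unique one_le_diff]

lemma measurable_pair_e: "measurable (mu_e (r - \<kappa>) \<Otimes>\<^sub>M lam) N = measurable (config_space \<Otimes>\<^sub>M config_space) N"
  by (rule measurable_cong_sets[OF sets_pair_state[OF mu_e_diff(1) lam_state(1)] refl])

lemma space_pair_e: "space (mu_e (r - \<kappa>) \<Otimes>\<^sub>M lam) = UNIV"
  by (simp add: space_pair_measure space_state[OF mu_e_diff(1)] space_state[OF lam_state(1)])

lemma state_mu_hat: "state (mu_hat r \<kappa> lam)"
  unfolding mu_hat_def
  by (rule state_distr)
     (use mu_e_diff(1) lam_state in \<open>auto simp: measurable_pair_e intro!: prob_space_pair state_prob_space\<close>)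

lemma AE_mu_hat:
  assumes P: "{n. P n} \<in> sets config_space"
    and ae: "AE m in mu_e (r - \<kappa>). AE \<sigma> in lam. P (gamma_map (m, \<sigma>))"
  shows "AE n in mu_hat r \<kappa> lam. P n"
proof -
  interpret M: prob_space "mu_e (r - \<kappa>)" by (rule state_prob_space[OF mu_e_diff(1)])
  interpret L: prob_space lam by (rule state_prob_space[OF lam_state(1)])
  interpret pair_prob_space "mu_e (r - \<kappa>)" lam ..
  have g: "gamma_map \<in> measurable (mu_e (r - \<kappa>) \<Otimes>\<^sub>M lam) config_space"
    by (simp add: measurable_pair_e)
  have "AE x in mu_e (r - \<kappa>) \<Otimes>\<^sub>M lam. P (gamma_map x)"
    by (rule AE_pair_measure) (use measurable_sets[OF g P] ae in \<open>auto simp: vimage_def Int_def conj_commute\<close>)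
  then show ?thesis
    unfolding mu_hat_def using P by (subst AE_distr_iff[OF g]) auto
qed

lemma emeasure_mu_hat:
  assumes A: "A \<in> sets config_space"
  shows "emeasure (mu_hat r \<kappa> lam) A = (\<integral>\<^sup>+ \<sigma>. emeasure (mu_e (r - \<kappa>)) {m. gamma_map (m, \<sigma>) \<in> A} \<partial>lam)"
proof -
  interpret M: prob_space "mu_e (r - \<kappa>)" by (rule state_prob_space[OF mu_e_diff(1)])
  interpret L: prob_space lam by (rule state_prob_space[OF lam_state(1)])
  interpret pair_prob_space "mu_e (r - \<kappa>)" lam ..
  have g: "gamma_map \<in> measurable (mu_e (r - \<kappa>) \<Otimes>\<^sub>M lam) config_space"
    by (simp add: measurable_pair_e)
  have "emeasure (mu_hat r \<kappa> lam) A = emeasure (mu_e (r - \<kappa>) \<Otimes>\<^sub>M lam) (gamma_map -` A \<inter> space (mu_e (r - \<kappa>) \<Otimes>\<^sub>M lam))"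
    unfolding mu_hat_def by (rule emeasure_distr[OF g A])
  also have "\<dots> = (\<integral>\<^sup>+ \<sigma>. emeasure (mu_e (r - \<kappa>)) ((\<lambda>m. (m, \<sigma>)) -` (gamma_map -` A \<inter> space (mu_e (r - \<kappa>) \<Otimes>\<^sub>M lam))) \<partial>lam)"
    by (rule emeasure_pair_measure_alt2[OF measurable_sets[OF g A]])
  finally show ?thesis by (simp add: vimage_def space_pair_e)
qed

lemma has_density_mu_hat: "has_density real (mu_hat r \<kappa> lam) r"
  unfolding has_density_iff
proof (rule AE_mu_hat[OF sets_config_density])
  show "AE m in mu_e (r - \<kappa>). AE \<sigma> in lam. config_density real (gamma_map (m, \<sigma>)) r"
    using mu_e_diff(4)[unfolded has_density_iff]
  proof eventually_elim
    case (elim m)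
    show ?case
      using \<kappa>[unfolded has_density_iff] by eventually_elim (use config_density_gamma_map[OF elim] in fastforce)
  qed
qed

lemma sets_gamma_section: "A \<in> sets config_space \<Longrightarrow> {m. gamma_map (m, \<sigma>) \<in> A} \<in> sets config_space"
proof -
  assume A: "A \<in> sets config_space"
  have "(\<lambda>m. gamma_map (m, \<sigma>)) \<in> measurable config_space config_space"
    using measurable_compose[OF measurable_Pair2' measurable_gamma_map, of \<sigma>] by simp
  from measurable_sets[OF this A] show ?thesis by (simp add: vimage_def)
qed

text \<open>For fixed \<open>\<sigma>\<close>, a step commutes with adding \<open>\<sigma>\<close>
  to an even configuration, so stationarity of \<open>mu_e\<close> can be used under the integral
  over \<open>lam\<close>. Translations act on both factors at once.\<close>

lemma TIS_mu_hat: "TIS ssm (mu_hat r \<kappa> lam)"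
proof -
  have "translation_invariant (mu_hat r \<kappa> lam)"
  proof (rule translation_invariantI[OF state_mu_hat])
    fix A :: "(int \<Rightarrow> nat) set" assume A: "A \<in> sets config_space"
    have tA: "translate (- 1) -` A \<in> sets config_space" using measurable_sets[OF measurable_translate A] by simp
    have gt: "translate (- 1) (gamma_map (m, \<sigma>)) = gamma_map (translate (- 1) m, translate (- 1) \<sigma>)" for m \<sigma>
      by (simp add: gamma_map_def fun_eq_iff)
    let ?h = "\<lambda>\<sigma>. emeasure (mu_e (r - \<kappa>)) {m. gamma_map (m, \<sigma>) \<in> A}"
    interpret M: prob_space "mu_e (r - \<kappa>)" by (rule state_prob_space[OF mu_e_diff(1)])
    interpret L: prob_space lam by (rule state_prob_space[OF lam_state(1)])
    interpret pair_prob_space "mu_e (r - \<kappa>)" lam ..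
    have h: "?h \<in> borel_measurable config_space"
    proof -
      have "gamma_map -` A \<inter> space (mu_e (r - \<kappa>) \<Otimes>\<^sub>M lam) \<in> sets (mu_e (r - \<kappa>) \<Otimes>\<^sub>M lam)"
        using measurable_gamma_map A unfolding measurable_pair_e[symmetric] by (rule measurable_sets)
      from measurable_emeasure_Pair2[OF this] show ?thesis
        by (simp add: measurable_state[OF lam_state(1)] vimage_def space_pair_e)
    qed
    have "emeasure (mu_hat r \<kappa> lam) (translate (- 1) -` A) = (\<integral>\<^sup>+ \<sigma>. ?h (translate (- 1) \<sigma>) \<partial>lam)"
      unfolding emeasure_mu_hat[OF tA]
    proof (rule nn_integral_cong)
      fix \<sigma>
      have "{m. gamma_map (m, \<sigma>) \<in> translate (- 1) -` A} = translate (- 1) -` {m. gamma_map (m, translate (- 1) \<sigma>) \<in> A}"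
        by (auto simp: gt)
      moreover have "emeasure (mu_e (r - \<kappa>)) (translate (- 1) -` {m. gamma_map (m, translate (- 1) \<sigma>) \<in> A}) = ?h (translate (- 1) \<sigma>)"
        by (rule emeasure_translate[OF mu_e_diff(1) mu_e_diff(5) sets_gamma_section[OF A]])
      ultimately show "emeasure (mu_e (r - \<kappa>)) {m. gamma_map (m, \<sigma>) \<in> translate (- 1) -` A} = ?h (translate (- 1) \<sigma>)"
        by (simp only:)
    qed
    also have "\<dots> = (\<integral>\<^sup>+ \<sigma>. ?h \<sigma> \<partial>lam)" by (rule nn_integral_translate[OF lam_state h])
    also have "\<dots> = emeasure (mu_hat r \<kappa> lam) A" by (rule emeasure_mu_hat[OF A, symmetric])
    finally show "emeasure (mu_hat r \<kappa> lam) (translate (- 1) -` A) = emeasure (mu_hat r \<kappa> lam) A" .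
  qed
  moreover have "stationary ssm (mu_hat r \<kappa> lam)"
  proof (rule stationaryI[OF state_mu_hat])
    fix A :: "(int \<Rightarrow> nat) set" assume A: "A \<in> sets config_space"
    interpret M: prob_space "mu_e (r - \<kappa>)" by (rule state_prob_space[OF mu_e_diff(1)])
    interpret L: prob_space lam by (rule state_prob_space[OF lam_state(1)])
    interpret pair_prob_space "mu_e (r - \<kappa>)" lam ..
    have f: "(\<lambda>x. emeasure (ssm (gamma_map x)) A) \<in> borel_measurable (mu_e (r - \<kappa>) \<Otimes>\<^sub>M lam)"
      using measurable_compose[OF measurable_gamma_map measurable_emeasure_ssm[OF A]] by (simp add: measurable_pair_e)
    have "(\<integral>\<^sup>+ n. emeasure (ssm n) A \<partial>mu_hat r \<kappa> lam) = (\<integral>\<^sup>+ x. emeasure (ssm (gamma_map x)) A \<partial>(mu_e (r - \<kappa>) \<Otimes>\<^sub>M lam))"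
      unfolding mu_hat_def using measurable_emeasure_ssm[OF A]
      by (subst nn_integral_distr) (auto simp: measurable_pair_e)
    also have "\<dots> = (\<integral>\<^sup>+ \<sigma>. \<integral>\<^sup>+ m. emeasure (ssm (gamma_map (m, \<sigma>))) A \<partial>mu_e (r - \<kappa>) \<partial>lam)"
      using f by (rule nn_integral_snd[symmetric])
    also have "\<dots> = (\<integral>\<^sup>+ \<sigma>. emeasure (mu_e (r - \<kappa>)) {m. gamma_map (m, \<sigma>) \<in> A} \<partial>lam)"
    proof (rule nn_integral_cong)
      fix \<sigma>
      have "(\<integral>\<^sup>+ m. emeasure (ssm (gamma_map (m, \<sigma>))) A \<partial>mu_e (r - \<kappa>)) =
          (\<integral>\<^sup>+ m. emeasure (ssm m) {m. gamma_map (m, \<sigma>) \<in> A} \<partial>mu_e (r - \<kappa>))"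
      proof (rule nn_integral_cong_AE)
        show "AE m in mu_e (r - \<kappa>). emeasure (ssm (gamma_map (m, \<sigma>))) A = emeasure (ssm m) {m. gamma_map (m, \<sigma>) \<in> A}"
          using mu_e_diff(2)
          by eventually_elim (simp add: emeasure_ssm A sets_gamma_section ssm_step_gamma_map X_star_even_def)
      qed
      also have "\<dots> = emeasure (mu_e (r - \<kappa>)) {m. gamma_map (m, \<sigma>) \<in> A}"
        by (rule stationary_nn_integral[OF mu_e_diff(1) mu_e_diff(3) sets_gamma_section[OF A]])
      finally show "(\<integral>\<^sup>+ m. emeasure (ssm (gamma_map (m, \<sigma>))) A \<partial>mu_e (r - \<kappa>)) =
          emeasure (mu_e (r - \<kappa>)) {m. gamma_map (m, \<sigma>) \<in> A}" .
    qed
    also have "\<dots> = emeasure (mu_hat r \<kappa> lam) A" by (rule emeasure_mu_hat[OF A, symmetric])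
    finally show "(\<integral>\<^sup>+ n. emeasure (ssm n) A \<partial>mu_hat r \<kappa> lam) = emeasure (mu_hat r \<kappa> lam) A" .
  qed
  ultimately show ?thesis using state_mu_hat by (simp add: TIS_def)
qed

lemma Phi_Z_mu_hat: "Phi_Z (mu_hat r \<kappa> lam) < \<infinity>"
  using TIS_mu_hat has_density_mu_hat by (intro Phi_Z_finite) (auto simp: TIS_def)

lemma emeasure_mu_hat_parity:
  assumes B: "B \<in> sets config_space"
  shows "emeasure (mu_hat r \<kappa> lam) (parity -` B) = emeasure lam B"
proof -
  interpret M: prob_space "mu_e (r - \<kappa>)" by (rule state_prob_space[OF mu_e_diff(1)])
  have "emeasure (mu_hat r \<kappa> lam) (parity -` B) = (\<integral>\<^sup>+ \<sigma>. indicator B \<sigma> \<partial>lam)"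
    unfolding emeasure_mu_hat[OF sets_parity_vimage[OF B]]
  proof (rule nn_integral_cong)
    fix \<sigma>
    have "emeasure (mu_e (r - \<kappa>)) {m. gamma_map (m, \<sigma>) \<in> parity -` B} = emeasure (mu_e (r - \<kappa>)) {m. \<sigma> \<in> B}"
    proof (rule emeasure_eq_AE)
      show "AE m in mu_e (r - \<kappa>). m \<in> {m. gamma_map (m, \<sigma>) \<in> parity -` B} \<longleftrightarrow> m \<in> {m. \<sigma> \<in> B}"
        using mu_e_diff(2) by eventually_elim (simp add: parts_gamma_map X_star_even_def)
      show "{m. gamma_map (m, \<sigma>) \<in> parity -` B} \<in> sets (mu_e (r - \<kappa>))"
        unfolding sets_state[OF mu_e_diff(1)] by (rule sets_gamma_section[OF sets_parity_vimage[OF B]])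
      show "{m. \<sigma> \<in> B} \<in> sets (mu_e (r - \<kappa>))"
        using sets.top[of "mu_e (r - \<kappa>)"] by (cases "\<sigma> \<in> B") (simp_all add: space_state[OF mu_e_diff(1)])
    qed
    then show "emeasure (mu_e (r - \<kappa>)) {m. gamma_map (m, \<sigma>) \<in> parity -` B} = indicator B \<sigma>"
      using M.emeasure_space_1 by (cases "\<sigma> \<in> B") (simp_all add: space_state[OF mu_e_diff(1)])
  qed
  then show ?thesis using B by (simp add: sets_state[OF lam_state(1)])
qed

lemma has_density_Phi_mu_hat: "has_density of_bool (Phi (mu_hat r \<kappa> lam)) (r / (1 + r))"
  by (rule has_density_Phi[OF state_mu_hat has_density_mu_hat])

text \<open>Absolute continuity transfers density and regularity, so the Palm measure of \<mu> lives
  on \<open>X_star\<close>. It also makes the parity law of that Palm measure absolutely continuous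
  with respect to \<open>lam\<close>, hence equal to it by ergodicity. Density and parity law
  determine the Palm measure, and so \<mu>.\<close>

lemma Phi_mu_hat_minimal:
  assumes \<mu>: "TIS fssep \<mu>"
    and ac: "\<And>A. A \<in> sets config_space \<Longrightarrow> emeasure (Phi (mu_hat r \<kappa> lam)) A = 0 \<Longrightarrow> emeasure \<mu> A = 0"
  shows "\<mu> = Phi (mu_hat r \<kappa> lam)"
proof -
  let ?\<nu> = "mu_hat r \<kappa> lam"
  let ?M = "Phi ?\<nu>"
  have S: "state \<mu>" and TI: "translation_invariant \<mu>" using \<mu> by (auto simp: TIS_def)
  have M: "regular ?M" by (rule regular_Phi[OF TIS_mu_hat Phi_Z_mu_hat])
  then have SM: "state ?M" by (simp add: regular_def)
  have ac': "absolutely_continuous ?M \<mu>"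
    using ac by (auto simp: absolutely_continuous_def null_sets_def sets_state[OF S])
  have AE: "AE \<eta> in \<mu>. P \<eta>" if "AE \<eta> in ?M. P \<eta>" for P
    by (rule absolutely_continuous_AE[OF _ ac' that]) (simp add: sets_state[OF S])
  have dens: "has_density of_bool \<mu> (r / (1 + r))"
    using AE has_density_Phi_mu_hat unfolding has_density_iff by blast
  have reg: "regular \<mu>"
  proof -
    have T: "{\<lambda>_::int. True} \<in> sets config_space"
    proof -
      have "{\<eta> \<in> space config_space. \<forall>i::int. \<eta> i} \<in> sets config_space" by measurable
      moreover have "{\<eta> \<in> space config_space. \<forall>i::int. \<eta> i} = {\<lambda>_. True}" by (auto simp: fun_eq_iff)
      ultimately show ?thesis by simp
    qed
    have "emeasure ?M {\<lambda>_. True} = 0"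
      using M prob_space.finite_measure[OF state_prob_space[OF SM]]
      by (simp add: regular_def finite_measure.emeasure_eq_measure)
    then have "emeasure \<mu> {\<lambda>_. True} = 0" by (rule ac[OF T])
    then show ?thesis using S TI by (simp add: regular_def measure_def)
  qed
  \<comment> \<open>The maps \<open>r / (1 + r)\<close> and \<open>\<rho> / (1 - \<rho>)\<close>,
    from stack density to particle density and back, are inverse to each other.\<close>
  have half: "1 / 2 < r / (1 + r)" and odds: "r / (1 + r) / (1 - r / (1 + r)) = r"
    using r by (simp_all add: field_simps)
  note p = palm_dense[OF \<mu> reg dens half, unfolded odds]
  have Sp: "state (palm \<mu>)" and TIp: "translation_invariant (palm \<mu>)" and stp: "stationary ssm (palm \<mu>)"
    using p(2) by (auto simp: TIS_def)
  let ?lam = "distr (palm \<mu>) config_space parity"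
  have "?lam = lam"
  proof (rule ergodic_unique[OF erg])
    show Sl: "state ?lam"
      by (rule state_distr_state[OF Sp]) measurable
    show "translation_invariant ?lam" by (rule translation_invariant_parity[OF Sp TIp])
    fix B :: "(int \<Rightarrow> bool) set" assume B: "B \<in> sets config_space" and 0: "emeasure lam B = 0"
    let ?A = "{\<eta>. \<not> \<eta> 1 \<and> stack_map \<eta> \<in> parity -` B}"
    have pB: "parity -` B \<in> sets config_space" by (rule sets_parity_vimage[OF B])
    have "stack_map -` (parity -` B) \<in> sets config_space"
      using measurable_sets[OF measurable_stack_map pB] by simp
    from sets.Int[OF sets_zero_at this, of 1] have A: "?A \<in> sets config_space"
      by (simp add: vimage_def Int_def)
    have "emeasure (palm ?M) (parity -` B) = 0"
      using 0 by (simp add: palm_Phi[OF state_mu_hat Phi_Z_mu_hat] emeasure_mu_hat_parity[OF B])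
    then have "emeasure ?M ?A = 0"
      using prob_space.emeasure_le_1[OF state_prob_space[OF SM], of "{\<eta>. \<not> \<eta> 1}"]
      unfolding emeasure_palm[OF SM pB] by (auto simp: ennreal_divide_eq_0_iff top_unique)
    then have "emeasure \<mu> ?A = 0" by (rule ac[OF A])
    then show "emeasure ?lam B = 0"
      unfolding emeasure_distr_state[OF Sp measurable_parity B] emeasure_palm[OF S pB] by simp
  qed
  then have "palm \<mu> = mu_hat r \<kappa> lam"
    using eq_mu_hat[OF unique Sp stp p(5) p(3), of \<kappa>] \<kappa> by simp
  then show ?thesis using p(6) by simp
qed

text \<open>Both parts of a convex decomposition with positive weights are absolutely continuous
  with respect to the mixture, so minimality identifies each of them with it.\<close>

lemma ETIS_Phi_mu_hat: "ETIS fssep (Phi (mu_hat r \<kappa> lam))"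
  unfolding ETIS_def
proof (intro conjI allI impI)
  let ?M = "Phi (mu_hat r \<kappa> lam)"
  show M: "TIS fssep ?M" by (rule TIS_Phi[OF TIS_mu_hat Phi_Z_mu_hat])
  fix \<mu>1 \<mu>2 :: "(int \<Rightarrow> bool) measure" and c :: real
  assume a: "TIS fssep \<mu>1 \<and> TIS fssep \<mu>2 \<and> 0 < c \<and> c < 1 \<and>
    (\<forall>A\<in>sets config_space. measure ?M A = c * measure \<mu>1 A + (1 - c) * measure \<mu>2 A)"
  have fm: "finite_measure ?M" "finite_measure \<mu>1" "finite_measure \<mu>2"
    using a M by (auto simp: TIS_def intro: prob_space.finite_measure state_prob_space)
  have null: "measure \<mu>1 A = 0 \<and> measure \<mu>2 A = 0" if "A \<in> sets config_space" "measure ?M A = 0" for A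
  proof -
    have "c * measure \<mu>1 A + (1 - c) * measure \<mu>2 A = 0" using a that by metis
    moreover have "0 \<le> c * measure \<mu>1 A" "0 \<le> (1 - c) * measure \<mu>2 A" using a by simp_all
    ultimately have "c * measure \<mu>1 A = 0" "(1 - c) * measure \<mu>2 A = 0" by linarith+
    then show ?thesis using a by simp
  qed
  have ac: "emeasure \<mu>1 A = 0" "emeasure \<mu>2 A = 0" if "A \<in> sets config_space" "emeasure ?M A = 0" for A
  proof -
    have "measure ?M A = 0" using that(2) by (simp add: measure_def)
    from null[OF that(1) this] show "emeasure \<mu>1 A = 0" "emeasure \<mu>2 A = 0"
      by (simp_all add: finite_measure.emeasure_eq_measure[OF fm(2)] finite_measure.emeasure_eq_measure[OF fm(3)])
  qed
  have "\<mu>1 = ?M" by (rule Phi_mu_hat_minimal[OF _ ac(1)]) (use a in blast)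
  moreover have "\<mu>2 = ?M" by (rule Phi_mu_hat_minimal[OF _ ac(2)]) (use a in blast)
  ultimately show "\<mu>1 = \<mu>2" by simp
qed

end

text \<open>If the parity law were not ergodic, an invariant parity event would split the Palm
  measure into two TIS states. Their images under \<open>Phi\<close> decompose \<mu>, so extremality
  makes them equal; but \<open>palm\<close> recovers from them measures concentrated on
  complementary events.\<close>

lemma ETIS_dense_eq_Phi_mu_hat:
  assumes reg: "regular \<mu>" and E: "ETIS fssep \<mu>" and \<rho>: "1 / 2 < \<rho>" and dens: "has_density of_bool \<mu> \<rho>"
  shows "\<exists>r \<kappa> lam. \<mu> = Phi (mu_hat r \<kappa> lam) \<and> 1 < r \<and> ergodic_TI lam \<and> has_density of_bool lam \<kappa> \<and> \<kappa> \<le> r - 1"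
proof -
  have T: "TIS fssep \<mu>" using E by (simp add: ETIS_def)
  note p = palm_dense[OF T reg dens \<rho>]
  let ?\<nu> = "palm \<mu>" and ?r = "\<rho> / (1 - \<rho>)"
  have S: "state ?\<nu>" and TI: "translation_invariant ?\<nu>" and st: "stationary ssm ?\<nu>"
    using p(2) by (auto simp: TIS_def)
  interpret prob_space ?\<nu> by (rule state_prob_space[OF S])
  let ?lam = "distr ?\<nu> config_space parity"
  have Sl: "state ?lam"
    by (rule state_distr_state[OF S]) measurable
  have TIl: "translation_invariant ?lam" by (rule translation_invariant_parity[OF S TI])
  have erg: "ergodic_TI ?lam"
    unfolding ergodic_TI_def
  proof (intro conjI ballI impI Sl TIl, rule ccontr)
    fix B assume "B \<in> sets ?lam" and inv: "translate 1 -` B = B"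
      and not: "\<not> (measure ?lam B = 0 \<or> measure ?lam B = 1)"
    then have B: "B \<in> sets config_space" by simp
    have B': "- B \<in> sets config_space" using sets.compl_sets[OF B] by (simp add: Compl_eq_Diff_UNIV)
    have inv': "translate 1 -` (- B) = - B" using inv by auto
    let ?C = "parity -` B" and ?C' = "parity -` (- B)"
    have C: "?C \<in> sets ?\<nu>" "?C' \<in> sets ?\<nu>"
      using sets_parity_vimage[OF B] sets_parity_vimage[OF B'] by (simp_all only: sets_state[OF S])
    have "?C' = space ?\<nu> - ?C" by (auto simp: space_state[OF S])
    then have prob_C': "prob ?C' = 1 - prob ?C" using C prob_compl by simp
    have "prob ?C = measure ?lam B" by (simp add: measure_def emeasure_distr_state[OF S measurable_parity B])
    with not prob_C' have pos: "emeasure ?\<nu> ?C \<noteq> 0" "emeasure ?\<nu> ?C' \<noteq> 0"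
      using prob_le_1[of ?C] by (auto simp: emeasure_eq_measure ennreal_eq_0_iff measure_le_0_iff)
    let ?u = "uniform_measure ?\<nu> ?C" and ?u' = "uniform_measure ?\<nu> ?C'"
    have u: "TIS ssm ?u" and u': "TIS ssm ?u'"
      using TIS_uniform[OF p(2,5) B inv pos(1)] TIS_uniform[OF p(2,5) B' inv' pos(2)] by auto
    have Su: "state ?u" and Su': "state ?u'" using u u' by (auto simp: TIS_def)
    have Z: "Phi_Z ?u < \<infinity>" "Phi_Z ?u' < \<infinity>"
      using u u' Phi_Z_finite[OF Su _ has_density_uniform[OF C(1) p(3)]] Phi_Z_finite[OF Su' _ has_density_uniform[OF C(2) p(3)]]
      by (simp_all add: TIS_def)
    \<comment> \<open>\<open>Phi\<close> normalizes by the mean word length, so each part enters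
      with its probability biased by its own mean word length. That the weights add up to 1 comes
      from evaluating the decomposition on the whole space.\<close>
    let ?a = "emeasure ?\<nu> ?C * Phi_Z ?u / Phi_Z ?\<nu>" and ?b = "emeasure ?\<nu> ?C' * Phi_Z ?u' / Phi_Z ?\<nu>"
    have Zn: "Phi_Z ?\<nu> < \<infinity>" by (rule Phi_Z_finite[OF S TI p(3)])
    have mix: "emeasure \<mu> A = ?a * emeasure (Phi ?u) A + ?b * emeasure (Phi ?u') A"
      if A: "A \<in> sets config_space" for A
    proof -
      have ws: "word_sum (indicator A) \<in> borel_measurable ?\<nu>" using A by (simp add: measurable_state[OF S])
      have part: "(\<integral>\<^sup>+ n. word_sum (indicator A) n * indicator D n \<partial>?\<nu>) =
          emeasure ?\<nu> D * Phi_Z (uniform_measure ?\<nu> D) * emeasure (Phi (uniform_measure ?\<nu> D)) A"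
        if D: "D \<in> sets ?\<nu>" "emeasure ?\<nu> D \<noteq> 0" and SD: "state (uniform_measure ?\<nu> D)" "Phi_Z (uniform_measure ?\<nu> D) < \<infinity>" for D
      proof -
        let ?v = "uniform_measure ?\<nu> D"
        have "Phi_Z ?v * emeasure (Phi ?v) A = (\<integral>\<^sup>+ n. word_sum (indicator A) n \<partial>?v)"
          unfolding emeasure_Phi_word_sum[OF SD(1) A]
          using Phi_Z_ge_1[OF SD(1)] SD(2) by (intro ennreal_times_divide_cancel) auto
        also have "\<dots> = (\<integral>\<^sup>+ n. word_sum (indicator A) n * indicator D n \<partial>?\<nu>) / emeasure ?\<nu> D"
          by (rule nn_integral_uniform_measure[OF ws D(1)])
        finally have "emeasure ?\<nu> D * (Phi_Z ?v * emeasure (Phi ?v) A) = (\<integral>\<^sup>+ n. word_sum (indicator A) n * indicator D n \<partial>?\<nu>)"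
          using D(2) by (simp add: ennreal_times_divide_cancel)
        then show ?thesis by (simp add: mult.assoc)
      qed
      have "emeasure \<mu> A = emeasure (Phi ?\<nu>) A" by (simp only: p(6))
      also have "\<dots> = (\<integral>\<^sup>+ n. word_sum (indicator A) n \<partial>?\<nu>) / Phi_Z ?\<nu>" by (rule emeasure_Phi_word_sum[OF S A])
      also have "(\<integral>\<^sup>+ n. word_sum (indicator A) n \<partial>?\<nu>) =
          (\<integral>\<^sup>+ n. word_sum (indicator A) n * indicator ?C n + word_sum (indicator A) n * indicator ?C' n \<partial>?\<nu>)"
        by (intro nn_integral_cong) (auto simp: indicator_def)
      also have "\<dots> = (\<integral>\<^sup>+ n. word_sum (indicator A) n * indicator ?C n \<partial>?\<nu>) + (\<integral>\<^sup>+ n. word_sum (indicator A) n * indicator ?C' n \<partial>?\<nu>)"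
        using ws C by (intro nn_integral_add) auto
      also have "\<dots> = emeasure ?\<nu> ?C * Phi_Z ?u * emeasure (Phi ?u) A + emeasure ?\<nu> ?C' * Phi_Z ?u' * emeasure (Phi ?u') A"
        by (simp only: part[OF C(1) pos(1) Su Z(1)] part[OF C(2) pos(2) Su' Z(2)])
      finally show ?thesis by (simp add: divide_ennreal_def distrib_left distrib_right ac_simps)
    qed
    have T1: "TIS fssep (Phi ?u)" "TIS fssep (Phi ?u')" using TIS_Phi u u' Z by auto
    have Smu: "state \<mu>" using T by (simp add: TIS_def)
    have SP: "state (Phi ?u)" "state (Phi ?u')" using T1 by (auto simp: TIS_def)
    have one: "?a + ?b = 1"
      using mix[of UNIV] sets.top[of "config_space :: (int \<Rightarrow> bool) measure"]
        prob_space.emeasure_space_1[OF state_prob_space[OF Smu]]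
        prob_space.emeasure_space_1[OF state_prob_space[OF SP(1)]]
        prob_space.emeasure_space_1[OF state_prob_space[OF SP(2)]]
      by (simp add: space_state[OF Smu] space_state[OF SP(1)] space_state[OF SP(2)])
    have Zpos: "Phi_Z ?u \<noteq> 0" "Phi_Z ?u' \<noteq> 0" using Phi_Z_ge_1[OF Su] Phi_Z_ge_1[OF Su'] by auto
    have ab: "?a \<noteq> 0" "?b \<noteq> 0" using pos Zpos Zn by (auto simp: ennreal_divide_eq_0_iff)
    have fin: "?a \<noteq> \<top>" "?b \<noteq> \<top>" using one by (auto simp: top_add)
    define c where "c = enn2real ?a"
    have c: "ennreal c = ?a" "0 < c" using fin ab by (auto simp: c_def enn2real_positive_iff zero_less_iff_neq_zero less_top)
    have d: "enn2real ?b = 1 - c" "0 < enn2real ?b"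
    proof -
      have "enn2real (?a + ?b) = c + enn2real ?b" using fin by (simp add: c_def enn2real_plus less_top)
      then show "enn2real ?b = 1 - c" by (simp only: one enn2real_1)
      show "0 < enn2real ?b" using fin ab by (auto simp: enn2real_positive_iff zero_less_iff_neq_zero less_top)
    qed
    have "\<forall>A\<in>sets config_space. measure \<mu> A = c * measure (Phi ?u) A + (1 - c) * measure (Phi ?u') A"
    proof
      fix A :: "(int \<Rightarrow> bool) set" assume A: "A \<in> sets config_space"
      interpret P1: prob_space "Phi ?u" by (rule state_prob_space[OF SP(1)])
      interpret P2: prob_space "Phi ?u'" by (rule state_prob_space[OF SP(2)])
      have "measure \<mu> A = enn2real (?a * emeasure (Phi ?u) A + ?b * emeasure (Phi ?u') A)"
        by (simp only: measure_def mix[OF A])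
      also have "\<dots> = enn2real (?a * emeasure (Phi ?u) A) + enn2real (?b * emeasure (Phi ?u') A)"
        using fin by (intro enn2real_plus) (auto simp: less_top ennreal_mult_less_top P1.emeasure_eq_measure P2.emeasure_eq_measure)
      also have "\<dots> = c * measure (Phi ?u) A + (1 - c) * measure (Phi ?u') A"
        using d(1) by (simp add: enn2real_mult c_def measure_def)
      finally show "measure \<mu> A = c * measure (Phi ?u) A + (1 - c) * measure (Phi ?u') A" .
    qed
    then have "Phi ?u = Phi ?u'"
      using E T1 c(2) d unfolding ETIS_def by (metis diff_gt_0_iff_gt)
    then have "palm (Phi ?u) = palm (Phi ?u')" by simp
    then have "?u = ?u'" using palm_Phi[OF Su Z(1)] palm_Phi[OF Su' Z(2)] by simp
    moreover have "emeasure ?u ?C = 1"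
      using C pos by (simp add: emeasure_uniform_measure ennreal_divide_self emeasure_eq_measure)
    moreover have "emeasure ?u' ?C = 0"
    proof -
      have "?C' \<inter> ?C = {}" by auto
      then show ?thesis using C by (simp add: emeasure_uniform_measure)
    qed
    ultimately show False by simp
  qed
  obtain \<kappa> where \<kappa>: "has_density of_bool ?lam \<kappa>"
    using ergodic_has_density[OF erg, of of_bool 1] by auto
  have "\<kappa> \<le> ?r - 1 \<and> ?\<nu> = mu_hat ?r \<kappa> ?lam"
    by (rule eq_mu_hat[OF unique S st p(5) p(3) \<kappa>])
  then show ?thesis using p(4,6) erg \<kappa> by metis
qed

end

theorem corollary5p8:
  assumes "\<forall>\<rho>\<^sub>e \<ge> 1. \<forall>\<mu>.
      state_on X_star_even \<mu> \<and> stationary ssm \<mu> \<and> has_density real \<mu> \<rho>\<^sub>e \<longleftrightarrow> \<mu> = mu_e \<rho>\<^sub>e"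
  shows "{\<mu>. regular \<mu> \<and> ETIS fssep \<mu> \<and> (\<exists>\<rho> > 1 / 2. has_density of_bool \<mu> \<rho>)} =
           {Phi (mu_hat \<rho>' \<kappa> lam) | \<rho>' \<kappa> lam.
              \<rho>' > 1 \<and> ergodic_TI lam \<and> has_density of_bool lam \<kappa> \<and> \<kappa> \<le> \<rho>' - 1} \<and>
         (\<forall>\<rho>' \<kappa> lam.
            \<rho>' > 1 \<and> ergodic_TI lam \<and> has_density of_bool lam \<kappa> \<and> \<kappa> \<le> \<rho>' - 1 \<longrightarrow>
            has_density of_bool (Phi (mu_hat \<rho>' \<kappa> lam)) (\<rho>' / (1 + \<rho>')))"
proof (intro conjI set_eqI iffI)
  fix \<mu> assume "\<mu> \<in> {\<mu>. regular \<mu> \<and> ETIS fssep \<mu> \<and> (\<exists>\<rho> > 1 / 2. has_density of_bool \<mu> \<rho>)}"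
  then show "\<mu> \<in> {Phi (mu_hat \<rho>' \<kappa> lam) | \<rho>' \<kappa> lam.
      \<rho>' > 1 \<and> ergodic_TI lam \<and> has_density of_bool lam \<kappa> \<and> \<kappa> \<le> \<rho>' - 1}"
    using ETIS_dense_eq_Phi_mu_hat[OF assms] by blast
next
  fix \<mu> assume "\<mu> \<in> {Phi (mu_hat \<rho>' \<kappa> lam) | \<rho>' \<kappa> lam.
      \<rho>' > 1 \<and> ergodic_TI lam \<and> has_density of_bool lam \<kappa> \<and> \<kappa> \<le> \<rho>' - 1}"
  then obtain r \<kappa> lam where \<mu>: "\<mu> = Phi (mu_hat r \<kappa> lam)"
    and a: "1 < r" "ergodic_TI lam" "has_density of_bool lam \<kappa>" "\<kappa> \<le> r - 1" by blast
  have "1 / 2 < r / (1 + r)" using a(1) by (simp add: field_simps)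
  then show "\<mu> \<in> {\<mu>. regular \<mu> \<and> ETIS fssep \<mu> \<and> (\<exists>\<rho> > 1 / 2. has_density of_bool \<mu> \<rho>)}"
    unfolding \<mu>
    using regular_Phi[OF TIS_mu_hat[OF assms a] Phi_Z_mu_hat[OF assms a]] ETIS_Phi_mu_hat[OF assms a]
      has_density_Phi_mu_hat[OF assms a] by blast
qed (use has_density_Phi_mu_hat[OF assms] in blast)

end
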